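(* Let $\alpha\in[0,1)$, $\varepsilon\in(0,1+\alpha)$, let $k\ge4$ be an integer and $f_0\in H^k(\mathbb{R}^2)$ with \[ \|\nabla f_0\|_{L^\infty}<\sqrt{\frac{1+\alpha-\varepsilon}{5+\alpha+\varepsilon}}. \] If $f\in C^1([0,T];H^k(\mathbb{R}^2))$ is the unique solution on $[0,T]$ of \[ \frac{\partial f(x,t)}{\partial t} = \mathrm{PV}\int_{\mathbb{R}^2} \frac{\left(\nabla f(x,t)-\nabla f(x-y,t)\right)\cdot y}{\left[|y|^2+(f(x,t)-f(x-y,t))^2\right]^{\frac{3+\alpha}{2}}}\,dy,\qquad f(x,0)=f_0(x), \] then $\|\nabla f\|_{L^\infty}(t)\le\|\nabla f_0\|_{L^\infty}$ for all $t\in[0,T]$.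
   Context: $\mathrm{PV}$ denotes the principal value; $x\in\mathbb{R}^2$. *)

theory Defs
  imports "HOL-Analysis.Analysis" "HOL-Probability.Essential_Supremum"
begin

definition pd :: "2 \<Rightarrow> (real^2 \<Rightarrow> real) \<Rightarrow> real^2 \<Rightarrow> real" where
  "pd i g x = deriv (\<lambda>s. g (x + s *\<^sub>R axis i 1)) 0"

definition pds :: "2 list \<Rightarrow> (real^2 \<Rightarrow> real) \<Rightarrow> real^2 \<Rightarrow> real" where
  "pds ws g = foldr pd ws g"

definition smooth2 :: "(real^2 \<Rightarrow> real) \<Rightarrow> bool" where
  "smooth2 g \<longleftrightarrow> (\<forall>ws. continuous_on UNIV (pds ws g) \<and>
      (\<forall>i x. (\<lambda>s. pds ws g (x + s *\<^sub>R axis i 1)) differentiable (at 0)))"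

definition test_fun :: "(real^2 \<Rightarrow> real) \<Rightarrow> bool" where
  "test_fun \<phi> \<longleftrightarrow> smooth2 \<phi> \<and> compact (closure {x. \<phi> x \<noteq> 0})"

definition Dab :: "nat \<Rightarrow> nat \<Rightarrow> (real^2 \<Rightarrow> real) \<Rightarrow> real^2 \<Rightarrow> real" where
  "Dab a b g = pds (replicate a 1 @ replicate b 2) g"

definition L2 :: "(real^2 \<Rightarrow> real) \<Rightarrow> bool" where
  "L2 g \<longleftrightarrow> g \<in> borel_measurable lborel \<and> integrable lborel (\<lambda>x. (g x)^2)"

definition loc_int :: "(real^2 \<Rightarrow> real) \<Rightarrow> bool" where
  "loc_int g \<longleftrightarrow> g \<in> borel_measurable lborel \<and>
     (\<forall>K. compact K \<longrightarrow> integrable lborel (\<lambda>x. indicator K x * g x))"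

definition weak_deriv :: "nat \<Rightarrow> nat \<Rightarrow> (real^2 \<Rightarrow> real) \<Rightarrow> (real^2 \<Rightarrow> real) \<Rightarrow> bool" where
  "weak_deriv a b f g \<longleftrightarrow> loc_int f \<and> loc_int g \<and>
     (\<forall>\<phi>. test_fun \<phi> \<longrightarrow>
        (LINT x|lborel. f x * Dab a b \<phi> x) = (-1) ^ (a + b) * (LINT x|lborel. g x * \<phi> x))"

definition Hk :: "nat \<Rightarrow> (real^2 \<Rightarrow> real) \<Rightarrow> bool" where
  "Hk k f \<longleftrightarrow> L2 f \<and> (\<forall>a b. a + b \<le> k \<longrightarrow> (\<exists>g. weak_deriv a b f g \<and> L2 g))"

definition wd :: "nat \<Rightarrow> nat \<Rightarrow> (real^2 \<Rightarrow> real) \<Rightarrow> real^2 \<Rightarrow> real" where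
  "wd a b f = (SOME g. weak_deriv a b f g \<and> L2 g)"

definition Hk_norm :: "nat \<Rightarrow> (real^2 \<Rightarrow> real) \<Rightarrow> real" where
  "Hk_norm k f = sqrt (\<Sum>(a,b)\<in>{(a,b). a + b \<le> k}. LINT x|lborel. (wd a b f x)^2)"

definition C1_Hk :: "real \<Rightarrow> nat \<Rightarrow> (real \<Rightarrow> real^2 \<Rightarrow> real) \<Rightarrow> bool" where
  "C1_Hk T k u \<longleftrightarrow> (\<forall>t\<in>{0..T}. Hk k (u t)) \<and>
     (\<exists>v. (\<forall>t\<in>{0..T}. Hk k (v t)) \<and>
        (\<forall>t\<in>{0..T}. ((\<lambda>s. Hk_norm k (\<lambda>x. (u s x - u t x) / (s - t) - v t x)) \<longlongrightarrow> 0)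
                         (at t within {0..T})) \<and>
        (\<forall>t\<in>{0..T}. ((\<lambda>s. Hk_norm k (\<lambda>x. v s x - v t x)) \<longlongrightarrow> 0) (at t within {0..T})))"

definition grad :: "(real^2 \<Rightarrow> real) \<Rightarrow> real^2 \<Rightarrow> real^2" where
  "grad g x = (\<chi> i. frechet_derivative g (at x) (axis i 1))"

definition Linf_grad :: "(real^2 \<Rightarrow> real) \<Rightarrow> ereal" where
  "Linf_grad g = esssup lborel (\<lambda>x. ereal (norm (grad g x)))"

definition has_pv_integral :: "(real^2 \<Rightarrow> real) \<Rightarrow> real \<Rightarrow> bool" where
  "has_pv_integral K I \<longleftrightarrow>
     ((\<lambda>e. integral {y. e < norm y \<and> norm y < 1 / e} K) \<longlongrightarrow> I) (at_right 0)"

text \<open>f x t is a solution on [0,T] (continuous-differentiable representative in x).\<close>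
definition is_solution :: "real \<Rightarrow> nat \<Rightarrow> real \<Rightarrow> (real^2 \<Rightarrow> real)
     \<Rightarrow> (real^2 \<Rightarrow> real \<Rightarrow> real) \<Rightarrow> bool" where
  "is_solution \<alpha> k T f0 f \<longleftrightarrow>
     C1_Hk T k (\<lambda>t x. f x t) \<and>
     (\<forall>t\<in>{0..T}. \<forall>x. (\<lambda>z. f z t) differentiable (at x)) \<and>
     (\<forall>x. f x 0 = f0 x) \<and>
     (\<forall>x. \<forall>t\<in>{0..T}. \<exists>D. ((\<lambda>s. f x s) has_real_derivative D) (at t within {0..T}) \<and>
        has_pv_integral
          (\<lambda>y. ((grad (\<lambda>z. f z t) x - grad (\<lambda>z. f z t) (x - y)) \<bullet> y) /
               ((norm y)^2 + (f x t - f (x - y) t)^2) powr ((3 + \<alpha>) / 2)) D)"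

end

theory Submission
  imports Defs "HOL-Real_Asymp.Real_Asymp"
begin

text \<open>
  Fix a vector \<open>h\<close> and a time, write \<open>u\<close> for the solution at that time, and let \<open>x\<close> maximize
  \<open>z \<mapsto> u(z + h) - u(z)\<close>; then \<open>\<nabla>u(x + h) = \<nabla>u(x)\<close>. With \<open>q = (u(x) - u(x - y)) / |y|\<close>,
  \<open>a = \<nabla>u(x) \<bullet> y / |y|\<close> and \<open>\<Psi>'(q) = (1 + q\<^sup>2) powr (-(3 + \<alpha>)/2)\<close>, the integrand of the
  equation is \<open>|y| powr (-2 - \<alpha>) ((a - q) \<Psi>'(q) - \<alpha> \<Psi>(q))\<close> minus the divergence of
  \<open>y |y| powr (-2 - \<alpha>) \<Psi>(q)\<close>, up to terms that depend on \<open>a\<close> only. The first part is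
  nonincreasing in \<open>q\<close> as long as \<open>|a|, |q| \<le> L\<close> and \<open>(5 + \<alpha>) L\<^sup>2 \<le> 1 + \<alpha>\<close>, and passing from
  \<open>x\<close> to \<open>x + h\<close> increases every \<open>q\<close>; the difference of the two divergences has a flux through
  small circles that vanishes in the limit and a flux of favourable sign at infinity. Hence the time
  derivative of \<open>u(x + h) - u(x)\<close> is nonpositive, so each maximal increment, and with it the
  Lipschitz constant, cannot grow while it stays below \<open>L\<close>. The gradient of the equation is never
  needed, which is why two bounded derivatives of \<open>u\<close> suffice.

  Continuity in time of the Lipschitz constant and decay at infinity come from \<open>H\<^sup>4\<close>. If \<open>P\<close> is a
  smooth step and \<open>\<rho>\<^sub>n(s) = n P'(n s)\<close>, then \<open>\<rho>\<^sub>n\<close> is \<open>\<rho>\<^sub>1\<close> plus the derivative of a function bounded by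
  1 and supported in the unit interval. So pairing derivatives of order at most two of \<open>u\<close> with
  \<open>\<rho>\<^sub>n \<otimes> \<rho>\<^sub>n\<close> costs at most two further derivatives in \<open>L\<^sup>2\<close>, uniformly in \<open>n\<close>.
\<close>

section \<open>Smooth functions of one variable\<close>

text \<open>The derivative is quantified existentially instead of being written with
  \<open>deriv\<close>, so each closure property below is an induction that exhibits a
  derivative.\<close>

primrec diff_upto :: "nat \<Rightarrow> (real \<Rightarrow> real) \<Rightarrow> bool" where
  "diff_upto 0 f = True"
| "diff_upto (Suc n) f = (\<exists>f'. (\<forall>x. (f has_real_derivative f' x) (at x)) \<and> diff_upto n f')"

lemma diff_upto_Suc_D: "diff_upto (Suc n) f \<Longrightarrow> diff_upto n f"
  by (induction n arbitrary: f) fastforce+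

lemma diff_upto_add: "diff_upto n f \<Longrightarrow> diff_upto n g \<Longrightarrow> diff_upto n (\<lambda>x. f x + g x)"
proof (induction n arbitrary: f g)
  case (Suc n)
  then obtain f' g' where "\<And>x. (f has_real_derivative f' x) (at x)" "diff_upto n f'"
    "\<And>x. (g has_real_derivative g' x) (at x)" "diff_upto n g'" by auto
  then have "\<And>x. ((\<lambda>x. f x + g x) has_real_derivative f' x + g' x) (at x)"
    "diff_upto n (\<lambda>x. f' x + g' x)"
    using Suc.IH by (auto intro!: derivative_intros)
  then show ?case by (auto intro!: exI[of _ "\<lambda>x. f' x + g' x"])
qed simp

lemma diff_upto_mult: "diff_upto n f \<Longrightarrow> diff_upto n g \<Longrightarrow> diff_upto n (\<lambda>x. f x * g x)"
proof (induction n arbitrary: f g)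
  case (Suc n)
  then obtain f' g' where fg: "\<And>x. (f has_real_derivative f' x) (at x)" "diff_upto n f'"
    "\<And>x. (g has_real_derivative g' x) (at x)" "diff_upto n g'" by auto
  have "diff_upto n f" "diff_upto n g" using Suc.prems diff_upto_Suc_D by blast+
  then have "diff_upto n (\<lambda>x. f' x * g x + g' x * f x)"
    using fg Suc.IH diff_upto_add by simp
  moreover have "((\<lambda>x. f x * g x) has_real_derivative f' x * g x + g' x * f x) (at x)" for x
    using fg by (auto intro!: derivative_eq_intros)
  ultimately show ?case by (auto intro!: exI[of _ "\<lambda>x. f' x * g x + g' x * f x"])
qed simp

lemma diff_upto_const: "diff_upto n (\<lambda>x. c)"
proof (induction n arbitrary: c)
  case (Suc n)
  then show ?case by (auto intro!: exI[of _ "\<lambda>x. 0"])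
qed simp

lemma diff_upto_affine: "diff_upto n f \<Longrightarrow> diff_upto n (\<lambda>x. f (a * x + b))"
proof (induction n arbitrary: f)
  case (Suc n)
  then obtain f' where f: "\<And>x. (f has_real_derivative f' x) (at x)" "diff_upto n f'" by auto
  have "((\<lambda>x. f (a * x + b)) has_real_derivative f' (a * x + b) * a) (at x)" for x
    by (rule DERIV_chain2[OF f(1)]) (auto intro!: derivative_eq_intros)
  moreover have "diff_upto n (\<lambda>x. f' (a * x + b) * a)"
    using Suc.IH[OF f(2)] diff_upto_const by (rule diff_upto_mult)
  ultimately show ?case by (auto intro!: exI[of _ "\<lambda>x. f' (a * x + b) * a"])
qed simp

definition smooth1 :: "(real \<Rightarrow> real) \<Rightarrow> bool" where
  "smooth1 f \<longleftrightarrow> (\<forall>n. diff_upto n f)"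

lemma smooth1_add: "smooth1 f \<Longrightarrow> smooth1 g \<Longrightarrow> smooth1 (\<lambda>x. f x + g x)"
  by (simp add: smooth1_def diff_upto_add)

lemma smooth1_mult: "smooth1 f \<Longrightarrow> smooth1 g \<Longrightarrow> smooth1 (\<lambda>x. f x * g x)"
  by (simp add: smooth1_def diff_upto_mult)

lemma smooth1_const: "smooth1 (\<lambda>x. c)"
  by (simp add: smooth1_def diff_upto_const)

lemma smooth1_affine: "smooth1 f \<Longrightarrow> smooth1 (\<lambda>x. f (a * x + b))"
  by (simp add: smooth1_def diff_upto_affine)

lemma smooth1_minus: "smooth1 f \<Longrightarrow> smooth1 g \<Longrightarrow> smooth1 (\<lambda>x. f x - g x)"
  using smooth1_add[of f "\<lambda>x. (-1) * g x"] smooth1_mult[OF smooth1_const[of "-1"], of g] by simp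

lemma smooth1_has_deriv: "smooth1 f \<Longrightarrow> (f has_real_derivative deriv f x) (at x)"
  unfolding smooth1_def by (metis DERIV_imp_deriv diff_upto.simps(2))

lemma smooth1_deriv: "smooth1 f \<Longrightarrow> smooth1 (deriv f)"
proof -
  assume *: "smooth1 f"
  have "diff_upto n (deriv f)" for n
  proof -
    obtain f' where "\<forall>x. (f has_real_derivative f' x) (at x)" "diff_upto n f'"
      using * diff_upto.simps(2)[of n f] unfolding smooth1_def by blast
    moreover from this have "deriv f = f'" by (auto intro: DERIV_imp_deriv)
    ultimately show ?thesis by simp
  qed
  then show ?thesis by (simp add: smooth1_def)
qed

lemma smooth1I: "(\<And>x. (f has_real_derivative f' x) (at x)) \<Longrightarrow> smooth1 f' \<Longrightarrow> smooth1 f"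
  unfolding smooth1_def by (metis diff_upto.simps not0_implies_Suc)

lemma smooth1_higher_deriv: "smooth1 f \<Longrightarrow> smooth1 ((deriv ^^ n) f)"
  by (induction n) (simp_all add: smooth1_deriv)

lemma smooth1_continuous_on: "smooth1 f \<Longrightarrow> continuous_on S f"
  using smooth1_has_deriv DERIV_isCont continuous_at_imp_continuous_on by blast

lemma higher_deriv_minus:
  "smooth1 f \<Longrightarrow> smooth1 g \<Longrightarrow> (deriv ^^ n) (\<lambda>x. f x - g x) = (\<lambda>x. (deriv ^^ n) f x - (deriv ^^ n) g x)"
proof (induction n)
  case (Suc n)
  show ?case
    using Suc by (auto intro!: DERIV_imp_deriv derivative_intros smooth1_has_deriv smooth1_higher_deriv)
qed simp

lemma higher_deriv_shift:
  "smooth1 f \<Longrightarrow> (deriv ^^ n) (\<lambda>x. f (x - b)) = (\<lambda>x. (deriv ^^ n) f (x - b))"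
proof (induction n)
  case (Suc n)
  have "((\<lambda>x. (deriv ^^ n) f (x - b)) has_real_derivative deriv ((deriv ^^ n) f) (x - b)) (at x)" for x
    by (rule DERIV_chain2[OF smooth1_has_deriv[OF smooth1_higher_deriv[OF Suc.prems]], THEN DERIV_cong])
      (auto intro!: derivative_eq_intros)
  then show ?case using Suc by (auto intro!: DERIV_imp_deriv)
qed simp

text \<open>Openness of S lets each derivative be computed from values inside S. This is how the
  derivatives of the kernels inherit their support.\<close>

lemma higher_deriv_zero:
  assumes "open S" "\<And>x. x \<in> S \<Longrightarrow> f x = 0" "x \<in> S"
  shows "(deriv ^^ n) f x = (0::real)"
  using assms(3)
proof (induction n arbitrary: x)
  case (Suc n)
  have "eventually (\<lambda>z. (deriv ^^ n) f z = 0) (nhds x)"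
    using Suc assms(1) by (auto simp: eventually_nhds)
  then have "deriv ((deriv ^^ n) f) x = deriv (\<lambda>_. 0) x" by (rule deriv_cong_ev) simp
  then show ?case by simp
qed (use assms in simp)

section \<open>A smooth step function\<close>

definition flat :: "real poly \<Rightarrow> real \<Rightarrow> real" where
  "flat p s = (if s \<le> 0 then 0 else poly p (1 / s) * exp (- (1 / s)))"

lemma poly_exp_tendsto_0: "((\<lambda>x. poly p x * exp (- x)) \<longlongrightarrow> (0::real)) at_top"
proof (induction p)
  case (pCons a p)
  have "((\<lambda>x. a * exp (- x) + x * poly p x * exp (-x)) \<longlongrightarrow> (0::real)) at_top"
  proof -
    have 1: "((\<lambda>x. a * exp (- x)) \<longlongrightarrow> 0) at_top" by real_asymp
    have 2: "((\<lambda>x. x * poly p x * exp (-x)) \<longlongrightarrow> (0::real)) at_top"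
    proof -
      have "((\<lambda>x. x ^ k / exp x) \<longlongrightarrow> (0::real)) at_top" for k
        by (rule tendsto_power_div_exp_0)
      then have "((\<lambda>x. \<Sum>i\<le>degree p. coeff p i * (x ^ (i + 1) / exp x)) \<longlongrightarrow> (\<Sum>i\<le>degree p. coeff p i * 0)) at_top"
        by (intro tendsto_sum tendsto_mult tendsto_const)
      then show ?thesis
        by (simp add: poly_altdef exp_minus divide_inverse sum_distrib_left sum_distrib_right mult_ac)
    qed
    show ?thesis using tendsto_add[OF 1 2] by simp
  qed
  then show ?case by (simp add: algebra_simps)
qed simp

text \<open>The functions p(1/s) exp(-1/s), extended by 0, are closed under differentiation: for s >
  0 the derivative is s^(-2) (p(1/s) - p'(1/s)) exp(-1/s), again of this form. Smoothness is then an
  induction over all p at once.\<close>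

lemma flat_has_derivative:
  "(flat p has_real_derivative flat ([:0, 0, 1:] * (p - pderiv p)) s) (at s)"
proof -
  consider "s < 0" | "s = 0" | "s > 0" by linarith
  then show ?thesis
  proof cases
    case 1
    have "((\<lambda>_. 0) has_real_derivative 0) (at s)" by simp
    moreover have "eventually (\<lambda>x. x < 0) (nhds s)" using 1
      unfolding eventually_nhds by (intro exI[of _ "{..<0}"]) auto
    then have "eventually (\<lambda>x. flat p x = 0) (nhds s)" by eventually_elim (simp add: flat_def)
    ultimately show ?thesis using 1
      by (subst DERIV_cong_ev[OF refl _ refl, of _ "\<lambda>_. 0"]) (auto simp: flat_def)
  next
    case 2
    have "((\<lambda>h. flat p h / h) \<longlongrightarrow> 0) (at_right 0)"
    proof -
      \<comment> \<open>For h > 0 the quotient \<open>flat p h / h\<close> has the same form, with p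
        multiplied by the variable, evaluated at 1/h.\<close>
      have "((\<lambda>x. poly ([:0,1:] * p) x * exp (- x)) \<longlongrightarrow> 0) at_top" by (rule poly_exp_tendsto_0)
      then have "((\<lambda>h. poly ([:0,1:] * p) (inverse h) * exp (- inverse h)) \<longlongrightarrow> 0) (at_right (0::real))"
        by (rule filterlim_compose) (rule filterlim_inverse_at_top_right)
      then show ?thesis
        by (rule Lim_transform_eventually)
          (auto simp: flat_def eventually_at_filter field_simps)
    qed
    moreover have "((\<lambda>h. flat p h / h) \<longlongrightarrow> 0) (at_left 0)"
      by (rule Lim_transform_eventually[OF tendsto_const])
        (auto simp: flat_def eventually_at_filter)
    ultimately have "((\<lambda>h. flat p h / h) \<longlongrightarrow> 0) (at 0)"
      by (simp add: filterlim_split_at)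
    then show ?thesis using 2 by (simp add: DERIV_def flat_def)
  next
    case 3
    have "((\<lambda>x. poly p (1 / x) * exp (- (1 / x))) has_real_derivative
      (flat ([:0, 0, 1:] * (p - pderiv p)) s)) (at s)"
      using 3 by (auto intro!: derivative_eq_intros simp: flat_def power2_eq_square field_simps)
    moreover have "eventually (\<lambda>x. x > 0) (nhds s)" using 3
      unfolding eventually_nhds by (intro exI[of _ "{0<..}"]) auto
    then have "eventually (\<lambda>x. flat p x = poly p (1 / x) * exp (- (1 / x))) (nhds s)"
      by eventually_elim (simp add: flat_def)
    ultimately show ?thesis
      by (subst DERIV_cong_ev[OF refl _ refl]) auto
  qed
qed

lemma smooth1_flat: "smooth1 (flat p)"
proof -
  have "diff_upto n (flat p)" for n
  proof (induction n arbitrary: p)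
    case (Suc n)
    then show ?case using flat_has_derivative by auto
  qed simp
  then show ?thesis by (simp add: smooth1_def)
qed

text \<open>P is the normalised primitive of the bump flat(s) flat(1 - s). Strict positivity of P'
  inside the unit interval later gives the mollifier a positive mass.\<close>

lemma smooth_step_exists:
  obtains P where "smooth1 P" "\<And>s. s \<le> 0 \<Longrightarrow> P s = 0" "\<And>s. s \<ge> 1 \<Longrightarrow> P s = 1"
    "\<And>s. 0 \<le> P s" "\<And>s. P s \<le> 1" "\<And>s. deriv P s \<ge> 0" "\<And>s. 0 < s \<Longrightarrow> s < 1 \<Longrightarrow> deriv P s > 0"
proof -
  define \<rho> where "\<rho> s = flat 1 s * flat 1 ((-1) * s + 1)" for s
  have sm: "smooth1 \<rho>" unfolding \<rho>_def
    by (intro smooth1_mult smooth1_flat smooth1_affine)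
  have "\<exists>F. \<forall>x::real. (F has_real_derivative \<rho> x) (at x)"
    using einterval_antiderivative[of "-\<infinity>" "\<infinity>" \<rho>] smooth1_continuous_on[OF sm, of UNIV]
    by (auto simp: continuous_on_eq_continuous_at has_real_derivative_iff_has_vector_derivative)
  then obtain F where F: "\<And>x. (F has_real_derivative \<rho> x) (at x)" by auto
  have \<rho>0: "\<rho> s = 0" if "s \<le> 0 \<or> s \<ge> 1" for s using that by (auto simp: \<rho>_def flat_def)
  have \<rho>pos: "\<rho> s > 0" if "0 < s" "s < 1" for s using that by (auto simp: \<rho>_def flat_def)
  have \<rho>ge: "\<rho> s \<ge> 0" for s using \<rho>0[of s] \<rho>pos[of s] by force
  have mono: "F x \<le> F y" if "x \<le> y" for x y
    using that F \<rho>ge by (meson DERIV_nonneg_imp_nondecreasing)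
  have F_cont: "continuous_on S F" for S
    using F by (auto intro!: continuous_at_imp_continuous_on DERIV_isCont)
  have F0: "F s = F 0" if "s \<le> 0" for s
  proof (cases "s = 0")
    case False
    have "\<And>x. s < x \<Longrightarrow> x < 0 \<Longrightarrow> (F has_real_derivative 0) (at x)" using F \<rho>0 by (metis less_imp_le)
    then show ?thesis using DERIV_isconst_end[of s 0 F] that False F_cont by simp
  qed simp
  have F1: "F s = F 1" if "s \<ge> 1" for s
  proof (cases "s = 1")
    case False
    have "\<And>x. 1 < x \<Longrightarrow> x < s \<Longrightarrow> (F has_real_derivative 0) (at x)" using F \<rho>0 by (metis less_imp_le)
    then show ?thesis using DERIV_isconst_end[of 1 s F] that False F_cont by simp
  qed simp
  have lt: "F 0 < F 1"
    by (rule DERIV_pos_imp_increasing_open[of 0 1 F])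
      (use F \<rho>pos in \<open>auto intro!: continuous_at_imp_continuous_on DERIV_isCont\<close>)
  define c where "c = 1 / (F 1 - F 0)"
  have c: "c > 0" using lt by (simp add: c_def)
  define P where "P s = c * (F s - F 0)" for s
  have dP: "(P has_real_derivative c * \<rho> s) (at s)" for s
    unfolding P_def by (auto intro!: derivative_eq_intros F)
  then have dP': "deriv P s = c * \<rho> s" for s by (rule DERIV_imp_deriv)
  show ?thesis
  proof (rule that[of P])
    show "smooth1 P" using dP by (rule smooth1I) (intro smooth1_mult smooth1_const sm)
    show "P s = 0" if "s \<le> 0" for s using F0[OF that] by (simp add: P_def)
    show P1: "P s = 1" if "s \<ge> 1" for s using F1[OF that] lt by (simp add: P_def c_def)
    have "F 0 \<le> F s" "F s \<le> F 1" for s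
      using mono[of 0 s] mono[of s 1] F0[of s] F1[of s] lt by (cases "s \<le> 0"; cases "s \<ge> 1"; force)+
    then show "0 \<le> P s" "P s \<le> 1" for s
      using c lt by (auto simp: P_def c_def divide_simps)
    show "deriv P s \<ge> 0" for s using c \<rho>ge by (simp add: dP')
    show "deriv P s > 0" if "0 < s" "s < 1" for s using c \<rho>pos that by (simp add: dP')
  qed
qed

section \<open>Local Sobolev estimates\<close>

lemma axis_2_nth [simp]: "axis 1 (1::real) $ (1::2) = 1" "axis 1 (1::real) $ (2::2) = 0"
  "axis 2 (1::real) $ (1::2) = 0" "axis 2 (1::real) $ (2::2) = 1"
  by (simp_all add: axis_def)

definition tprod :: "(real \<Rightarrow> real) \<Rightarrow> (real \<Rightarrow> real) \<Rightarrow> real^2 \<Rightarrow> real" where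
  "tprod A B z = A (z $ 1) * B (z $ 2)"

lemma tprod_pd:
  assumes "smooth1 A" "smooth1 B"
  shows "((\<lambda>s. tprod A B (x + s *\<^sub>R axis 1 1)) has_real_derivative tprod (deriv A) B x) (at 0)"
    "((\<lambda>s. tprod A B (x + s *\<^sub>R axis 2 1)) has_real_derivative tprod A (deriv B) x) (at 0)"
proof -
  have "((\<lambda>s. A (x $ 1 + s)) has_real_derivative deriv A (x $ 1)) (at 0)"
    using smooth1_has_deriv[OF assms(1), of "0 + x $ 1"] unfolding DERIV_shift by (simp add: add.commute)
  then show "((\<lambda>s. tprod A B (x + s *\<^sub>R axis 1 1)) has_real_derivative tprod (deriv A) B x) (at 0)"
    unfolding tprod_def by (auto intro!: derivative_eq_intros)
  have "((\<lambda>s. B (x $ 2 + s)) has_real_derivative deriv B (x $ 2)) (at 0)"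
    using smooth1_has_deriv[OF assms(2), of "0 + x $ 2"] unfolding DERIV_shift by (simp add: add.commute)
  then show "((\<lambda>s. tprod A B (x + s *\<^sub>R axis 2 1)) has_real_derivative tprod A (deriv B) x) (at 0)"
    unfolding tprod_def by (auto intro!: derivative_eq_intros)
qed

lemma pd_tprod:
  assumes "smooth1 A" "smooth1 B"
  shows "pd 1 (tprod A B) = tprod (deriv A) B" "pd 2 (tprod A B) = tprod A (deriv B)"
  using tprod_pd[OF assms] by (auto simp: pd_def fun_eq_iff intro!: DERIV_imp_deriv)

text \<open>Each partial derivative acts on its own factor, so of a word of indices only the
  multiplicities remain, and \<open>smooth2\<close> reduces to smoothness in one variable.\<close>

lemma pds_tprod:
  assumes "smooth1 A" "smooth1 B"
  shows "pds ws (tprod A B) = tprod ((deriv ^^ count_list ws 1) A) ((deriv ^^ count_list ws 2) B)"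
proof (induction ws)
  case (Cons w ws)
  have "w = 1 \<or> w = 2" by (rule exhaust_2)
  then show ?case
    using Cons pd_tprod[OF smooth1_higher_deriv[OF assms(1)] smooth1_higher_deriv[OF assms(2)]]
    by (auto simp: pds_def)
qed (simp add: pds_def)

lemma count_list_replicate: "count_list (replicate n x) y = (if x = y then n else 0)"
  by (induction n) auto

lemma Dab_tprod:
  assumes "smooth1 A" "smooth1 B"
  shows "Dab a b (tprod A B) = tprod ((deriv ^^ a) A) ((deriv ^^ b) B)"
  unfolding Dab_def pds_tprod[OF assms] by (simp add: count_list_replicate)

lemma tprod_continuous_on:
  assumes "continuous_on UNIV A" "continuous_on UNIV B"
  shows "continuous_on S (tprod A B)"
proof -
  have "continuous_on S (\<lambda>z. z $ i)" for i :: 2 by (intro continuous_intros)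
  then have "continuous_on S (\<lambda>z. A (z $ 1))" "continuous_on S (\<lambda>z. B (z $ 2))"
    by (auto intro: continuous_on_compose2[OF assms(1)] continuous_on_compose2[OF assms(2)])
  then show ?thesis unfolding tprod_def by (rule continuous_on_mult)
qed

lemma test_fun_tprod:
  fixes c d :: "real^2"
  assumes "smooth1 A" "smooth1 B"
    and "\<And>s. A s \<noteq> 0 \<Longrightarrow> c $ 1 \<le> s \<and> s \<le> d $ 1" "\<And>s. B s \<noteq> 0 \<Longrightarrow> c $ 2 \<le> s \<and> s \<le> d $ 2"
  shows "test_fun (tprod A B)"
proof -
  have "{x. tprod A B x \<noteq> 0} \<subseteq> cbox c d"
    using assms(3,4) by (auto simp: tprod_def mem_box_cart forall_2)
  then have "bounded {x. tprod A B x \<noteq> 0}" using bounded_cbox bounded_subset by blast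
  moreover have "smooth2 (tprod A B)"
    unfolding smooth2_def pds_tprod[OF assms(1,2)]
  proof (intro allI conjI)
    fix ws :: "2 list" and i :: 2 and x :: "real^2"
    let ?A = "(deriv ^^ count_list ws 1) A" and ?B = "(deriv ^^ count_list ws 2) B"
    have sm: "smooth1 ?A" "smooth1 ?B" using assms smooth1_higher_deriv by auto
    then show "continuous_on UNIV (tprod ?A ?B)"
      by (intro tprod_continuous_on smooth1_continuous_on)
    show "(\<lambda>s. tprod ?A ?B (x + s *\<^sub>R axis i 1)) differentiable at 0"
      using tprod_pd[OF sm, of x] exhaust_2[of i] by (auto simp: real_differentiable_def)
  qed
  ultimately show ?thesis by (simp add: test_fun_def)
qed

lemma weak_derivD:
  assumes "weak_deriv a b f g"
  shows "test_fun \<phi> \<Longrightarrow> (LINT x|lborel. f x * Dab a b \<phi> x) = (-1) ^ (a + b) * (LINT x|lborel. g x * \<phi> x)"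
    and "f \<in> borel_measurable lborel" and "compact K \<Longrightarrow> integrable lborel (\<lambda>x. indicator K x * f x)"
  using assms by (auto simp: weak_deriv_def loc_int_def)

lemma wd_spec:
  assumes "Hk k u" "a + b \<le> k"
  shows "weak_deriv a b u (wd a b u)" "L2 (wd a b u)"
proof -
  have "\<exists>g. weak_deriv a b u g \<and> L2 g" using assms by (auto simp: Hk_def)
  from someI_ex[OF this] show "weak_deriv a b u (wd a b u)" "L2 (wd a b u)"
    by (auto simp: wd_def)
qed

section \<open>Local energies on unit boxes\<close>

definition unit_box :: "real^2 \<Rightarrow> (real^2) set" where
  "unit_box x = cbox x (x + 1)"

lemma measure_unit_box: "measure lborel (unit_box x) = 1"
  unfolding unit_box_def by (subst content_cbox_cart) (auto simp: interval_ne_empty_cart)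

lemma integrable_indicator_L2:
  assumes "L2 g" "S \<in> sets lborel"
  shows "integrable lborel (\<lambda>z. indicator S z * (g z)\<^sup>2 :: real)"
  using integrable_mult_indicator[of S lborel "\<lambda>z. (g z)\<^sup>2"] assms by (auto simp: L2_def)

text \<open>A linearised Cauchy-Schwarz inequality, from |g| \<le> \<eta> + g^2 / \<eta>. The free
  parameter serves two purposes later: \<eta> = 1 gives a uniform bound, and a small \<eta> turns
  small local energy into a small pairing.\<close>

lemma local_L2_bound:
  assumes "L2 g" "\<psi> \<in> borel_measurable lborel" and \<psi>: "\<And>z. \<bar>\<psi> z\<bar> \<le> M * indicator (unit_box x) z" and "\<eta> > 0" "M \<ge> 0"
  shows "\<bar>LINT z|lborel. g z * \<psi> z\<bar> \<le> M * (\<eta> + (LINT z|lborel. indicator (unit_box x) z * (g z)\<^sup>2) / \<eta>)"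
proof -
  let ?Q = "unit_box x"
  have Q: "?Q \<in> sets lborel" by (simp add: unit_box_def)
  have i1: "integrable lborel (\<lambda>z. indicator ?Q z :: real)"
    by (simp add: unit_box_def emeasure_lborel_cbox_eq)
  have i2: "integrable lborel (\<lambda>z. indicator ?Q z * (g z)\<^sup>2 :: real)"
    by (rule integrable_indicator_L2[OF assms(1) Q])
  let ?h = "\<lambda>z. M * (\<eta> * indicator ?Q z + indicator ?Q z * (g z)\<^sup>2 / \<eta>)"
  have ih: "integrable lborel ?h" using i1 i2 by (intro integrable_mult_right integrable_add integrable_divide) auto
  have le: "\<bar>g z * \<psi> z\<bar> \<le> ?h z" for z
  proof -
    have "\<bar>g z\<bar> * \<eta> \<le> \<bar>g z\<bar>\<^sup>2 + \<eta>\<^sup>2"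
    proof -
      have "0 \<le> \<bar>g z\<bar> * \<eta>" using \<open>\<eta> > 0\<close> by simp
      then show ?thesis using sum_squares_bound[of "\<bar>g z\<bar>" \<eta>] by linarith
    qed
    then have "\<bar>g z\<bar> \<le> \<eta> + (g z)\<^sup>2 / \<eta>" using \<open>\<eta> > 0\<close> by (simp add: field_simps power2_eq_square)
    then have "\<bar>g z\<bar> * \<bar>\<psi> z\<bar> \<le> (\<eta> + (g z)\<^sup>2 / \<eta>) * (M * indicator ?Q z)"
      using \<psi>[of z] \<open>\<eta> > 0\<close> by (intro mult_mono) auto
    then show ?thesis by (simp add: abs_mult algebra_simps)
  qed
  have m: "(\<lambda>z. g z * \<psi> z) \<in> borel_measurable lborel" using assms by (auto simp: L2_def)
  have "integrable lborel (\<lambda>z. g z * \<psi> z)"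
    using ih m by (rule Bochner_Integration.integrable_bound)
      (intro AE_I2, use order_trans[OF le abs_ge_self] in \<open>simp only: real_norm_def\<close>)
  then have "\<bar>LINT z|lborel. g z * \<psi> z\<bar> \<le> (LINT z|lborel. ?h z)"
    using Bochner_Integration.integral_norm_bound_integral[of lborel "\<lambda>z. g z * \<psi> z" ?h] ih le by auto
  also have "\<dots> = M * (\<eta> + (LINT z|lborel. indicator ?Q z * (g z)\<^sup>2) / \<eta>)"
    using i1 i2 measure_unit_box[of x] by (simp add: unit_box_def)
  finally show ?thesis .
qed

text \<open>The square of \<open>Hk_norm\<close> with every integral restricted to the unit box at
  x. Unlike the full norm it tends to 0 as x goes to infinity, which is the source of the spatial
  decay.\<close>

definition local_energy :: "nat \<Rightarrow> (real^2 \<Rightarrow> real) \<Rightarrow> real^2 \<Rightarrow> real" where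
  "local_energy k u x =
     (\<Sum>(a,b)\<in>{(a,b). a + b \<le> k}. LINT z|lborel. indicator (unit_box x) z * (wd a b u z)\<^sup>2)"

lemma finite_multiindices: "finite {(a,b). a + b \<le> (k::nat)}"
  by (rule finite_subset[of _ "{..k} \<times> {..k}"]) auto

lemma integral_le_local_energy:
  assumes "a + b \<le> k"
  shows "(LINT z|lborel. indicator (unit_box x) z * (wd a b u z)\<^sup>2) \<le> local_energy k u x"
  unfolding local_energy_def
  using member_le_sum[of "(a, b)" "{(a,b). a + b \<le> k}" "\<lambda>(a,b). LINT z|lborel. indicator (unit_box x) z * (wd a b u z)\<^sup>2"]
    finite_multiindices[of k] assms by auto

lemma local_energy_le:
  assumes "Hk k u"
  shows "local_energy k u x \<le> (Hk_norm k u)\<^sup>2"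
proof -
  have "local_energy k u x \<le> (\<Sum>(a,b)\<in>{(a,b). a + b \<le> k}. LINT z|lborel. (wd a b u z)\<^sup>2)"
    unfolding local_energy_def
  proof (intro sum_mono, clarify)
    fix a b assume "a + b \<le> k"
    then have L: "L2 (wd a b u)" using assms wd_spec by blast
    show "(LINT z|lborel. indicator (unit_box x) z * (wd a b u z)\<^sup>2) \<le> (LINT z|lborel. (wd a b u z)\<^sup>2)"
      using L by (intro integral_mono integrable_indicator_L2) (auto simp: L2_def unit_box_def indicator_def)
  qed
  also have "\<dots> = (Hk_norm k u)\<^sup>2"
    unfolding Hk_norm_def by (subst real_sqrt_pow2) (auto intro!: sum_nonneg)
  finally show ?thesis .
qed

text \<open>Integrals over complements of large balls vanish by dominated convergence, and a unit
  box with a distant corner lies in such a complement.\<close>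

lemma local_L2_vanishes:
  assumes "L2 g" "e > 0"
  shows "\<exists>R. \<forall>x. norm x > R \<longrightarrow> (LINT z|lborel. indicator (unit_box x) z * (g z)\<^sup>2) < e"
proof -
  let ?f = "\<lambda>n::nat. \<lambda>z. indicator {z. norm z \<ge> real n} z * (g z)\<^sup>2 :: real"
  have S: "{z::real^2. norm z \<ge> r} \<in> sets lborel" for r :: real by simp
  have "(\<lambda>n. LINT z|lborel. ?f n z) \<longlonglongrightarrow> (LINT z::real^2|lborel. (0::real))"
  proof (rule integral_dominated_convergence)
    show "integrable lborel (\<lambda>z. (g z)\<^sup>2)" using assms by (simp add: L2_def)
    show "AE x in lborel. (\<lambda>i. ?f i x) \<longlonglongrightarrow> 0"
    proof (intro AE_I2)
      fix x :: "real^2"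
      have "eventually (\<lambda>n. real n > norm x) sequentially" by real_asymp
      then have "eventually (\<lambda>n. 0 = ?f n x) sequentially" by eventually_elim auto
      then show "(\<lambda>i. ?f i x) \<longlonglongrightarrow> 0" by (rule Lim_transform_eventually[OF tendsto_const])
    qed
    show "?f i \<in> borel_measurable lborel" for i
      by (intro borel_measurable_integrable integrable_indicator_L2 assms S)
  qed (auto simp: indicator_def)
  then have "eventually (\<lambda>n. (LINT z|lborel. ?f n z) < e) sequentially"
    using assms by (auto dest: order_tendstoD)
  then obtain n where n: "(LINT z|lborel. ?f n z) < e" by (auto simp: eventually_sequentially)
  \<comment> \<open>The norm of the all-ones vector is the diameter of a unit box.\<close>
  show ?thesis
  proof (intro exI[of _ "real n + norm (1 :: real^2)"] allI impI)
    fix x :: "real^2" assume x: "norm x > real n + norm (1 :: real^2)"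
    have sub: "norm z \<ge> real n" if "z \<in> unit_box x" for z
    proof -
      have "norm (z - x) \<le> norm (1 :: real^2)"
        using that by (intro norm_le_componentwise_cart) (auto simp: unit_box_def mem_box_cart algebra_simps)
      then show ?thesis using x norm_triangle_ineq2[of x z] norm_minus_commute[of x z] by linarith
    qed
    have "(LINT z|lborel. indicator (unit_box x) z * (g z)\<^sup>2) \<le> (LINT z|lborel. ?f n z)"
      using sub assms by (intro integral_mono integrable_indicator_L2) (auto simp: unit_box_def indicator_def)
    then show "(LINT z|lborel. indicator (unit_box x) z * (g z)\<^sup>2) < e" using n by linarith
  qed
qed

lemma local_energy_vanishes:
  assumes "Hk k u" "e > 0"
  shows "\<exists>R. \<forall>x. norm x > R \<longrightarrow> local_energy k u x < e"
proof -
  let ?I = "{(a,b). a + b \<le> k}"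
  define N where "N = real (card ?I)"
  have fin: "finite ?I" by (rule finite_multiindices)
  have ne: "?I \<noteq> {}" using zero_le[of k] by (auto intro!: exI[of _ 0])
  have N: "N > 0" using fin ne by (auto simp: N_def card_gt_0_iff)
  have "\<exists>R. \<forall>x. norm x > R \<longrightarrow> (LINT z|lborel. indicator (unit_box x) z * (wd (fst i) (snd i) u z)\<^sup>2) < e / N" if "i \<in> ?I" for i
    using that wd_spec(2)[OF assms(1)] assms(2) N by (intro local_L2_vanishes) auto
  then have "\<forall>i\<in>?I. \<exists>R. \<forall>x. norm x > R \<longrightarrow> (LINT z|lborel. indicator (unit_box x) z * (wd (fst i) (snd i) u z)\<^sup>2) < e / N"
    by (rule ballI)
  from bchoice[OF this] obtain R where R: "\<forall>i\<in>?I. \<forall>x. norm x > R i \<longrightarrow>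
      (LINT z|lborel. indicator (unit_box x) z * (wd (fst i) (snd i) u z)\<^sup>2) < e / N" ..
  show ?thesis
  proof (intro exI[of _ "Max (R ` ?I)"] allI impI)
    fix x :: "real^2" assume x: "norm x > Max (R ` ?I)"
    have "local_energy k u x < (\<Sum>(a,b)\<in>?I. e / N)"
      unfolding local_energy_def
    proof (intro sum_strict_mono fin ne, clarify)
      fix a b assume "a + b \<le> k"
      then have "R (a, b) \<le> Max (R ` ?I)" using fin by (intro Max_ge) auto
      then have "norm x > R (a, b)" using x by linarith
      then show "(LINT z|lborel. indicator (unit_box x) z * (wd a b u z)\<^sup>2) < e / N"
        using bspec[OF R, of "(a,b)"] \<open>a + b \<le> k\<close> by auto
    qed
    also have "\<dots> = e" using N by (simp add: N_def case_prod_unfold)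
    finally show "local_energy k u x < e" .
  qed
qed

section \<open>A mollifier that is uniformly bounded after one integration\<close>

locale smooth_step =
  fixes P :: "real \<Rightarrow> real"
  assumes smooth: "smooth1 P"
    and step_0: "s \<le> 0 \<Longrightarrow> P s = 0"
    and step_1: "s \<ge> 1 \<Longrightarrow> P s = 1"
    and step_nonneg: "0 \<le> P s"
    and step_le_1: "P s \<le> 1"
    and step_deriv_nonneg: "deriv P s \<ge> 0"
    and step_deriv_pos: "0 < s \<Longrightarrow> s < 1 \<Longrightarrow> deriv P s > 0"
begin

text \<open>The derivative of P(n s) in s: an approximate identity concentrating on
  [0, 1/n].\<close>

definition kern :: "real \<Rightarrow> real \<Rightarrow> real" where
  "kern n s = n * deriv P (n * s)"

text \<open>Subtracting P s cancels the value 1 to the right of the unit interval, so this primitive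
  of \<open>kern n - kern 1\<close> has compact support. Its bound 1 does not depend on n.\<close>

definition bump :: "real \<Rightarrow> real \<Rightarrow> real" where
  "bump n s = P (n * s) - P s"

lemma smooth1_kern: "smooth1 (kern n)"
  unfolding kern_def
  using smooth1_mult[OF smooth1_const smooth1_affine[OF smooth1_deriv[OF smooth], of n 0]] by simp

lemma smooth1_bump: "smooth1 (bump n)"
  unfolding bump_def
  using smooth1_minus[OF smooth1_affine[OF smooth, of n 0] smooth] by simp

text \<open>P is constant on each open half-line; the endpoints 0 and 1 follow by continuity of
  P'.\<close>

lemma deriv_step_zero:
  assumes "s \<le> 0 \<or> s \<ge> 1"
  shows "deriv P s = 0"
proof -
  have "deriv P x = 0" if "x \<in> {..<0} \<union> {1<..}" for x
  proof -
    have "(deriv ^^ 1) (\<lambda>s. P s - (if x < 0 then 0 else 1)) x = 0"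
      by (rule higher_deriv_zero[of "if x < 0 then {..<0} else {1<..}"])
        (use that step_0 step_1 in \<open>auto split: if_splits\<close>)
    then show ?thesis
      using higher_deriv_minus[OF smooth smooth1_const, of 1 "if x < 0 then 0 else 1"]
      by (simp add: fun_eq_iff)
  qed
  then have "deriv P x = 0" if "x \<in> closure ({..<0} \<union> {1<..})" for x
    using continuous_constant_on_closure[of "{..<0} \<union> {1<..}" "deriv P" 0 x] that
      smooth1_continuous_on[OF smooth1_deriv[OF smooth]] by blast
  then show ?thesis using assms by simp
qed

lemma kern_zero: "n \<ge> 1 \<Longrightarrow> s \<le> 0 \<or> s \<ge> 1 \<Longrightarrow> kern n s = 0"
  unfolding kern_def using mult_mono[of 1 n 1 s]
  by (auto intro!: deriv_step_zero simp: mult_nonneg_nonpos)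

lemma bump_zero: "n \<ge> 1 \<Longrightarrow> s \<le> 0 \<or> s \<ge> 1 \<Longrightarrow> bump n s = 0"
  unfolding bump_def using mult_mono[of 1 n 1 s]
  by (auto simp: step_0 step_1 mult_nonneg_nonpos)

lemma bump_le_1: "\<bar>bump n s\<bar> \<le> 1"
  unfolding bump_def using step_nonneg[of "n * s"] step_nonneg[of s] step_le_1[of "n * s"] step_le_1[of s]
  by linarith

lemma deriv_bump: "deriv (bump n) s = kern n s - kern 1 s"
proof -
  have "((\<lambda>s. P (n * s)) has_real_derivative deriv P (n * s) * n) (at s)"
    by (rule DERIV_chain2[OF smooth1_has_deriv[OF smooth]]) (auto intro!: derivative_eq_intros)
  then have "(bump n has_real_derivative kern n s - kern 1 s) (at s)"
    unfolding bump_def kern_def using smooth1_has_deriv[OF smooth, of s]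
    by (auto intro!: derivative_eq_intros)
  then show ?thesis by (rule DERIV_imp_deriv)
qed

text \<open>Trades the large kernel for one more derivative of a function bounded by 1, plus a term
  independent of n.\<close>

lemma higher_deriv_kern:
  "(deriv ^^ a) (kern n) s = (deriv ^^ Suc a) (bump n) s + (deriv ^^ a) (kern 1) s"
proof -
  have "(deriv ^^ Suc a) (bump n) = (deriv ^^ a) (\<lambda>s. kern n s - kern 1 s)"
    unfolding funpow_Suc_right by (simp add: deriv_bump[abs_def])
  then show ?thesis by (simp add: higher_deriv_minus smooth1_kern)
qed

lemma kern_1_bounded: "\<exists>C\<ge>1. \<forall>s. \<bar>kern 1 s\<bar> \<le> C"
proof -
  have "bounded (kern 1 ` {0..1})"
    by (intro compact_imp_bounded compact_continuous_image smooth1_continuous_on smooth1_kern) auto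
  then obtain C where C: "\<And>s. s \<in> {0..1} \<Longrightarrow> \<bar>kern 1 s\<bar> \<le> C"
    unfolding bounded_iff by fastforce
  have "\<bar>kern 1 s\<bar> \<le> max 1 C" for s
    using C[of s] kern_zero[of 1 s] by (cases "s \<in> {0..1}") auto
  then show ?thesis by (intro exI[of _ "max 1 C"]) auto
qed

definition kern2 :: "real \<Rightarrow> nat \<Rightarrow> nat \<Rightarrow> real^2 \<Rightarrow> real" where
  "kern2 n a b = tprod ((deriv ^^ a) (kern n)) ((deriv ^^ b) (kern n))"

text \<open>Splitting each tensor factor as in \<open>higher_deriv_kern\<close> gives four pairings.
  In each of them at most 2 + 2 = 4 derivatives are moved onto u, where k \<ge> 4 supplies them in
  L2. What is left of the kernel is bounded by C^2 on the unit box, uniformly in n; hence the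
  constant 4 C^2.\<close>

lemma kern2_bound:
  "\<exists>C>0. \<forall>k u x n a b \<eta>. k \<ge> 4 \<longrightarrow> Hk k u \<longrightarrow> a + b \<le> 2 \<longrightarrow> n \<ge> 1 \<longrightarrow> \<eta> > 0 \<longrightarrow>
     \<bar>LINT z|lborel. u z * kern2 n a b (z - x)\<bar> \<le> C * (\<eta> + local_energy k u x / \<eta>)"
proof -
  obtain C where C: "C \<ge> 1" "\<And>s. \<bar>kern 1 s\<bar> \<le> C" using kern_1_bounded by auto
  show ?thesis
  proof (intro exI[of _ "4 * C\<^sup>2"] conjI allI impI)
    show "0 < 4 * C\<^sup>2" using C by simp
    fix k u x and n \<eta> :: real and a b :: nat
    assume k: "k \<ge> 4" and u: "Hk k u" and ab: "a + b \<le> 2" and n: "n \<ge> 1" and \<eta>: "\<eta> > 0"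
    let ?sh = "\<lambda>c f. (\<lambda>s::real. f (s - c) :: real)"
    \<comment> \<open>The common properties of \<open>bump n\<close> and \<open>kern 1\<close>:
      since C \<ge> 1, the same bound covers both, independently of n.\<close>
    define good where "good f \<longleftrightarrow> smooth1 f \<and> (\<forall>s. s \<le> 0 \<or> s \<ge> 1 \<longrightarrow> f s = 0) \<and> (\<forall>s. \<bar>f s\<bar> \<le> C)" for f :: "real \<Rightarrow> real"
    have gb: "good (bump n)" using smooth1_bump bump_zero[OF n] bump_le_1 C(1) by (force simp: good_def intro: order_trans)
    have gk: "good (kern 1)" using smooth1_kern kern_zero[of 1] C by (auto simp: good_def)
    have sm: "smooth1 (?sh c f)" if "good f" for f c
      using smooth1_affine[of f 1 "-c"] that by (simp add: good_def)
    have main: "integrable lborel (\<lambda>z. u z * tprod ((deriv ^^ i) A) ((deriv ^^ j) B) (z - x)) \<and>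
      \<bar>LINT z|lborel. u z * tprod ((deriv ^^ i) A) ((deriv ^^ j) B) (z - x)\<bar> \<le> C\<^sup>2 * (\<eta> + local_energy k u x / \<eta>)"
      if A: "good A" and B: "good B" and ij: "i + j \<le> 4" for A B i j
    proof -
      let ?A = "?sh (x $ 1) A" and ?B = "?sh (x $ 2) B"
      have smAB: "smooth1 ?A" "smooth1 ?B" using sm A B by auto
      have w: "weak_deriv i j u (wd i j u)" "L2 (wd i j u)" using wd_spec[OF u, of i j] ij k by auto
      have nz: "A s \<noteq> 0 \<Longrightarrow> 0 < s \<and> s < 1" "B s \<noteq> 0 \<Longrightarrow> 0 < s \<and> s < 1" for s
        using A B by (auto simp: good_def not_le[symmetric])
      have tf: "test_fun (tprod ?A ?B)"
        using smAB by (rule test_fun_tprod[of _ _ x "x + 1"]) (use nz in \<open>force+\<close>)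
      have D: "Dab i j (tprod ?A ?B) = (\<lambda>z. tprod ((deriv ^^ i) A) ((deriv ^^ j) B) (z - x))"
        unfolding Dab_tprod[OF smAB] using A B by (simp add: higher_deriv_shift good_def tprod_def fun_eq_iff)
      have cont: "continuous_on UNIV (Dab i j (tprod ?A ?B))"
        unfolding Dab_tprod[OF smAB] by (intro tprod_continuous_on smooth1_continuous_on smooth1_higher_deriv smAB)
      have "(LINT z|lborel. u z * tprod ((deriv ^^ i) A) ((deriv ^^ j) B) (z - x)) =
        (-1) ^ (i + j) * (LINT z|lborel. wd i j u z * tprod ?A ?B z)"
        using weak_derivD(1)[OF w(1) tf] unfolding D .
      then have "\<bar>LINT z|lborel. u z * tprod ((deriv ^^ i) A) ((deriv ^^ j) B) (z - x)\<bar> =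
        \<bar>LINT z|lborel. wd i j u z * tprod ?A ?B z\<bar>" by (simp add: abs_mult power_abs)
      also have "\<dots> \<le> C\<^sup>2 * (\<eta> + (LINT z|lborel. indicator (unit_box x) z * (wd i j u z)\<^sup>2) / \<eta>)"
      proof (rule local_L2_bound[OF w(2) _ _ \<eta>])
        show "tprod ?A ?B \<in> borel_measurable lborel"
          using tprod_continuous_on[OF smooth1_continuous_on smooth1_continuous_on, OF smAB, of UNIV]
          by (simp add: borel_measurable_continuous_onI)
        show "\<bar>tprod ?A ?B z\<bar> \<le> C\<^sup>2 * indicator (unit_box x) z" for z
        proof (cases "z \<in> unit_box x")
          case True
          have "\<bar>A (z $ 1 - x $ 1)\<bar> * \<bar>B (z $ 2 - x $ 2)\<bar> \<le> C * C"
            using A B C(1) by (intro mult_mono) (auto simp: good_def)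
          then show ?thesis using True by (simp add: tprod_def abs_mult power2_eq_square)
        next
          case False
          then have "tprod ?A ?B z = 0"
            using nz(1)[of "z $ 1 - x $ 1"] nz(2)[of "z $ 2 - x $ 2"]
            by (force simp: unit_box_def mem_box_cart forall_2 tprod_def)
          then show ?thesis using False by simp
        qed
      qed simp
      also have "\<dots> \<le> C\<^sup>2 * (\<eta> + local_energy k u x / \<eta>)"
        using integral_le_local_energy[of i j k x u] ij k \<eta> by (intro mult_left_mono add_left_mono divide_right_mono) auto
      finally have bound: "\<bar>LINT z|lborel. u z * tprod ((deriv ^^ i) A) ((deriv ^^ j) B) (z - x)\<bar> \<le> C\<^sup>2 * (\<eta> + local_energy k u x / \<eta>)" .
      \<comment> \<open>Integrability of each pairing allows the four-term expansion of the kernel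
        to be integrated term by term.\<close>
      have integrable: "integrable lborel (\<lambda>z. u z * Dab i j (tprod ?A ?B) z)"
      proof -
        have "compact (cbox x (x + 1))" by simp
        then have ui: "integrable lborel (\<lambda>z. indicator (cbox x (x+1)) z * u z)"
          by (rule weak_derivD(3)[OF w(1)])
        have "bounded (Dab i j (tprod ?A ?B) ` cbox x (x+1))"
          using cont by (intro compact_imp_bounded compact_continuous_image) (auto intro: continuous_on_subset)
        then obtain M where M: "\<And>z. z \<in> cbox x (x+1) \<Longrightarrow> \<bar>Dab i j (tprod ?A ?B) z\<bar> \<le> M"
          by (auto simp: bounded_iff)
        have z: "Dab i j (tprod ?A ?B) z = 0" if "z \<notin> cbox x (x+1)" for z
        proof -
          have "(z $ 1 - x $ 1 < 0 \<or> z $ 1 - x $ 1 > 1) \<or> (z $ 2 - x $ 2 < 0 \<or> z $ 2 - x $ 2 > 1)"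
            using that by (auto simp: mem_box_cart forall_2)
          moreover have "(deriv ^^ m) f s = 0" if "good f" "s < 0 \<or> s > 1" for f m s
            using that by (intro higher_deriv_zero[of "{..<0} \<union> {1<..}"]) (auto simp: good_def)
          ultimately show ?thesis unfolding D tprod_def using A B by auto
        qed
        have "integrable lborel (\<lambda>z. M * \<bar>indicator (cbox x (x+1)) z * u z\<bar>)" using ui by auto
        moreover have "(\<lambda>z. u z * Dab i j (tprod ?A ?B) z) \<in> borel_measurable lborel"
          using weak_derivD(2)[OF w(1)] cont by (intro borel_measurable_times) (auto intro: borel_measurable_continuous_onI)
        ultimately show ?thesis
        proof (rule Bochner_Integration.integrable_bound)
          show "AE z in lborel. norm (u z * Dab i j (tprod ?A ?B) z) \<le> norm (M * \<bar>indicator (cbox x (x+1)) z * u z\<bar>)"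
          proof (rule AE_I2)
            fix z
            show "norm (u z * Dab i j (tprod ?A ?B) z) \<le> norm (M * \<bar>indicator (cbox x (x+1)) z * u z\<bar>)"
            proof (cases "z \<in> cbox x (x+1)")
              case True
              have "\<bar>Dab i j (tprod ?A ?B) z\<bar> * \<bar>u z\<bar> \<le> \<bar>M\<bar> * \<bar>u z\<bar>"
                by (rule mult_right_mono[OF order_trans[OF M[OF True] abs_ge_self]]) simp
              then show ?thesis using True
                by (simp add: abs_mult mult.commute[of "\<bar>u z\<bar>"])
            qed (simp add: z)
          qed
        qed
      qed
      show ?thesis
        using bound integrable[unfolded fun_cong[OF D]] by (rule conjI[rotated])
    qed
    define I where "I = (\<lambda>f g i j z. u z * tprod ((deriv ^^ i) f) ((deriv ^^ j) g) (z - x))"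
    have eq: "u z * kern2 n a b (z - x) = I (bump n) (bump n) (Suc a) (Suc b) z + I (bump n) (kern 1) (Suc a) b z
      + (I (kern 1) (bump n) a (Suc b) z + I (kern 1) (kern 1) a b z)" for z
    proof -
      have "kern2 n a b w = ((deriv ^^ Suc a) (bump n) (w $ 1) + (deriv ^^ a) (kern 1) (w $ 1)) *
          ((deriv ^^ Suc b) (bump n) (w $ 2) + (deriv ^^ b) (kern 1) (w $ 2))" for w
        unfolding kern2_def tprod_def by (simp only: higher_deriv_kern[of a n "w $ 1"] higher_deriv_kern[of b n "w $ 2"])
      then show ?thesis by (simp only: I_def tprod_def ring_distribs add.assoc)
    qed
    have ab4: "Suc a + Suc b \<le> 4" "Suc a + b \<le> 4" "a + Suc b \<le> 4" "a + b \<le> 4" using ab by linarith+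
    let ?E = "C\<^sup>2 * (\<eta> + local_energy k u x / \<eta>)"
    note m1 = main[OF gb gb ab4(1)] and m2 = main[OF gb gk ab4(2)]
      and m3 = main[OF gk gb ab4(3)] and m4 = main[OF gk gk ab4(4)]
    have m1: "integrable lborel (I (bump n) (bump n) (Suc a) (Suc b))" "\<bar>integral\<^sup>L lborel (I (bump n) (bump n) (Suc a) (Suc b))\<bar> \<le> ?E"
      unfolding I_def by (rule conjunct1[OF m1], rule conjunct2[OF m1])
    have m2: "integrable lborel (I (bump n) (kern 1) (Suc a) b)" "\<bar>integral\<^sup>L lborel (I (bump n) (kern 1) (Suc a) b)\<bar> \<le> ?E"
      unfolding I_def by (rule conjunct1[OF m2], rule conjunct2[OF m2])
    have m3: "integrable lborel (I (kern 1) (bump n) a (Suc b))" "\<bar>integral\<^sup>L lborel (I (kern 1) (bump n) a (Suc b))\<bar> \<le> ?E"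
      unfolding I_def by (rule conjunct1[OF m3], rule conjunct2[OF m3])
    have m4: "integrable lborel (I (kern 1) (kern 1) a b)" "\<bar>integral\<^sup>L lborel (I (kern 1) (kern 1) a b)\<bar> \<le> ?E"
      unfolding I_def by (rule conjunct1[OF m4], rule conjunct2[OF m4])
    have "(LINT z|lborel. u z * kern2 n a b (z - x)) =
      integral\<^sup>L lborel (I (bump n) (bump n) (Suc a) (Suc b)) + integral\<^sup>L lborel (I (bump n) (kern 1) (Suc a) b)
      + (integral\<^sup>L lborel (I (kern 1) (bump n) a (Suc b)) + integral\<^sup>L lborel (I (kern 1) (kern 1) a b))"
      unfolding eq using m1(1) m2(1) m3(1) m4(1) by (simp only: Bochner_Integration.integral_add Bochner_Integration.integrable_add)
    then show "\<bar>LINT z|lborel. u z * kern2 n a b (z - x)\<bar> \<le> 4 * C\<^sup>2 * (\<eta> + local_energy k u x / \<eta>)"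
      using m1(2) m2(2) m3(2) m4(2) by linarith
  qed
qed

end

section \<open>Taylor estimates from second differences\<close>

lemma lborel_integral_affine:
  fixes f :: "'a::euclidean_space \<Rightarrow> real" and t :: 'a and c :: real
  assumes "c \<noteq> 0" "f \<in> borel_measurable borel"
  shows "(LINT x|lborel. f x) = \<bar>c\<bar> ^ DIM('a) * (LINT x|lborel. f (t + c *\<^sub>R x))"
proof -
  have "(LINT x|lborel. f x) =
      (LINT x|density (distr lborel borel (\<lambda>x. t + c *\<^sub>R x)) (\<lambda>_. \<bar>c\<bar> ^ DIM('a)). f x)"
    by (subst lborel_affine[OF assms(1), of t]) simp
  also have "\<dots> = (LINT x|distr lborel borel (\<lambda>x. t + c *\<^sub>R x). \<bar>c\<bar> ^ DIM('a) * f x)"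
    using assms(2) by (subst integral_density) auto
  also have "\<dots> = (LINT x|lborel. \<bar>c\<bar> ^ DIM('a) * f (t + c *\<^sub>R x))"
    using assms(2) by (subst integral_distr) auto
  finally show ?thesis by simp
qed

text \<open>A violation would persist on a nonempty open set, and such a set is not
  negligible.\<close>

lemma AE_le_continuous:
  fixes f :: "'a::euclidean_space \<Rightarrow> real"
  assumes "continuous_on UNIV f" "AE x in lborel. f x \<le> c"
  shows "f x \<le> c"
proof (rule ccontr)
  assume "\<not> f x \<le> c"
  let ?S = "{x. c < f x}"
  have "open ?S" using assms(1) by (intro open_Collect_less continuous_on_const)
  moreover have "x \<in> ?S" using \<open>\<not> f x \<le> c\<close> by simp
  then have "?S \<noteq> {}" by blast
  ultimately have "\<not> negligible ?S" by (rule open_not_negligible)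
  moreover have "negligible ?S"
  proof -
    have "AE x in lebesgue. x \<notin> ?S" using AE_completion[OF assms(2)] by eventually_elim auto
    moreover have "?S \<in> sets lebesgue" using \<open>open ?S\<close> by (simp add: lborelD borel_open)
    ultimately show ?thesis using AE_iff_null_sets[of ?S lebesgue] by (simp add: negligible_iff_null_sets)
  qed
  ultimately show False by blast
qed

lemma has_derivative_grad:
  assumes "u differentiable (at x)"
  shows "(u has_derivative (\<lambda>h. grad u x \<bullet> h)) (at x)"
proof -
  have D: "(u has_derivative frechet_derivative u (at x)) (at x)"
    using assms by (simp add: frechet_derivative_works)
  interpret bounded_linear "frechet_derivative u (at x)" using D by (rule has_derivative_bounded_linear)
  have "frechet_derivative u (at x) h = grad u x \<bullet> h" for h
  proof -
    have "h = h $ 1 *\<^sub>R axis 1 1 + h $ 2 *\<^sub>R axis 2 1"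
      by (simp add: vec_eq_iff forall_2)
    then have "frechet_derivative u (at x) h =
        h $ 1 * frechet_derivative u (at x) (axis 1 1) + h $ 2 * frechet_derivative u (at x) (axis 2 1)"
      by (metis add scaleR real_scaleR_def)
    then show ?thesis by (simp add: grad_def inner_vec_def sum_2 mult.commute)
  qed
  then have "frechet_derivative u (at x) = (\<lambda>h. grad u x \<bullet> h)" by (rule ext)
  then show ?thesis using D by simp
qed

text \<open>For the Taylor error E, the combination E(h) - 2 E(h/2) is a second difference of u
  about x + h/2. Repeated halving sums a geometric series, while 2^k E(h/2^k) tends to 0 by
  differentiability at x. Bounded second differences thus replace a bounded second
  derivative.\<close>

lemma taylor_of_second_difference:
  fixes u :: "real^2 \<Rightarrow> real"
  assumes "u differentiable (at x)"
    and second: "\<And>x h. \<bar>u (x + h) - 2 * u x + u (x - h)\<bar> \<le> C * (norm h)\<^sup>2"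
  shows "\<bar>u (x + h) - u x - grad u x \<bullet> h\<bar> \<le> C * (norm h)\<^sup>2"
proof -
  define E where "E h = u (x + h) - u x - grad u x \<bullet> h" for h
  have C: "C * (norm h)\<^sup>2 \<ge> 0" for h :: "real^2" using second[of x h] by linarith
  have half: "\<bar>E h - 2 * E ((1/2) *\<^sub>R h)\<bar> \<le> C * (norm h)\<^sup>2 / 4" for h
  proof -
    have "x + (1/2) *\<^sub>R h + (1/2) *\<^sub>R h = x + h" by (simp add: add.assoc flip: scaleR_left_distrib)
    then have "E h - 2 * E ((1/2) *\<^sub>R h) =
      u ((x + (1/2) *\<^sub>R h) + (1/2) *\<^sub>R h) - 2 * u (x + (1/2) *\<^sub>R h) + u ((x + (1/2) *\<^sub>R h) - (1/2) *\<^sub>R h)"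
      by (simp add: E_def add.commute)
    then show ?thesis using second[of "x + (1/2) *\<^sub>R h" "(1/2) *\<^sub>R h"]
      by (simp add: power_divide)
  qed
  \<comment> \<open>Step k contributes 2^k C |h/2^k|^2 / 4 = C |h|^2 2^(-k) / 4; the last summand
    collects these terms up to step k.\<close>
  have iter: "\<bar>E h\<bar> \<le> 2 ^ k * \<bar>E ((1/2) ^ k *\<^sub>R h)\<bar> + C * (norm h)\<^sup>2 * (1 - (1/2) ^ k) / 2" for k h
  proof (induction k)
    case (Suc k)
    let ?h = "(1/2) ^ k *\<^sub>R h"
    have "\<bar>E ?h\<bar> \<le> 2 * \<bar>E ((1/2) *\<^sub>R ?h)\<bar> + C * (norm ?h)\<^sup>2 / 4" using half[of ?h] by linarith
    then have "2 ^ k * \<bar>E ?h\<bar> \<le> 2 ^ k * (2 * \<bar>E ((1/2) *\<^sub>R ?h)\<bar> + C * (norm ?h)\<^sup>2 / 4)"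
      by (rule mult_left_mono) simp
    also have "\<dots> = 2 ^ Suc k * \<bar>E ((1/2) ^ Suc k *\<^sub>R h)\<bar> + C * (norm h)\<^sup>2 * ((1/2) ^ k) / 4"
      by (simp add: power_mult_distrib field_simps power2_eq_square)
    finally have "2 ^ k * \<bar>E ?h\<bar> \<le> 2 ^ Suc k * \<bar>E ((1/2) ^ Suc k *\<^sub>R h)\<bar> + C * (norm h)\<^sup>2 * ((1/2) ^ k) / 4" .
    moreover have "C * (norm h)\<^sup>2 * (1 - (1/2) ^ Suc k) / 2 =
        C * (norm h)\<^sup>2 * (1 - (1/2) ^ k) / 2 + C * (norm h)\<^sup>2 * ((1/2) ^ k) / 4"
      by (simp add: diff_divide_distrib right_diff_distrib)
    ultimately show ?case using Suc by linarith
  qed simp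
  have "(\<lambda>k. 2 ^ k * \<bar>E ((1/2) ^ k *\<^sub>R h)\<bar>) \<longlonglongrightarrow> 0"
  proof (cases "h = 0")
    case True
    then show ?thesis by (simp add: E_def)
  next
    case False
    have "((\<lambda>y. norm (u (x + y) - u x - grad u x \<bullet> y) / norm y) \<longlongrightarrow> 0) (at 0)"
      using has_derivative_grad[OF assms(1)] unfolding has_derivative_at by auto
    moreover have "filterlim (\<lambda>k. (1/2) ^ k *\<^sub>R h) (at 0) sequentially"
      unfolding filterlim_at
    proof
      show "\<forall>\<^sub>F k in sequentially. (1/2) ^ k *\<^sub>R h \<in> UNIV \<and> (1/2) ^ k *\<^sub>R h \<noteq> 0" using False by simp
      have "(\<lambda>k. (1/2::real) ^ k *\<^sub>R h) \<longlonglongrightarrow> 0 *\<^sub>R h" by (intro tendsto_intros LIMSEQ_realpow_zero) auto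
      then show "(\<lambda>k. (1/2::real) ^ k *\<^sub>R h) \<longlonglongrightarrow> 0" by simp
    qed
    ultimately have "(\<lambda>k. norm (E ((1/2) ^ k *\<^sub>R h)) / norm ((1/2) ^ k *\<^sub>R h)) \<longlonglongrightarrow> 0"
      unfolding E_def by (rule filterlim_compose)
    then have "(\<lambda>k. norm h * (norm (E ((1/2) ^ k *\<^sub>R h)) / norm ((1/2) ^ k *\<^sub>R h))) \<longlonglongrightarrow> norm h * 0"
      by (intro tendsto_intros)
    then show ?thesis using False by (simp add: field_simps)
  qed
  then have "(\<lambda>k. 2 ^ k * \<bar>E ((1/2) ^ k *\<^sub>R h)\<bar> + C * (norm h)\<^sup>2) \<longlonglongrightarrow> 0 + C * (norm h)\<^sup>2"
    by (intro tendsto_intros)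
  moreover have "\<bar>E h\<bar> \<le> 2 ^ k * \<bar>E ((1/2) ^ k *\<^sub>R h)\<bar> + C * (norm h)\<^sup>2" for k
  proof -
    have "C * (norm h)\<^sup>2 * (1 - (1/2) ^ k) \<le> C * (norm h)\<^sup>2 * 1"
      by (intro mult_left_mono C) auto
    then show ?thesis using iter[of h k] C[of h] by simp
  qed
  ultimately have "\<bar>E h\<bar> \<le> C * (norm h)\<^sup>2"
    by (intro LIMSEQ_le_const[of _ "C * (norm h)\<^sup>2"]) auto
  then show ?thesis by (simp add: E_def)
qed

text \<open>The gradient difference v is tested against a parallel vector w of length r = |x - z|.
  The expansions from z to z + w, from x to z and from x to z + w have errors of at most 1, 1 and 4
  times C r^2, the last because |z - x + w| \<le> 2 r. Combining them leaves the inner product of v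
  and w.\<close>

lemma grad_lipschitz_of_taylor:
  fixes u :: "real^2 \<Rightarrow> real"
  assumes taylor: "\<And>x h. \<bar>u (x + h) - u x - grad u x \<bullet> h\<bar> \<le> C * (norm h)\<^sup>2"
  shows "norm (grad u x - grad u z) \<le> 6 * C * norm (x - z)"
proof (cases "grad u x = grad u z \<or> x = z")
  case True
  then show ?thesis using taylor[of x "axis 1 1"] by auto
next
  case False
  define r where "r = norm (x - z)"
  define v where "v = grad u x - grad u z"
  have r: "r > 0" and v: "norm v > 0" using False by (auto simp: r_def v_def)
  define w where "w = (r / norm v) *\<^sub>R v"
  have nw: "norm w = r" using r v by (simp add: w_def)
  have C: "C \<ge> 0" using taylor[of x "axis 1 1"] by simp
  have 1: "\<bar>u (z + w) - u z - grad u z \<bullet> w\<bar> \<le> C * r\<^sup>2" using taylor[of z w] nw by simp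
  have 2: "\<bar>u z - u x - grad u x \<bullet> (z - x)\<bar> \<le> C * r\<^sup>2"
    using taylor[of x "z - x"] by (simp add: r_def norm_minus_commute)
  have "norm (z - x + w) \<le> 2 * r" using norm_triangle_ineq[of "z - x" w] nw by (simp add: r_def norm_minus_commute)
  then have "C * (norm (z - x + w))\<^sup>2 \<le> C * (2 * r)\<^sup>2" using C by (intro mult_left_mono power_mono) auto
  then have 3: "\<bar>u (z + w) - u x - grad u x \<bullet> (z - x + w)\<bar> \<le> 4 * C * r\<^sup>2"
    using taylor[of x "z - x + w"] by (simp add: power_mult_distrib)
  have "\<bar>v \<bullet> w\<bar> \<le> 6 * C * r\<^sup>2"
    using 1 2 3 by (simp add: v_def inner_diff_left inner_add_right)
  moreover have "v \<bullet> w = r * norm v" using v by (simp add: w_def dot_square_norm power2_eq_square)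
  ultimately have "r * norm v \<le> r * (6 * C * r)" using r v by (simp add: power2_eq_square mult_ac abs_mult)
  then show ?thesis using r by (simp add: v_def r_def)
qed

lemma grad_bound_of_taylor:
  fixes u :: "real^2 \<Rightarrow> real"
  assumes taylor: "\<And>x h. \<bar>u (x + h) - u x - grad u x \<bullet> h\<bar> \<le> C * (norm h)\<^sup>2"
    and bound: "\<And>x. \<bar>u x\<bar> \<le> A"
  shows "norm (grad u x) \<le> 2 * A + C"
proof (cases "grad u x = 0")
  case True
  then show ?thesis using taylor[of x "axis 1 1"] bound[of x] by simp
next
  case False
  define h where "h = (1 / norm (grad u x)) *\<^sub>R grad u x"
  have "norm h = 1" "grad u x \<bullet> h = norm (grad u x)"
    using False by (simp_all add: h_def dot_square_norm power2_eq_square)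
  then show ?thesis using taylor[of x h] bound[of x] bound[of "x + h"] by simp
qed

lemma lipschitz_of_grad_bound:
  fixes u :: "real^2 \<Rightarrow> real"
  assumes "\<And>x. u differentiable (at x)" "\<And>x. norm (grad u x) \<le> M"
  shows "\<bar>u x - u y\<bar> \<le> M * norm (x - y)"
proof -
  have "norm (u x - u y) \<le> M * norm (x - y)"
  proof (rule differentiable_bound[of UNIV u "\<lambda>x h. grad u x \<bullet> h"])
    show "onorm ((\<bullet>) (grad u x)) \<le> M" for x
    proof (rule onorm_bound)
      show "0 \<le> M" using assms(2)[of x] norm_ge_zero[of "grad u x"] by linarith
      show "norm (grad u x \<bullet> h) \<le> M * norm h" for h
        using order_trans[OF Cauchy_Schwarz_ineq2[of "grad u x" h] mult_right_mono[OF assms(2)[of x] norm_ge_zero[of h]]] by simp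
    qed
  qed (use has_derivative_grad[OF assms(1)] in auto)
  then show ?thesis by simp
qed

text \<open>The derivative along v = \<open>grad u x\<close> itself is |v|^2, and the difference
  quotients in that direction are at most M |v|.\<close>

lemma grad_bound_of_lipschitz:
  fixes u :: "real^2 \<Rightarrow> real"
  assumes "u differentiable (at x)" "\<And>x y. \<bar>u x - u y\<bar> \<le> M * norm (x - y)"
  shows "norm (grad u x) \<le> M"
proof -
  define v where "v = grad u x"
  have "((\<lambda>s. u (x + s *\<^sub>R v)) has_derivative (\<lambda>s. v \<bullet> (s *\<^sub>R v))) (at 0)"
  proof -
    have "(u has_derivative (\<lambda>h. v \<bullet> h)) (at (x + 0 *\<^sub>R v))"
      using has_derivative_grad[OF assms(1)] by (simp add: v_def)
    moreover have "((\<lambda>s. x + s *\<^sub>R v) has_derivative (\<lambda>s. s *\<^sub>R v)) (at 0)"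
      by (auto intro!: derivative_eq_intros)
    ultimately show ?thesis using has_derivative_compose by blast
  qed
  then have "((\<lambda>s. u (x + s *\<^sub>R v)) has_real_derivative (norm v)\<^sup>2) (at 0)"
    by (simp add: has_field_derivative_def dot_square_norm mult_commute_abs)
  then have "((\<lambda>s. (u (x + s *\<^sub>R v) - u x) / s) \<longlongrightarrow> (norm v)\<^sup>2) (at 0)"
    by (simp add: DERIV_def)
  moreover have "eventually (\<lambda>s. (u (x + s *\<^sub>R v) - u x) / s \<le> M * norm v) (at 0)"
  proof (rule eventually_at_filter[THEN iffD2], rule always_eventually, safe)
    fix s :: real assume "s \<noteq> 0"
    have "\<bar>(u (x + s *\<^sub>R v) - u x) / s\<bar> \<le> M * norm v"
      using assms(2)[of "x + s *\<^sub>R v" x] \<open>s \<noteq> 0\<close> by (simp add: abs_divide divide_le_eq mult_ac)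
    then show "(u (x + s *\<^sub>R v) - u x) / s \<le> M * norm v" by (rule abs_le_D1)
  qed
  ultimately have "(norm v)\<^sup>2 \<le> M * norm v" by (intro tendsto_upperbound) auto
  \<comment> \<open>For a zero gradient the claim is M \<ge> 0, which the Lipschitz bound at two
    distinct points provides.\<close>
  then show ?thesis
    using assms(2)[of "axis 1 1" 0] by (cases "v = 0") (auto simp: power2_eq_square v_def)
qed

section \<open>Passing to the limit in the mollifier\<close>

context smooth_step
begin

text \<open>By scaling, \<open>kern2 n 0 0\<close> has the same integral for all n > 0, so this is
  the normalisation of the approximate identity.\<close>

definition mass :: real where
  "mass = (LINT z|lborel. kern2 1 0 0 z)"

lemma kern2_continuous_on: "continuous_on S (kern2 n a b)"
  unfolding kern2_def
  by (intro tprod_continuous_on smooth1_continuous_on smooth1_higher_deriv smooth1_kern)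

lemma kern2_measurable [measurable]: "kern2 n a b \<in> borel_measurable borel"
  by (intro borel_measurable_continuous_onI kern2_continuous_on)

lemma kern2_zero:
  assumes "n \<ge> 1" "z \<notin> cbox 0 1"
  shows "kern2 n a b z = 0"
proof -
  have "(z $ 1 < 0 \<or> z $ 1 > 1) \<or> (z $ 2 < 0 \<or> z $ 2 > 1)"
    using assms(2) by (auto simp: mem_box_cart forall_2)
  moreover have "(deriv ^^ m) (kern n) s = 0" if "s < 0 \<or> s > 1" for s m
    using that kern_zero[OF assms(1)] by (intro higher_deriv_zero[of "{..<0} \<union> {1<..}"]) auto
  ultimately show ?thesis unfolding kern2_def tprod_def by auto
qed

lemma kern2_scale: "kern2 n 0 0 z = n\<^sup>2 * kern2 1 0 0 (n *\<^sub>R z)"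
  by (simp add: kern2_def tprod_def kern_def power2_eq_square)

lemma kern2_bounded: "\<exists>B. \<forall>z. \<bar>kern2 1 0 0 z\<bar> \<le> B * indicator (cbox 0 1) z"
proof -
  have "bounded (kern2 1 0 0 ` cbox 0 1)"
    by (intro compact_imp_bounded compact_continuous_image kern2_continuous_on) auto
  then obtain B where B: "\<And>z. z \<in> cbox 0 1 \<Longrightarrow> \<bar>kern2 1 0 0 z\<bar> \<le> B"
    unfolding bounded_iff by fastforce
  then show ?thesis using kern2_zero[of 1 _ 0 0] by (intro exI[of _ B]) (auto simp: indicator_def)
qed

text \<open>A zero integral would force the continuous nonnegative kernel to vanish everywhere, but
  it is positive at the centre of the unit box.\<close>

lemma mass_pos: "mass > 0"
proof -
  obtain B where B: "\<And>z. \<bar>kern2 1 0 0 z\<bar> \<le> B * indicator (cbox 0 1) z" using kern2_bounded by auto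
  have "integrable lborel (\<lambda>z::real^2. B * indicator (cbox 0 1) z)"
    by (intro integrable_mult_right) (simp add: emeasure_lborel_cbox_eq)
  then have int: "integrable lborel (kern2 1 0 0)"
    by (rule Bochner_Integration.integrable_bound) (auto intro!: AE_I2 order_trans[OF B abs_ge_self])
  have nn: "kern2 1 0 0 z \<ge> 0" for z
    by (simp add: kern2_def tprod_def kern_def step_deriv_nonneg)
  have "mass \<noteq> 0"
  proof
    assume "mass = 0"
    then have "AE z in lborel. kern2 1 0 0 z = 0"
      using integral_nonneg_eq_0_iff_AE[OF int] nn by (simp add: mass_def)
    then have "AE z in lborel. kern2 1 0 0 z \<le> 0" by eventually_elim simp
    from AE_le_continuous[OF kern2_continuous_on this]
    have "kern2 1 0 0 (\<chi> i. 1/2) \<le> 0" .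
    then show False using step_deriv_pos[of "1/2"] by (simp add: kern2_def tprod_def kern_def mult_le_0_iff)
  qed
  moreover have "mass \<ge> 0" unfolding mass_def by (intro Bochner_Integration.integral_nonneg nn)
  ultimately show ?thesis by simp
qed

text \<open>The substitution z = x + y / (n + 1) fixes the kernel and puts the scale into the
  argument of u; dominated convergence on the unit box finishes.\<close>

lemma kern2_approximates:
  assumes "continuous_on UNIV u"
  shows "(\<lambda>n. LINT z|lborel. u z * kern2 (real (Suc n)) 0 0 (z - x)) \<longlonglongrightarrow> u x * mass"
proof -
  have um: "u \<in> borel_measurable borel" using assms by (rule borel_measurable_continuous_onI)
  let ?c = "\<lambda>n. 1 / real (Suc n)"
  have eq: "(LINT z|lborel. u z * kern2 (real (Suc n)) 0 0 (z - x)) =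
      (LINT y|lborel. u (x + ?c n *\<^sub>R y) * kern2 1 0 0 y)" for n
  proof -
    have "(LINT z|lborel. u z * kern2 (real (Suc n)) 0 0 (z - x)) =
      \<bar>?c n\<bar> ^ DIM(real^2) * (LINT y|lborel. u (x + ?c n *\<^sub>R y) * kern2 (real (Suc n)) 0 0 ((x + ?c n *\<^sub>R y) - x))"
      by (rule lborel_integral_affine) (use um in auto)
    also have "\<dots> = (LINT y|lborel. \<bar>?c n\<bar> ^ DIM(real^2) * (u (x + ?c n *\<^sub>R y) * kern2 (real (Suc n)) 0 0 ((x + ?c n *\<^sub>R y) - x)))"
      by simp
    also have "\<dots> = (LINT y|lborel. u (x + ?c n *\<^sub>R y) * kern2 1 0 0 y)"
    proof (rule Bochner_Integration.integral_cong[OF refl])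
      fix y :: "real^2"
      have "\<bar>1 / N\<bar> ^ DIM(real^2) * (w * kern2 N 0 0 ((x + (1 / N) *\<^sub>R y) - x)) = w * kern2 1 0 0 y" if "N > 0" for N w
        by (subst kern2_scale[of N]) (use that in \<open>simp add: power_divide\<close>)
      from this[of "real (Suc n)"] show "\<bar>?c n\<bar> ^ DIM(real^2) * (u (x + ?c n *\<^sub>R y) * kern2 (real (Suc n)) 0 0 ((x + ?c n *\<^sub>R y) - x)) =
        u (x + ?c n *\<^sub>R y) * kern2 1 0 0 y" by simp
    qed
    finally show ?thesis .
  qed
  obtain B where B: "\<And>z. \<bar>kern2 1 0 0 z\<bar> \<le> B * indicator (cbox 0 1) z" using kern2_bounded by auto
  let ?S = "cball x (norm (1::real^2))"
  have "bounded (u ` ?S)"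
    by (intro compact_imp_bounded compact_continuous_image continuous_on_subset[OF assms]) auto
  then obtain M where M: "\<And>z. z \<in> ?S \<Longrightarrow> \<bar>u z\<bar> \<le> M"
    unfolding bounded_iff by fastforce
  have "(\<lambda>n. LINT y|lborel. u (x + ?c n *\<^sub>R y) * kern2 1 0 0 y) \<longlonglongrightarrow> (LINT y|lborel. u x * kern2 1 0 0 y)"
  proof (rule integral_dominated_convergence[where w = "\<lambda>y. M * (B * indicator (cbox 0 1) y)"])
    show "integrable lborel (\<lambda>y::real^2. M * (B * indicator (cbox 0 1) y))"
      by (intro integrable_mult_right) (simp add: emeasure_lborel_cbox_eq)
    show "AE y in lborel. (\<lambda>n. u (x + ?c n *\<^sub>R y) * kern2 1 0 0 y) \<longlonglongrightarrow> u x * kern2 1 0 0 y"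
    proof (rule AE_I2)
      fix y :: "real^2"
      have "?c \<longlonglongrightarrow> 0" using LIMSEQ_inverse_real_of_nat by (simp add: inverse_eq_divide)
      then have "(\<lambda>n. x + ?c n *\<^sub>R y) \<longlonglongrightarrow> x + 0 *\<^sub>R y" by (intro tendsto_intros)
      then have "(\<lambda>n. u (x + ?c n *\<^sub>R y)) \<longlonglongrightarrow> u x"
        using continuous_on_tendsto_compose[OF assms, of "\<lambda>n. x + ?c n *\<^sub>R y" x] by simp
      then show "(\<lambda>n. u (x + ?c n *\<^sub>R y) * kern2 1 0 0 y) \<longlonglongrightarrow> u x * kern2 1 0 0 y"
        by (intro tendsto_intros)
    qed
    show "AE y in lborel. norm (u (x + ?c n *\<^sub>R y) * kern2 1 0 0 y) \<le> M * (B * indicator (cbox 0 1) y)" for n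
    proof (rule AE_I2)
      fix y :: "real^2"
      show "norm (u (x + ?c n *\<^sub>R y) * kern2 1 0 0 y) \<le> M * (B * indicator (cbox 0 1) y)"
      proof (cases "y \<in> cbox 0 1")
        case True
        have "norm y \<le> norm (1::real^2)"
          using True by (intro norm_le_componentwise_cart) (auto simp: mem_box_cart)
        then have "norm (?c n *\<^sub>R y) \<le> norm (1::real^2)"
          by (simp add: divide_le_eq) (smt (verit) mult_left_mono norm_ge_zero of_nat_0_le_iff mult_cancel_left1)
        then have "\<bar>u (x + ?c n *\<^sub>R y)\<bar> \<le> M" by (intro M) (simp add: dist_norm)
        then have "\<bar>u (x + ?c n *\<^sub>R y)\<bar> * \<bar>kern2 1 0 0 y\<bar> \<le> M * (B * indicator (cbox 0 1) y)"
          by (intro mult_mono B) auto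
        then show ?thesis by (simp add: abs_mult)
      qed (simp add: kern2_zero)
    qed
    show "(\<lambda>y. u (x + ?c n *\<^sub>R y) * kern2 1 0 0 y) \<in> borel_measurable lborel" for n
      using um by simp
  qed simp
  then show ?thesis unfolding eq by (simp add: mass_def)
qed

lemma sup_bound_of_kern2_bound:
  assumes "continuous_on UNIV u"
    and "\<And>n. n \<ge> 1 \<Longrightarrow> \<bar>LINT z|lborel. u z * kern2 n 0 0 (z - x)\<bar> \<le> K"
  shows "\<bar>u x\<bar> * mass \<le> K"
proof -
  have "(\<lambda>n. \<bar>LINT z|lborel. u z * kern2 (real (Suc n)) 0 0 (z - x)\<bar>) \<longlonglongrightarrow> \<bar>u x * mass\<bar>"
    by (intro tendsto_rabs kern2_approximates assms)
  then have "\<bar>u x * mass\<bar> \<le> K"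
    by (rule LIMSEQ_le_const2) (use assms(2) in auto)
  then show ?thesis using mass_pos by (simp add: abs_mult)
qed

lemma kern2_has_derivative:
  "((\<lambda>\<tau>. kern2 n a b (w - \<tau> *\<^sub>R h)) has_real_derivative
     - (h $ 1 * kern2 n (Suc a) b (w - \<tau> *\<^sub>R h) + h $ 2 * kern2 n a (Suc b) (w - \<tau> *\<^sub>R h))) (at \<tau>)"
proof -
  have 1: "((\<lambda>\<tau>. (deriv ^^ m) (kern n) (c - \<tau> * d)) has_real_derivative (deriv ^^ Suc m) (kern n) (c - \<tau> * d) * (- d)) (at \<tau>)"
    for m c d
    using smooth1_has_deriv[OF smooth1_higher_deriv[OF smooth1_kern, of m n], of "c - \<tau> * d"]
    by (intro DERIV_chain2[of "(deriv ^^ m) (kern n)"]) (auto intro!: derivative_eq_intros)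
  show ?thesis unfolding kern2_def tprod_def vector_minus_component vector_scaleR_component real_scaleR_def
    by (rule DERIV_cong[OF DERIV_mult[OF 1 1]]) (simp add: algebra_simps)
qed

text \<open>Differentiating the pairing with respect to a translation of the kernel along h yields
  pairings with kernels of order at most 2, bounded by K uniformly in n. This controls second
  differences of the mollified function, and the limit in n gives those of u.\<close>

lemma second_difference_bound:
  assumes cont: "continuous_on UNIV u"
    and K: "\<And>n a b x. n \<ge> 1 \<Longrightarrow> a + b \<le> 2 \<Longrightarrow> \<bar>LINT z|lborel. u z * kern2 n a b (z - x)\<bar> \<le> K"
  shows "\<bar>u (x + h) - 2 * u x + u (x - h)\<bar> * mass \<le> 4 * K * (norm h)\<^sup>2"
proof -
  \<comment> \<open>This prepares one fixed box containing the supports of the kernels for all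
    |\<tau>| \<le> 1, so that the Leibniz rule applies on a domain independent of \<tau>.\<close>
  obtain R where "R > 0" and R: "cbox (0::real^2) 1 \<subseteq> ball 0 R"
    using bounded_cbox bounded_subset_ballD by blast
  define r where "r = R + norm x + norm h"
  have um: "u \<in> borel_measurable borel" using cont by (rule borel_measurable_continuous_onI)
  obtain c :: "real^2" where c: "cball 0 r \<subseteq> cbox (- c) c"
    using bounded_subset_cbox_symmetric[OF bounded_cball] by blast
  define F where "F n a b \<tau> = integral (cbox (-c) c) (\<lambda>z. u z * kern2 n a b (z - x - \<tau> *\<^sub>R h))" for n a b \<tau>
  have cont': "continuous_on S (\<lambda>z. u z * kern2 n a b (z - x - \<tau> *\<^sub>R h))" for n a b \<tau> S
    by (intro continuous_intros continuous_on_subset[OF cont] continuous_on_compose2[OF kern2_continuous_on[of UNIV]]) auto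
  have F: "F n a b \<tau> = (LINT z|lborel. u z * kern2 n a b (z - (x + \<tau> *\<^sub>R h)))" if "n \<ge> 1" "\<bar>\<tau>\<bar> \<le> 1" for n a b \<tau>
  proof -
    have z: "u z * kern2 n a b (z - x - \<tau> *\<^sub>R h) = 0" if "z \<notin> cbox (- c) c" for z
    proof -
      have "norm z > r" using that c by (auto simp: not_le[symmetric])
      moreover have "norm (\<tau> *\<^sub>R h) \<le> norm h" using \<open>\<bar>\<tau>\<bar> \<le> 1\<close> by (simp add: mult_left_le_one_le)
      moreover have "norm z \<le> norm (z - x - \<tau> *\<^sub>R h) + norm x + norm (\<tau> *\<^sub>R h)"
        using norm_triangle_ineq[of "z - x - \<tau> *\<^sub>R h" "x + \<tau> *\<^sub>R h"] norm_triangle_ineq[of x "\<tau> *\<^sub>R h"] by simp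
      ultimately have "norm (z - x - \<tau> *\<^sub>R h) > R" unfolding r_def by linarith
      then have "z - x - \<tau> *\<^sub>R h \<notin> cbox 0 1" using R by auto
      then show ?thesis using kern2_zero[OF \<open>n \<ge> 1\<close>] by simp
    qed
    have "set_integrable lborel (cbox (-c) c) (\<lambda>z. u z * kern2 n a b (z - x - \<tau> *\<^sub>R h))"
      by (rule borel_integrable_compact[unfolded set_integrable_def[symmetric], OF compact_cbox cont'])
    from set_borel_integral_eq_integral(2)[OF this]
    have "F n a b \<tau> = (LINT z|lborel. indicator (cbox (-c) c) z *\<^sub>R (u z * kern2 n a b (z - x - \<tau> *\<^sub>R h)))"
      by (simp add: F_def set_lebesgue_integral_def)
    also have "\<dots> = (LINT z|lborel. u z * kern2 n a b (z - x - \<tau> *\<^sub>R h))"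
      by (rule Bochner_Integration.integral_cong) (use z in \<open>auto simp: indicator_def\<close>)
    finally show ?thesis by (simp add: diff_diff_eq)
  qed
  have dF: "(F n a b has_real_derivative - (h $ 1 * F n (Suc a) b \<tau> + h $ 2 * F n a (Suc b) \<tau>)) (at \<tau>)" for n a b \<tau>
  proof -
    let ?f' = "\<lambda>\<tau> z. u z * - (h $ 1 * kern2 n (Suc a) b (z - x - \<tau> *\<^sub>R h) + h $ 2 * kern2 n a (Suc b) (z - x - \<tau> *\<^sub>R h))"
    have "((\<lambda>\<tau>. integral (cbox (-c) c) (\<lambda>z. u z * kern2 n a b (z - x - \<tau> *\<^sub>R h))) has_field_derivative
      integral (cbox (-c) c) (?f' \<tau>)) (at \<tau> within UNIV)"
    proof (rule leibniz_rule_field_derivative)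
      show "((\<lambda>\<tau>. u z * kern2 n a b (z - x - \<tau> *\<^sub>R h)) has_field_derivative ?f' \<tau> z) (at \<tau> within UNIV)" for \<tau> z
        using DERIV_cmult[OF kern2_has_derivative] by simp
      show "continuous_on (UNIV \<times> cbox (-c) c) (\<lambda>(\<tau>, z). ?f' \<tau> z)"
        unfolding case_prod_unfold
        by (intro continuous_intros continuous_on_compose2[OF cont] continuous_on_compose2[OF kern2_continuous_on[of UNIV]]) auto
    qed (auto intro!: integrable_continuous cont')
    moreover have "integral (cbox (-c) c) (?f' \<tau>) = - (h $ 1 * F n (Suc a) b \<tau> + h $ 2 * F n a (Suc b) \<tau>)"
    proof -
      have hi: "((\<lambda>z. u z * kern2 n a b (z - x - \<tau> *\<^sub>R h)) has_integral F n a b \<tau>) (cbox (-c) c)" for a b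
        unfolding F_def by (intro integrable_integral integrable_continuous cont')
      have sum: "((\<lambda>z. - (h $ 1 * (u z * kern2 n (Suc a) b (z - x - \<tau> *\<^sub>R h)) + h $ 2 * (u z * kern2 n a (Suc b) (z - x - \<tau> *\<^sub>R h))))
        has_integral - (h $ 1 * F n (Suc a) b \<tau> + h $ 2 * F n a (Suc b) \<tau>)) (cbox (-c) c)"
        by (intro has_integral_neg has_integral_add has_integral_mult_right hi)
      have "?f' \<tau> = (\<lambda>z. - (h $ 1 * (u z * kern2 n (Suc a) b (z - x - \<tau> *\<^sub>R h)) + h $ 2 * (u z * kern2 n a (Suc b) (z - x - \<tau> *\<^sub>R h))))"
        by (simp only: minus_add_distrib mult_minus_right distrib_left mult.left_commute)
      then show ?thesis by (simp only:) (rule integral_unique[OF sum])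
    qed
    ultimately show ?thesis by (simp add: F_def[abs_def])
  qed
  have fin: "\<bar>F n 0 0 1 - 2 * F n 0 0 0 + F n 0 0 (-1)\<bar> \<le> 4 * K * (norm h)\<^sup>2" if n: "n \<ge> 1" for n
  proof -
    define m1 where "m1 \<tau> = - (h $ 1 * F n 1 0 \<tau> + h $ 2 * F n 0 1 \<tau>)" for \<tau>
    define m2 where "m2 \<tau> = (h $ 1)\<^sup>2 * F n 2 0 \<tau> + 2 * (h $ 1) * (h $ 2) * F n 1 1 \<tau> + (h $ 2)\<^sup>2 * F n 0 2 \<tau>" for \<tau>
    have d1: "(F n 0 0 has_real_derivative m1 \<tau>) (at \<tau>)" for \<tau> using dF[of n 0 0] by (simp add: m1_def)
    have d2: "(m1 has_real_derivative m2 \<tau>) (at \<tau>)" for \<tau>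
      unfolding m1_def m2_def
      by (rule DERIV_cong, (rule derivative_intros dF)+) (simp add: algebra_simps power2_eq_square numeral_2_eq_2)
    have b2: "\<bar>m2 \<tau>\<bar> \<le> 2 * K * (norm h)\<^sup>2" if "\<bar>\<tau>\<bar> \<le> 1" for \<tau>
    proof -
      have FK: "\<bar>F n a b \<tau>\<bar> \<le> K" if "a + b \<le> 2" for a b
        unfolding F[OF n \<open>\<bar>\<tau>\<bar> \<le> 1\<close>] by (rule K[OF n that])
      have K0: "K \<ge> 0" using FK[of 0 0] by simp
      have "\<bar>m2 \<tau>\<bar> \<le> (h $ 1)\<^sup>2 * \<bar>F n 2 0 \<tau>\<bar> + 2 * \<bar>h $ 1\<bar> * \<bar>h $ 2\<bar> * \<bar>F n 1 1 \<tau>\<bar> + (h $ 2)\<^sup>2 * \<bar>F n 0 2 \<tau>\<bar>"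
        unfolding m2_def by (rule order_trans[OF abs_triangle_ineq]) (auto simp: abs_mult intro!: add_mono order_trans[OF abs_triangle_ineq])
      also have "\<dots> \<le> (h $ 1)\<^sup>2 * K + 2 * \<bar>h $ 1\<bar> * \<bar>h $ 2\<bar> * K + (h $ 2)\<^sup>2 * K"
        by (intro add_mono mult_left_mono FK) auto
      also have "\<dots> = (\<bar>h $ 1\<bar> + \<bar>h $ 2\<bar>)\<^sup>2 * K" by (simp add: power2_sum algebra_simps)
      also have "\<dots> \<le> (2 * (norm h)\<^sup>2) * K"
      proof (rule mult_right_mono[OF _ K0])
        have "(norm h)\<^sup>2 = (h $ 1)\<^sup>2 + (h $ 2)\<^sup>2"
          by (simp add: norm_vec_def L2_set_def sum_2)
        then show "(\<bar>h $ 1\<bar> + \<bar>h $ 2\<bar>)\<^sup>2 \<le> 2 * (norm h)\<^sup>2"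
          using sum_squares_bound[of "\<bar>h $ 1\<bar>" "\<bar>h $ 2\<bar>"] by (simp add: power2_sum)
      qed
      finally show ?thesis by (simp add: mult_ac)
    qed
    \<comment> \<open>Symmetrising in \<tau> turns the second difference into
      \<open>?r 1 - ?r 0\<close>. Two uses of the mean value theorem give 2 \<xi> times a value of
      \<open>m2\<close>, with \<xi> < 1. The final 4 is this 2 times the 2 from (|h1| + |h2|)^2
      \<le> 2 |h|^2.\<close>
    let ?r = "\<lambda>\<tau>. F n 0 0 \<tau> + F n 0 0 (- \<tau>)"
    have "(?r has_real_derivative m1 \<tau> - m1 (- \<tau>)) (at \<tau>)" for \<tau>
    proof -
      have "((\<lambda>\<tau>. F n 0 0 (- \<tau>)) has_real_derivative m1 (- \<tau>) * (- 1)) (at \<tau>)"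
        by (rule DERIV_chain2[of "F n 0 0"]) (auto intro!: derivative_eq_intros d1)
      from DERIV_add[OF d1[of \<tau>] this] show ?thesis by simp
    qed
    then obtain \<xi> where \<xi>: "0 < \<xi>" "\<xi> < 1" "?r 1 - ?r 0 = (1 - 0) * (m1 \<xi> - m1 (- \<xi>))"
      using MVT2[of 0 1 ?r "\<lambda>\<tau>. m1 \<tau> - m1 (- \<tau>)"] by auto
    obtain \<zeta> where \<zeta>: "- \<xi> < \<zeta>" "\<zeta> < \<xi>" "m1 \<xi> - m1 (- \<xi>) = (\<xi> - (- \<xi>)) * m2 \<zeta>"
      using MVT2[of "-\<xi>" \<xi> m1 m2] d2 \<xi> by auto
    have "F n 0 0 1 - 2 * F n 0 0 0 + F n 0 0 (-1) = 2 * \<xi> * m2 \<zeta>"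
      using \<xi>(3) \<zeta>(3) by simp
    then have "\<bar>F n 0 0 1 - 2 * F n 0 0 0 + F n 0 0 (-1)\<bar> = 2 * \<xi> * \<bar>m2 \<zeta>\<bar>"
      using \<xi>(1) by (simp add: abs_mult)
    also have "\<dots> \<le> 2 * (2 * K * (norm h)\<^sup>2)"
      using \<xi> \<zeta> b2[of \<zeta>] by (intro mult_mono) auto
    finally show ?thesis by simp
  qed
  have "(\<lambda>k. F (real (Suc k)) 0 0 1) \<longlonglongrightarrow> u (x + h) * mass" "(\<lambda>k. F (real (Suc k)) 0 0 0) \<longlonglongrightarrow> u x * mass"
    "(\<lambda>k. F (real (Suc k)) 0 0 (-1)) \<longlonglongrightarrow> u (x - h) * mass"
    using kern2_approximates[OF cont, of "x + h"] kern2_approximates[OF cont, of x] kern2_approximates[OF cont, of "x - h"]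
    by (simp_all add: F)
  then have "(\<lambda>k. \<bar>F (real (Suc k)) 0 0 1 - 2 * F (real (Suc k)) 0 0 0 + F (real (Suc k)) 0 0 (-1)\<bar>)
     \<longlonglongrightarrow> \<bar>u (x + h) * mass - 2 * (u x * mass) + u (x - h) * mass\<bar>"
    by (intro tendsto_intros)
  then have "\<bar>u (x + h) * mass - 2 * (u x * mass) + u (x - h) * mass\<bar> \<le> 4 * K * (norm h)\<^sup>2"
    by (rule LIMSEQ_le_const2) (use fin in auto)
  also have "u (x + h) * mass - 2 * (u x * mass) + u (x - h) * mass = (u (x + h) - 2 * u x + u (x - h)) * mass"
    by (simp add: algebra_simps)
  finally show ?thesis using mass_pos by (simp add: abs_mult)
qed

end

section \<open>Comparison of the principal values\<close>

lemma integrable_on_bounded_set: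
  fixes f :: "'a::euclidean_space \<Rightarrow> real"
  assumes "A \<in> sets lborel" "bounded A" "f \<in> borel_measurable borel" "\<And>y. y \<in> A \<Longrightarrow> \<bar>f y\<bar> \<le> B"
  shows "integrable lborel (\<lambda>y. indicator A y * f y)"
proof -
  have "integrable lborel (\<lambda>y. B * indicator A y)"
    using assms(1,2) emeasure_bounded_finite[of A] by (intro integrable_mult_right) simp
  then show ?thesis
  proof (rule Bochner_Integration.integrable_bound)
    show "(\<lambda>y. indicator A y * f y) \<in> borel_measurable lborel" using assms by simp
    show "AE y in lborel. norm (indicator A y * f y) \<le> norm (B * indicator A y)"
      by (rule AE_I2) (use assms(4) in \<open>auto simp: indicator_def intro: order_trans[OF _ abs_ge_self]\<close>)
  qed
qed

lemma integral_eq_lebesgue_on_bounded_set: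
  fixes f :: "'a::euclidean_space \<Rightarrow> real"
  assumes "A \<in> sets lborel" "bounded A" "f \<in> borel_measurable borel" "\<And>y. y \<in> A \<Longrightarrow> \<bar>f y\<bar> \<le> B"
  shows "integral A f = (LINT y|lborel. indicator A y * f y)"
proof -
  have "set_integrable lborel A f"
    using integrable_on_bounded_set[OF assms] by (simp add: set_integrable_def)
  from set_borel_integral_eq_integral(2)[OF this] show ?thesis by (simp add: set_lebesgue_integral_def)
qed

text \<open>The situation at one fixed time, with x a maximum point of the increment by h.
  \<open>\<Psi>\<close> may be any primitive of the weight, since it enters through its
  differences.\<close>

locale comparison =
  fixes \<alpha> L C :: real and u :: "real^2 \<Rightarrow> real" and x h :: "real^2" and \<Psi> :: "real \<Rightarrow> real"
  assumes \<alpha>: "0 \<le> \<alpha>" "\<alpha> < 1"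
    and small: "(5 + \<alpha>) * L\<^sup>2 \<le> 1 + \<alpha>"
    and diff: "\<And>x. u differentiable (at x)"
    and grad_cont: "continuous_on UNIV (grad u)"
    and lip: "\<And>x y. \<bar>u x - u y\<bar> \<le> L * norm (x - y)"
    and grad_eq: "grad u (x + h) = grad u x"
    and is_max: "\<And>z. u (z + h) - u z \<le> u (x + h) - u x"
    and taylor: "\<And>x h. \<bar>u (x + h) - u x - grad u x \<bullet> h\<bar> \<le> C * (norm h)\<^sup>2"
    and \<Psi>: "\<And>q. (\<Psi> has_real_derivative (1 + q\<^sup>2) powr (- ((3 + \<alpha>) / 2))) (at q)"
begin

definition w :: "real \<Rightarrow> real" where "w q = (1 + q\<^sup>2) powr (- ((3 + \<alpha>) / 2))"
definition quot :: "real^2 \<Rightarrow> real^2 \<Rightarrow> real" where "quot v y = (u v - u (v - y)) / norm y"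
definition slope :: "real^2 \<Rightarrow> real^2 \<Rightarrow> real" where "slope v y = (grad u (v - y) \<bullet> y) / norm y"
definition \<kappa> :: "real^2 \<Rightarrow> real" where "\<kappa> y = \<Psi> (quot (x + h) y) - \<Psi> (quot x y)"
definition \<psi> :: "real^2 \<Rightarrow> real" where "\<psi> y = norm y powr (- 2 - \<alpha>) * \<kappa> y"
definition K :: "real^2 \<Rightarrow> real^2 \<Rightarrow> real" where
  "K v y = ((grad u v - grad u (v - y)) \<bullet> y) / ((norm y)\<^sup>2 + (u v - u (v - y))\<^sup>2) powr ((3 + \<alpha>) / 2)"
text \<open>\<open>norm y powr (- 2 - \<alpha>) * D\<kappa> y\<close> is the divergence of the field
  \<open>\<psi> y *\<^sub>R y\<close>: the dimension 2 and the homogeneity -2 - \<alpha> add up to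
  -\<alpha>, and the rest is the radial derivative of \<open>\<kappa>\<close>.\<close>

definition D\<kappa> :: "real^2 \<Rightarrow> real" where
  "D\<kappa> y = - \<alpha> * \<kappa> y + (w (quot (x + h) y) * (slope (x + h) y - quot (x + h) y) - w (quot x y) * (slope x y - quot x y))"

lemma L_nonneg: "L \<ge> 0"
  using lip[of "axis 1 1" 0] abs_ge_zero[of "u (axis 1 1) - u 0"] by (simp add: norm_axis_1)

lemma C_nonneg: "C \<ge> 0"
  using taylor[of 0 "axis 1 1"] abs_ge_zero[of "u (0 + axis 1 1) - u 0 - grad u 0 \<bullet> axis 1 1"]
  by (simp add: norm_axis_1)

lemma quot_bound: "\<bar>quot v y\<bar> \<le> L"
  using lip[of v "v - y"] L_nonneg by (cases "y = 0") (auto simp: quot_def divide_le_eq)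

lemma inner_quot_bound: "\<bar>(grad u v \<bullet> y) / norm y\<bar> \<le> L"
proof (cases "y = 0")
  case False
  have "\<bar>grad u v \<bullet> y\<bar> \<le> L * norm y"
    using Cauchy_Schwarz_ineq2[of "grad u v" y] mult_right_mono[OF grad_bound_of_lipschitz[OF diff lip, of v] norm_ge_zero[of y]]
    by linarith
  then show ?thesis using False by (simp add: divide_le_eq)
qed (use L_nonneg in simp)

lemma slope_bound: "\<bar>slope v y\<bar> \<le> L"
  unfolding slope_def by (rule inner_quot_bound)

lemma w_bound: "0 < w q" "w q \<le> 1"
proof -
  have pos: "1 + q\<^sup>2 > 0" by (simp add: add_pos_nonneg)
  then show "0 < w q" by (simp add: w_def)
  have "1 \<le> (1 + q\<^sup>2) powr ((3 + \<alpha>) / 2)" using \<alpha> by (intro ge_one_powr_ge_zero) auto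
  then show "w q \<le> 1" unfolding w_def powr_minus by (simp add: inverse_le_1_iff)
qed

lemma \<Psi>_mono: "a \<le> b \<Longrightarrow> \<Psi> a \<le> \<Psi> b"
  by (rule DERIV_nonneg_imp_nondecreasing) (use \<Psi> in \<open>auto intro!: exI\<close>)

lemma \<Psi>_lipschitz: "\<bar>\<Psi> a - \<Psi> b\<bar> \<le> \<bar>a - b\<bar>"
proof -
  have *: "\<Psi> b - \<Psi> a \<le> b - a" if "a \<le> b" for a b
  proof -
    have "(\<lambda>q. q - \<Psi> q) a \<le> (\<lambda>q. q - \<Psi> q) b"
      by (rule DERIV_nonneg_imp_nondecreasing[OF that])
        (use w_bound(2) in \<open>auto intro!: exI derivative_eq_intros \<Psi> simp: w_def\<close>)
    then show ?thesis by simp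
  qed
  then show ?thesis using *[of a b] *[of b a] \<Psi>_mono[of a b] \<Psi>_mono[of b a] by (cases "a \<le> b") auto
qed

text \<open>What remains of the integrand once the divergence is split off; a stands for the slope
  at the base point in the direction of y, which x and x + h share.\<close>

definition H :: "real \<Rightarrow> real \<Rightarrow> real" where "H a q = (a - q) * w q - \<alpha> * \<Psi> q"

text \<open>With w(q) = (1 + q^2) r and w'(q) = -(3 + \<alpha>) q r, the derivative of
  \<open>H a\<close> is r times -(1 + \<alpha>) + 2 q^2 - (3 + \<alpha>) a q. For |a|, |q| \<le> L
  the second factor is at most -(1 + \<alpha>) + (5 + \<alpha>) L^2, which explains the slope
  threshold.\<close>

lemma H_antimono:
  assumes "\<bar>a\<bar> \<le> L" "\<bar>b\<bar> \<le> L" "\<bar>c\<bar> \<le> L" "b \<le> c"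
  shows "H a c \<le> H a b"
proof (rule DERIV_nonpos_imp_nonincreasing[OF \<open>b \<le> c\<close>])
  fix q assume "b \<le> q" "q \<le> c"
  then have q: "\<bar>q\<bar> \<le> L" using assms by linarith
  have pos: "1 + q\<^sup>2 > 0" by (simp add: add_pos_nonneg)
  define r where "r = (1 + q\<^sup>2) powr (- ((3 + \<alpha>) / 2) - 1)"
  have r: "r > 0" using pos by (simp add: r_def)
  have wr: "w q = (1 + q\<^sup>2) * r"
    using pos by (simp add: w_def r_def powr_diff)
  have dw: "(w has_real_derivative - (3 + \<alpha>) * q * r) (at q)"
    unfolding w_def[abs_def] r_def using pos
    by (auto intro!: derivative_eq_intros simp: powr_diff field_simps)
  have d\<Psi>: "(\<Psi> has_real_derivative w q) (at q)" using \<Psi> by (simp add: w_def)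
  have "(H a has_real_derivative ((a - q) * (- (3 + \<alpha>) * q * r) - w q) - \<alpha> * w q) (at q)"
    unfolding H_def[abs_def] by (auto intro!: derivative_eq_intros dw d\<Psi>)
  moreover have "((a - q) * (- (3 + \<alpha>) * q * r) - w q) - \<alpha> * w q \<le> 0"
  proof -
    have "q\<^sup>2 \<le> L\<^sup>2" using q L_nonneg abs_le_square_iff[of q L] by simp
    moreover have "\<bar>a * q\<bar> \<le> L\<^sup>2" using mult_mono[OF assms(1) q] L_nonneg by (simp add: abs_mult power2_eq_square)
    then have "- (a * q) \<le> L\<^sup>2" by linarith
    then have "(3 + \<alpha>) * - (a * q) \<le> (3 + \<alpha>) * L\<^sup>2" using \<alpha> by (intro mult_left_mono) auto
    ultimately have "- (1 + \<alpha>) + 2 * q\<^sup>2 + (3 + \<alpha>) * - (a * q) \<le> 0"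
      using small by (simp add: algebra_simps)
    then have "r * (- (1 + \<alpha>) + 2 * q\<^sup>2 + (3 + \<alpha>) * - (a * q)) \<le> 0" using r by (simp add: mult_nonneg_nonpos)
    then show ?thesis unfolding wr by (simp add: algebra_simps power2_eq_square)
  qed
  ultimately show "\<exists>y. (H a has_real_derivative y) (at q) \<and> y \<le> 0" by blast
qed

text \<open>Maximality tested at x - y; it orders the difference quotients at x and x + h for every
  y.\<close>

lemma increment: "u x - u (x - y) \<le> u (x + h) - u (x + h - y)"
  using is_max[of "x - y"] by (simp add: algebra_simps)

lemma quot_mono: "quot x y \<le> quot (x + h) y"
  unfolding quot_def using increment[of y] by (intro divide_right_mono) auto

text \<open>Equal gradients cancel the linear Taylor terms and leave two quadratic errors. Hence
  \<open>\<kappa>\<close> is O(|y|) at the origin, which makes the flux through small circles vanish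
  in the limit.\<close>

lemma quot_diff: "quot (x + h) y - quot x y \<le> 2 * C * norm y"
proof (cases "y = 0")
  case False
  have "u (x + h) - u (x + h - y) - (u x - u (x - y)) \<le> 2 * C * (norm y)\<^sup>2"
    using taylor[of "x + h" "- y"] taylor[of x "- y"] grad_eq by simp
  then have "(u (x + h) - u (x + h - y) - (u x - u (x - y))) / norm y \<le> 2 * C * (norm y)\<^sup>2 / norm y"
    by (rule divide_right_mono) simp
  then show ?thesis using False by (simp add: quot_def diff_divide_distrib power2_eq_square)
qed (simp add: quot_def)

lemma \<kappa>_nonneg: "0 \<le> \<kappa> y"
  unfolding \<kappa>_def using \<Psi>_mono[OF quot_mono] by simp

lemma \<kappa>_le: "\<kappa> y \<le> 2 * C * norm y" "\<kappa> y \<le> 2 * L"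
  using \<Psi>_lipschitz[of "quot (x + h) y" "quot x y"] quot_diff[of y] quot_mono[of y]
    quot_bound[of "x + h" y] quot_bound[of x y] unfolding \<kappa>_def by linarith+

lemma \<psi>_nonneg: "0 \<le> \<psi> y"
  by (simp add: \<psi>_def \<kappa>_nonneg)

lemma K_eq:
  assumes "y \<noteq> 0"
  shows "K v y = norm y powr (- 2 - \<alpha>) * (((grad u v \<bullet> y) / norm y - slope v y) * w (quot v y))"
proof -
  have n: "norm y > 0" using assms by simp
  have "(norm y)\<^sup>2 + (u v - u (v - y))\<^sup>2 = (norm y)\<^sup>2 * (1 + (quot v y)\<^sup>2)"
    using n by (simp add: quot_def power_divide algebra_simps)
  then have "((norm y)\<^sup>2 + (u v - u (v - y))\<^sup>2) powr ((3 + \<alpha>) / 2) =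
      norm y powr (3 + \<alpha>) * (1 + (quot v y)\<^sup>2) powr ((3 + \<alpha>) / 2)"
  proof -
    have "((norm y)\<^sup>2) powr ((3 + \<alpha>) / 2) = (norm y powr 2) powr ((3 + \<alpha>) / 2)" using n by simp
    also have "\<dots> = norm y powr (2 * ((3 + \<alpha>) / 2))" by (rule powr_powr)
    also have "2 * ((3 + \<alpha>) / 2) = 3 + \<alpha>" by simp
    finally have "((norm y)\<^sup>2) powr ((3 + \<alpha>) / 2) = norm y powr (3 + \<alpha>)" .
    moreover assume "(norm y)\<^sup>2 + (u v - u (v - y))\<^sup>2 = (norm y)\<^sup>2 * (1 + (quot v y)\<^sup>2)"
    ultimately show ?thesis by (simp add: powr_mult add_nonneg_nonneg)
  qed
  then have "K v y = norm y * (((grad u v \<bullet> y) / norm y - slope v y)) /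
      (norm y powr (3 + \<alpha>) * (1 + (quot v y)\<^sup>2) powr ((3 + \<alpha>) / 2))"
    using n by (simp add: K_def slope_def inner_diff_left diff_divide_distrib right_diff_distrib)
  also have "\<dots> = (norm y / norm y powr (3 + \<alpha>)) * ((((grad u v \<bullet> y) / norm y - slope v y)) * w (quot v y))"
  proof -
    have "a * b / (c * d) = (a / c) * (b * inverse d)" for a b c d :: real
      by (simp add: field_simps)
    then show ?thesis unfolding w_def powr_minus .
  qed
  also have "norm y / norm y powr (3 + \<alpha>) = norm y powr (- 2 - \<alpha>)"
  proof -
    have "1 - (3 + \<alpha>) = - 2 - \<alpha>" by simp
    then show ?thesis using n powr_diff[of "norm y" 1 "3 + \<alpha>"] by (simp only: powr_one zero_le_dist norm_ge_zero)
  qed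
  finally show ?thesis .
qed

text \<open>The terms with \<open>slope\<close> cancel against those in \<open>D\<kappa>\<close>.
  What remains is exactly a difference of two values of \<open>H\<close> with the same a, by
  \<open>grad_eq\<close>, and it has a sign by \<open>H_antimono\<close>.\<close>

lemma kernel_difference:
  assumes "y \<noteq> 0"
  shows "K (x + h) y - K x y \<le> - (norm y powr (- 2 - \<alpha>) * D\<kappa> y)"
proof -
  let ?a = "(grad u x \<bullet> y) / norm y"
  have "K (x + h) y - K x y + norm y powr (- 2 - \<alpha>) * D\<kappa> y =
      norm y powr (- 2 - \<alpha>) * (H ?a (quot (x + h) y) - H ?a (quot x y))"
    unfolding K_eq[OF assms] D\<kappa>_def \<kappa>_def H_def grad_eq by (simp add: algebra_simps)
  moreover have "norm y powr (- 2 - \<alpha>) * (H ?a (quot (x + h) y) - H ?a (quot x y)) \<le> 0"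
    using H_antimono[OF inner_quot_bound[of x y] quot_bound[of x y] quot_bound[of "x + h" y] quot_mono[of y]]
    by (intro mult_nonneg_nonpos) auto
  ultimately show ?thesis by linarith
qed

lemma quot_ray:
  assumes "l > 0" "y \<noteq> 0"
  shows "((\<lambda>l. quot v (l *\<^sub>R y)) has_real_derivative (slope v (l *\<^sub>R y) - quot v (l *\<^sub>R y)) / l) (at l)"
proof -
  have "((\<lambda>l. u (v - l *\<^sub>R y)) has_derivative (\<lambda>s. grad u (v - l *\<^sub>R y) \<bullet> (- (s *\<^sub>R y)))) (at l)"
    by (rule has_derivative_compose[OF _ has_derivative_grad[OF diff]]) (auto intro!: derivative_eq_intros)
  then have du: "((\<lambda>l. u (v - l *\<^sub>R y)) has_real_derivative - (grad u (v - l *\<^sub>R y) \<bullet> y)) (at l)"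
    unfolding has_field_derivative_def by (rule has_derivative_eq_rhs) (simp add: fun_eq_iff)
  have "((\<lambda>l. (u v - u (v - l *\<^sub>R y)) / (l * norm y)) has_real_derivative
      (slope v (l *\<^sub>R y) - quot v (l *\<^sub>R y)) / l) (at l)"
    using assms
    by (auto intro!: derivative_eq_intros du simp: slope_def quot_def divide_simps) (simp add: algebra_simps power2_eq_square)
  moreover have "eventually (\<lambda>l. (u v - u (v - l *\<^sub>R y)) / (l * norm y) = quot v (l *\<^sub>R y)) (nhds l)"
  proof -
    have "eventually (\<lambda>l. l > 0) (nhds l)" using assms(1)
      unfolding eventually_nhds by (intro exI[of _ "{0<..}"]) auto
    then show ?thesis by eventually_elim (simp add: quot_def)
  qed
  ultimately show ?thesis by (subst (asm) DERIV_cong_ev[OF refl _ refl])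
qed

text \<open>Along dilations the divergence becomes a derivative in one variable. The exponent
  -\<alpha> combines the Jacobian l^2 with the homogeneity l^(-2 - \<alpha>).\<close>

lemma \<kappa>_ray:
  assumes "l > 0" "y \<noteq> 0"
  shows "((\<lambda>l. l powr (- \<alpha>) * \<kappa> (l *\<^sub>R y)) has_real_derivative l powr (- \<alpha> - 1) * D\<kappa> (l *\<^sub>R y)) (at l)"
proof -
  have q: "((\<lambda>l. \<Psi> (quot v (l *\<^sub>R y))) has_real_derivative
      w (quot v (l *\<^sub>R y)) * ((slope v (l *\<^sub>R y) - quot v (l *\<^sub>R y)) / l)) (at l)" for v
    unfolding w_def by (rule DERIV_chain2[OF \<Psi> quot_ray[OF assms]])
  have p: "((\<lambda>l. l powr (- \<alpha>)) has_real_derivative - \<alpha> * l powr (- \<alpha> - 1)) (at l)"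
    using assms by (auto intro!: derivative_eq_intros)
  have "l powr (- \<alpha>) = l * l powr (- \<alpha> - 1)" using assms by (simp add: powr_diff)
  then show ?thesis unfolding \<kappa>_def D\<kappa>_def
    by (intro DERIV_cong[OF DERIV_mult[OF p DERIV_diff[OF q q]]]) (use assms in \<open>simp add: field_simps\<close>)
qed

lemma D\<kappa>_bound: "\<bar>D\<kappa> y\<bar> \<le> 6 * L"
proof -
  have b: "\<bar>w (quot v y) * (slope v y - quot v y)\<bar> \<le> 2 * L" for v
  proof -
    have "\<bar>slope v y - quot v y\<bar> \<le> 2 * L" using slope_bound[of v y] quot_bound[of v y] by linarith
    then have "w (quot v y) * \<bar>slope v y - quot v y\<bar> \<le> 1 * (2 * L)"
      using w_bound[of "quot v y"] by (intro mult_mono) auto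
    then show ?thesis using w_bound(1)[of "quot v y"] by (simp add: abs_mult)
  qed
  have "\<alpha> * \<kappa> y \<le> 1 * (2 * L)" using \<alpha> \<kappa>_nonneg \<kappa>_le by (intro mult_mono) auto
  moreover have "0 \<le> \<alpha> * \<kappa> y" using \<alpha> \<kappa>_nonneg by simp
  ultimately show ?thesis unfolding D\<kappa>_def using b[of x] b[of "x + h"] by linarith
qed

lemma u_continuous: "continuous_on S u"
  using diff by (meson differentiable_imp_continuous_on differentiable_on_def differentiable_at_withinI)

lemma measurable_data [measurable]:
  "u \<in> borel_measurable borel" "grad u \<in> borel_measurable borel" "\<Psi> \<in> borel_measurable borel"
  using u_continuous grad_cont DERIV_isCont[OF \<Psi>]
  by (auto intro: borel_measurable_continuous_onI continuous_at_imp_continuous_on)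

lemma measurable_quotients [measurable]:
  "w \<in> borel_measurable borel" "quot v \<in> borel_measurable borel" "slope v \<in> borel_measurable borel"
  unfolding w_def[abs_def] quot_def[abs_def] slope_def[abs_def] by measurable

lemma measurable_kernels [measurable]:
  "\<kappa> \<in> borel_measurable borel" "K v \<in> borel_measurable borel" "D\<kappa> \<in> borel_measurable borel"
  unfolding \<kappa>_def[abs_def] K_def[abs_def] D\<kappa>_def[abs_def] by measurable

lemma \<psi>_measurable [measurable]: "\<psi> \<in> borel_measurable borel"
  unfolding \<psi>_def[abs_def] by measurable

section \<open>Flux of the divergence term through an annulus\<close>

definition ann :: "real \<Rightarrow> (real^2) set" where "ann e = {y. e < norm y \<and> norm y < 1 / e}"

lemma ann_sets: "ann e \<in> sets lborel" "bounded (ann e)"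
  unfolding ann_def by (auto intro: boundedI[of _ "1 / e"])

lemma ann_powr:
  assumes "0 < e" "y \<in> ann e"
  shows "norm y powr (- 2 - \<alpha>) \<le> e powr (- 2 - \<alpha>)" "y \<noteq> 0"
  using assms \<alpha> by (auto simp: ann_def intro!: powr_mono2')

lemma K_bound:
  assumes "0 < e" "y \<in> ann e"
  shows "\<bar>K v y\<bar> \<le> e powr (- 2 - \<alpha>) * (2 * L)"
proof -
  have "\<bar>(grad u v \<bullet> y) / norm y - slope v y\<bar> \<le> 2 * L"
    using inner_quot_bound[of v y] slope_bound[of v y] by linarith
  then have *: "\<bar>(grad u v \<bullet> y) / norm y - slope v y\<bar> * w (quot v y) \<le> (2 * L) * 1"
    using w_bound[of "quot v y"] L_nonneg by (intro mult_mono) auto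
  have "norm y powr (- 2 - \<alpha>) * (\<bar>(grad u v \<bullet> y) / norm y - slope v y\<bar> * w (quot v y)) \<le> e powr (- 2 - \<alpha>) * ((2 * L) * 1)"
    by (rule mult_mono[OF ann_powr(1)[OF assms] *]) (use w_bound(1)[of "quot v y"] in auto)
  then show ?thesis
    unfolding K_eq[OF ann_powr(2)[OF assms]] using w_bound[of "quot v y"] by (simp add: abs_mult)
qed

definition area :: real where "area = measure lborel (ball (0::real^2) 1)"

lemma shell_measure:
  assumes "0 < e" "1 \<le> l"
  shows "measure lborel (cball (0::real^2) (l * e) - cball 0 e) = area * (l\<^sup>2 - 1) * e\<^sup>2"
proof -
  have c: "measure lborel (cball (0::real^2) r) = r\<^sup>2 * area" if "r \<ge> 0" for r
    using content_ball_conv_unit_ball[OF that, of "0::real^2"]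
    by (simp add: content_cball_conv_ball area_def)
  have "e \<le> l * e" using assms by simp
  then have "measure lborel (cball (0::real^2) (l * e) - cball 0 e) =
      measure lborel (cball (0::real^2) (l * e)) - measure lborel (cball (0::real^2) e)"
    using emeasure_lborel_cball_finite[of "0::real^2" "l * e"]
    by (intro measure_Diff) (auto simp: infinity_ennreal_def)
  then show ?thesis using assms c by (simp add: algebra_simps power_mult_distrib)
qed

text \<open>In place of the divergence theorem, the integral over the annulus A is the limit, as l
  decreases to 1, of the integral of \<open>\<psi>\<close> over l A minus that over A, divided by l
  - 1. Since \<open>\<psi>\<close> is nonnegative, the part gained at the outer circle has the good
  sign; the part lost at the inner circle is a thin shell where \<open>\<psi>\<close> is at most 2 C
  e^(-1 - \<alpha>).\<close>

lemma divergence_integral: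
  assumes e: "0 < e" "e < 1"
  shows "integrable lborel (\<lambda>y. indicator (ann e) y * (norm y powr (- 2 - \<alpha>) * D\<kappa> y))"
    and "- (6 * C * area * e powr (1 - \<alpha>)) \<le> (LINT y|lborel. indicator (ann e) y * (norm y powr (- 2 - \<alpha>) * D\<kappa> y))"
proof -
  let ?g = "\<lambda>y::real^2. norm y powr (- 2 - \<alpha>)"
  have gm [measurable]: "?g \<in> borel_measurable borel" by measurable
  have gD: "\<bar>?g y * D\<kappa> y\<bar> \<le> e powr (- 2 - \<alpha>) * (6 * L)" if "y \<in> ann e" for y
    unfolding abs_mult using ann_powr[OF e(1) that] D\<kappa>_bound[of y] by (intro mult_mono) auto
  show int: "integrable lborel (\<lambda>y. indicator (ann e) y * (?g y * D\<kappa> y))"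
    by (rule integrable_on_bounded_set[OF ann_sets _ gD]) auto
  \<comment> \<open>Dilation factors in (1, 2], so that l^2 - 1 = (l + 1) (l - 1) \<le> 3 (l - 1):
    the area of the lost shell is linear in l - 1.\<close>
  define l where "l n = 1 + 1 / real (Suc n)" for n
  have l1: "l n > 1" for n by (simp add: l_def)
  have l2: "(l n)\<^sup>2 - 1 \<le> 3 * (l n - 1)" for n
  proof -
    have "l n \<le> 2" by (simp add: l_def divide_le_eq)
    then have "(l n + 1) * (l n - 1) \<le> 3 * (l n - 1)" using l1[of n] by (intro mult_right_mono) auto
    then show ?thesis by (simp add: algebra_simps power2_eq_square)
  qed
  have l_lim: "l \<longlonglongrightarrow> 1"
    unfolding l_def using tendsto_add[OF tendsto_const[of 1] LIMSEQ_inverse_real_of_nat] by (simp add: inverse_eq_divide)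
  define \<zeta> where "\<zeta> y l = l powr (- \<alpha>) * \<kappa> (l *\<^sub>R y)" for y l
  have \<zeta>_scale: "l\<^sup>2 * \<psi> (l *\<^sub>R y) = ?g y * \<zeta> y l" if "l > 0" for l y
  proof -
    have "l\<^sup>2 * (l powr (- 2 - \<alpha>)) = l powr (- \<alpha>)"
      using that powr_add[of l 2 "- 2 - \<alpha>"] by simp
    moreover have "l\<^sup>2 * \<psi> (l *\<^sub>R y) = (l\<^sup>2 * l powr (- 2 - \<alpha>)) * (?g y * \<kappa> (l *\<^sub>R y))"
      using that by (simp add: \<psi>_def powr_mult mult_ac)
    ultimately show ?thesis by (simp add: \<zeta>_def mult_ac)
  qed
  let ?F = "\<lambda>n y. indicator (ann e) y * (?g y * ((\<zeta> y (l n) - \<zeta> y 1) / (l n - 1)))"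
  \<comment> \<open>The quotients converge by \<open>\<kappa>_ray\<close> at l = 1; the mean value
    theorem and the bound on \<open>D\<kappa>\<close> provide the dominating function.\<close>
  have lim: "(\<lambda>n. LINT y|lborel. ?F n y) \<longlonglongrightarrow> (LINT y|lborel. indicator (ann e) y * (?g y * D\<kappa> y))"
  proof (rule integral_dominated_convergence[where w = "\<lambda>y. indicator (ann e) y * (e powr (- 2 - \<alpha>) * (6 * L))"])
    show "integrable lborel (\<lambda>y. indicator (ann e) y * (e powr (- 2 - \<alpha>) * (6 * L)))"
      by (rule integrable_on_bounded_set[OF ann_sets]) auto
    show "(\<lambda>y. indicator (ann e) y * (?g y * D\<kappa> y)) \<in> borel_measurable lborel" using int by auto
    show "?F n \<in> borel_measurable lborel" for n
      using ann_sets(1)[of e] unfolding \<zeta>_def by measurable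
    show "AE y in lborel. (\<lambda>n. ?F n y) \<longlonglongrightarrow> indicator (ann e) y * (?g y * D\<kappa> y)"
    proof (rule AE_I2)
      fix y :: "real^2"
      show "(\<lambda>n. ?F n y) \<longlonglongrightarrow> indicator (ann e) y * (?g y * D\<kappa> y)"
      proof (cases "y \<in> ann e")
        case True
        then have "y \<noteq> 0" using ann_powr e by blast
        from \<kappa>_ray[of 1, OF _ this] have "(\<zeta> y has_real_derivative D\<kappa> y) (at 1)"
          by (simp add: \<zeta>_def[abs_def])
        then have "((\<lambda>l. (\<zeta> y l - \<zeta> y 1) / (l - 1)) \<longlongrightarrow> D\<kappa> y) (at 1)"
          by (simp add: has_field_derivative_iff)
        moreover have "filterlim l (at 1) sequentially"
          using l_lim l1 by (auto simp: filterlim_at less_imp_neq[OF l1, symmetric] intro!: always_eventually)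
        ultimately have "(\<lambda>n. (\<zeta> y (l n) - \<zeta> y 1) / (l n - 1)) \<longlonglongrightarrow> D\<kappa> y" by (rule filterlim_compose)
        then show ?thesis by (intro tendsto_intros)
      qed simp
    qed
    show "AE y in lborel. norm (?F n y) \<le> indicator (ann e) y * (e powr (- 2 - \<alpha>) * (6 * L))" for n
    proof (rule AE_I2)
      fix y :: "real^2"
      show "norm (?F n y) \<le> indicator (ann e) y * (e powr (- 2 - \<alpha>) * (6 * L))"
      proof (cases "y \<in> ann e")
        case True
        note y = ann_powr[OF e(1) True]
        obtain m where m: "1 < m" "m < l n" "\<zeta> y (l n) - \<zeta> y 1 = (l n - 1) * (m powr (- \<alpha> - 1) * D\<kappa> (m *\<^sub>R y))"
          using MVT2[OF l1[of n], of "\<zeta> y" "\<lambda>l. l powr (- \<alpha> - 1) * D\<kappa> (l *\<^sub>R y)"] \<kappa>_ray[OF _ y(2)]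
          unfolding \<zeta>_def[abs_def] by force
        have "m powr (- \<alpha> - 1) \<le> m powr 0" using m \<alpha> by (intro powr_mono) auto
        then have "m powr (- \<alpha> - 1) * \<bar>D\<kappa> (m *\<^sub>R y)\<bar> \<le> 1 * (6 * L)"
          using m D\<kappa>_bound[of "m *\<^sub>R y"] by (intro mult_mono) auto
        then have "\<bar>(\<zeta> y (l n) - \<zeta> y 1) / (l n - 1)\<bar> \<le> 6 * L"
          using m by (simp add: abs_mult)
        then have "?g y * \<bar>(\<zeta> y (l n) - \<zeta> y 1) / (l n - 1)\<bar> \<le> e powr (- 2 - \<alpha>) * (6 * L)"
          using y by (intro mult_mono) auto
        then show ?thesis using True by (simp add: abs_mult)
      qed simp
    qed
  qed
  have low: "- (6 * C * area * e powr (1 - \<alpha>)) \<le> (LINT y|lborel. ?F n y)" for n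
  proof -
    define k where "k = l n"
    have k: "k > 1" "k\<^sup>2 - 1 \<le> 3 * (k - 1)" using l1 l2 by (auto simp: k_def)
    let ?S = "cball (0::real^2) (k * e) - cball 0 e"
    \<comment> \<open>The indicator of the annulus dilated by k.\<close>
    let ?I = "\<lambda>z. indicator (ann e) ((1 / k) *\<^sub>R z) :: real"
    have \<psi>b: "\<psi> y \<le> 2 * C * e powr (- 1 - \<alpha>)" if "e < norm y" for y
    proof -
      have "\<psi> y \<le> norm y powr (- 2 - \<alpha>) * (2 * C * norm y)"
        unfolding \<psi>_def by (intro mult_left_mono \<kappa>_le) auto
      also have "\<dots> = 2 * C * norm y powr (- 1 - \<alpha>)"
        using that e powr_add[of "norm y" 1 "- 2 - \<alpha>"] by (simp add: mult_ac)
      also have "\<dots> \<le> 2 * C * e powr (- 1 - \<alpha>)"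
        using that e \<alpha> C_nonneg by (intro mult_left_mono powr_mono2') auto
      finally show ?thesis .
    qed
    have i1: "integrable lborel (\<lambda>y. indicator (ann e) y * \<psi> y)"
      by (rule integrable_on_bounded_set[OF ann_sets, of _ _ "2 * C * e powr (- 1 - \<alpha>)"])
        (use \<psi>b \<psi>_nonneg in \<open>auto simp: ann_def\<close>)
    have i2: "integrable lborel (\<lambda>y. indicator ?S y * \<psi> y)"
      by (rule integrable_on_bounded_set[of _ _ "2 * C * e powr (- 1 - \<alpha>)"])
        (use \<psi>b \<psi>_nonneg in \<open>auto intro: bounded_subset[OF bounded_cball]\<close>)
    have set: "{z. (1 / k) *\<^sub>R z \<in> ann e} = {z. k * e < norm z \<and> norm z < k / e}"
      using k e by (auto simp: ann_def field_simps)
    have i3: "integrable lborel (\<lambda>y. ?I y * \<psi> y)"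
    proof -
      have "integrable lborel (\<lambda>y. indicator {z. (1 / k) *\<^sub>R z \<in> ann e} y * \<psi> y)"
      proof (rule integrable_on_bounded_set[where B = "2 * C * e powr (- 1 - \<alpha>)"])
        show "{z. (1 / k) *\<^sub>R z \<in> ann e} \<in> sets lborel" unfolding set by simp
        show "bounded {z. (1 / k) *\<^sub>R z \<in> ann e}" unfolding set by (auto intro: boundedI[of _ "k / e"])
        show "\<bar>\<psi> y\<bar> \<le> 2 * C * e powr (- 1 - \<alpha>)" if "y \<in> {z. (1 / k) *\<^sub>R z \<in> ann e}" for y
        proof -
          have "e \<le> k * e" using k e by simp
          then show ?thesis using that \<psi>b[of y] \<psi>_nonneg[of y] unfolding set by simp
        qed
      qed simp
      then show ?thesis by (simp add: indicator_def)
    qed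
    have scale: "(LINT y|lborel. ?I y * \<psi> y) = k\<^sup>2 * (LINT y|lborel. indicator (ann e) y * \<psi> (k *\<^sub>R y))"
    proof -
      have "(\<lambda>z. ?I z * \<psi> z) \<in> borel_measurable borel" using i3 by auto
      from lborel_integral_affine[of k, OF _ this, of 0] k show ?thesis by simp
    qed
    have pt: "?F n y = (k\<^sup>2 * (indicator (ann e) y * \<psi> (k *\<^sub>R y)) - indicator (ann e) y * \<psi> y) / (k - 1)" for y
    proof -
      have "k\<^sup>2 * (indicator (ann e) y * \<psi> (k *\<^sub>R y)) = indicator (ann e) y * (?g y * \<zeta> y k)"
        using \<zeta>_scale[of k y] k by (metis mult.left_commute order_less_trans zero_less_one)
      moreover have "\<psi> y = ?g y * \<zeta> y 1" using \<zeta>_scale[of 1 y] by simp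
      ultimately show ?thesis by (auto simp: k_def algebra_simps diff_divide_distrib)
    qed
    have i4: "integrable lborel (\<lambda>y. k\<^sup>2 * (indicator (ann e) y * \<psi> (k *\<^sub>R y)))"
    proof -
      have b: "\<bar>\<psi> (k *\<^sub>R y)\<bar> \<le> 2 * C * e powr (- 1 - \<alpha>)" if "y \<in> ann e" for y
      proof -
        have "1 * norm y \<le> k * norm y" using k by (intro mult_right_mono) auto
        then have "e < norm (k *\<^sub>R y)" using that k by (simp add: ann_def)
        then show ?thesis using \<psi>b \<psi>_nonneg by simp
      qed
      show ?thesis
        by (intro integrable_mult_right integrable_on_bounded_set[OF ann_sets _ b]) auto
    qed
    have "(LINT y|lborel. ?F n y) = ((LINT y|lborel. ?I y * \<psi> y) - (LINT y|lborel. indicator (ann e) y * \<psi> y)) / (k - 1)"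
      unfolding pt using i1 i4 by (simp add: scale)
    moreover have "(LINT y|lborel. indicator (ann e) y * \<psi> y) - (LINT y|lborel. ?I y * \<psi> y) \<le> 6 * C * area * e powr (1 - \<alpha>) * (k - 1)"
    proof -
      have "(LINT y|lborel. indicator (ann e) y * \<psi> y) - (LINT y|lborel. ?I y * \<psi> y) = (LINT y|lborel. indicator (ann e) y * \<psi> y - ?I y * \<psi> y)"
        using i1 i3 by simp
      also have "\<dots> \<le> (LINT y|lborel. indicator ?S y * (2 * C * e powr (- 1 - \<alpha>)))"
      proof (rule integral_mono)
        show "integrable lborel (\<lambda>y. indicator (ann e) y * \<psi> y - ?I y * \<psi> y)" using i1 i3 by simp
        show "integrable lborel (\<lambda>y. indicator ?S y * (2 * C * e powr (- 1 - \<alpha>)))"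
          by (rule integrable_on_bounded_set) (auto intro: bounded_subset[OF bounded_cball])
        \<comment> \<open>The left side can be positive only at points of A outside k A. These lie
          in the inner shell, because dilation enlarges the outer radius.\<close>
        show "indicator (ann e) y * \<psi> y - ?I y * \<psi> y \<le> indicator ?S y * (2 * C * e powr (- 1 - \<alpha>))" for y
        proof (cases "y \<in> ann e \<and> y \<notin> {z. (1 / k) *\<^sub>R z \<in> ann e}")
          case True
          have "1 / e \<le> k / e" using k e by (intro divide_right_mono) auto
          then have "y \<in> ?S" using True unfolding set by (auto simp: ann_def)
          then show ?thesis using True \<psi>b[of y] by (simp add: ann_def)
        next
          case False
          then have "indicator (ann e) y \<le> ?I y" by (auto simp: indicator_def)
          then have "indicator (ann e) y * \<psi> y \<le> ?I y * \<psi> y" using \<psi>_nonneg by (rule mult_right_mono)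
          moreover have "0 \<le> indicator ?S y * (2 * C * e powr (- 1 - \<alpha>))"
            by (intro mult_nonneg_nonneg C_nonneg) auto
          ultimately show ?thesis by linarith
        qed
      qed
      also have "\<dots> = area * (k\<^sup>2 - 1) * e\<^sup>2 * (2 * C * e powr (- 1 - \<alpha>))"
        using shell_measure[OF e(1), of k] k by simp
      also have "\<dots> = (k\<^sup>2 - 1) * (2 * C * area * e powr (1 - \<alpha>))"
        using powr_add[of e 2 "- 1 - \<alpha>"] e by (simp add: mult_ac)
      also have "\<dots> \<le> (3 * (k - 1)) * (2 * C * area * e powr (1 - \<alpha>))"
        using k(2) C_nonneg by (intro mult_right_mono) (auto simp: area_def)
      also have "\<dots> = 6 * C * area * e powr (1 - \<alpha>) * (k - 1)" by (simp add: algebra_simps)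
      finally show ?thesis .
    qed
    ultimately show ?thesis using k(1) by (simp add: le_divide_eq minus_divide_left[symmetric] divide_le_eq)
  qed
  show "- (6 * C * area * e powr (1 - \<alpha>)) \<le> (LINT y|lborel. indicator (ann e) y * (?g y * D\<kappa> y))"
    by (rule LIMSEQ_le_const[OF lim]) (use low in auto)
qed

text \<open>Both principal values use the same annuli. On each of them the difference of the
  integrals is at most a multiple of e^(1 - \<alpha>), which tends to 0 because \<alpha> <
  1.\<close>

lemma pv_comparison:
  assumes "has_pv_integral (K (x + h)) D1" "has_pv_integral (K x) D0"
  shows "D1 \<le> D0"
proof -
  have le: "integral (ann e) (K (x + h)) - integral (ann e) (K x) \<le> 6 * C * area * e powr (1 - \<alpha>)"
    if e: "0 < e" "e < 1" for e
  proof -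
    have i: "integrable lborel (\<lambda>y. indicator (ann e) y * K v y)"
      "integral (ann e) (K v) = (LINT y|lborel. indicator (ann e) y * K v y)" for v
      by (rule integrable_on_bounded_set integral_eq_lebesgue_on_bounded_set; (rule ann_sets K_bound[OF e(1)])?; simp)+
    have "integral (ann e) (K (x + h)) - integral (ann e) (K x) =
      (LINT y|lborel. indicator (ann e) y * K (x + h) y - indicator (ann e) y * K x y)"
      using i by simp
    also have "\<dots> \<le> (LINT y|lborel. - (indicator (ann e) y * (norm y powr (- 2 - \<alpha>) * D\<kappa> y)))"
    proof (rule integral_mono)
      show "indicator (ann e) y * K (x + h) y - indicator (ann e) y * K x y \<le> - (indicator (ann e) y * (norm y powr (- 2 - \<alpha>) * D\<kappa> y))" for y
        using kernel_difference[of y] ann_powr(2)[OF e(1)] by (auto simp: indicator_def)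
    qed (use i divergence_integral(1)[OF e] in auto)
    also have "\<dots> \<le> 6 * C * area * e powr (1 - \<alpha>)" using divergence_integral(2)[OF e] by simp
    finally show ?thesis .
  qed
  have lim: "((\<lambda>e. integral (ann e) (K (x + h)) - integral (ann e) (K x)) \<longlongrightarrow> D1 - D0) (at_right 0)"
    using assms unfolding has_pv_integral_def ann_def by (rule tendsto_diff)
  have lim': "((\<lambda>e. 6 * C * area * e powr (1 - \<alpha>)) \<longlongrightarrow> 6 * C * area * 0) (at_right 0)"
  proof (intro tendsto_mult tendsto_const)
    have "((\<lambda>e. e powr (1 - \<alpha>)) \<longlongrightarrow> 0 powr (1 - \<alpha>)) (at_right 0)"
      by (rule tendsto_powr') (use \<alpha> in \<open>auto simp: eventually_at_filter\<close>)
    then show "((\<lambda>e. e powr (1 - \<alpha>)) \<longlongrightarrow> 0) (at_right 0)" by simp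
  qed
  have "eventually (\<lambda>e. integral (ann e) (K (x + h)) - integral (ann e) (K x) \<le> 6 * C * area * e powr (1 - \<alpha>)) (at_right 0)"
    using eventually_at_right_less[of "0::real"] eventually_at_right[of 0 "1::real"]
    by (auto simp: eventually_at_right_field intro!: exI[of _ 1] le)
  from tendsto_le[OF trivial_limit_at_right_real lim' lim this]
  show ?thesis by simp
qed

end

section \<open>Regularity of the solution in time\<close>

lemma L2_lincomb:
  assumes "L2 f" "L2 g"
  shows "L2 (\<lambda>x. a * f x + b * g x)"
proof -
  have m: "f \<in> borel_measurable lborel" "g \<in> borel_measurable lborel" using assms by (auto simp: L2_def)
  have "integrable lborel (\<lambda>x. (a * f x + b * g x)\<^sup>2)"
  proof (rule Bochner_Integration.integrable_bound)
    show "integrable lborel (\<lambda>x. 2 * a\<^sup>2 * (f x)\<^sup>2 + 2 * b\<^sup>2 * (g x)\<^sup>2)"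
      using assms by (auto simp: L2_def)
    show "(\<lambda>x. (a * f x + b * g x)\<^sup>2) \<in> borel_measurable lborel" using m by measurable
    have "(p + q)\<^sup>2 \<le> 2 * p\<^sup>2 + 2 * q\<^sup>2" for p q :: real
      using sum_squares_bound[of p q] by (simp add: power2_sum)
    then have "(a * f x + b * g x)\<^sup>2 \<le> 2 * (a * f x)\<^sup>2 + 2 * (b * g x)\<^sup>2" for x .
    then show "AE x in lborel. norm ((a * f x + b * g x)\<^sup>2) \<le> norm (2 * a\<^sup>2 * (f x)\<^sup>2 + 2 * b\<^sup>2 * (g x)\<^sup>2)"
      by (intro AE_I2) (simp add: power_mult_distrib mult.assoc)
  qed
  then show ?thesis using m by (simp add: L2_def)
qed

lemma loc_int_lincomb:
  assumes "loc_int f" "loc_int g"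
  shows "loc_int (\<lambda>x. a * f x + b * g x)"
  unfolding loc_int_def
proof (intro conjI allI impI)
  show "(\<lambda>x. a * f x + b * g x) \<in> borel_measurable lborel" using assms by (auto simp: loc_int_def)
  fix K :: "(real^2) set" assume "compact K"
  then have "integrable lborel (\<lambda>x. indicator K x * f x)" "integrable lborel (\<lambda>x. indicator K x * g x)"
    using assms by (auto simp: loc_int_def)
  then have "integrable lborel (\<lambda>x. a * (indicator K x * f x) + b * (indicator K x * g x))" by auto
  then show "integrable lborel (\<lambda>x. indicator K x * (a * f x + b * g x))" by (simp add: algebra_simps)
qed

lemma loc_int_mult_integrable:
  assumes "loc_int f" "continuous_on UNIV \<phi>" "compact K" "\<And>x. x \<notin> K \<Longrightarrow> \<phi> x = 0"
  shows "integrable lborel (\<lambda>x. f x * \<phi> x)"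
proof -
  have "bounded (\<phi> ` K)"
    by (intro compact_imp_bounded compact_continuous_image continuous_on_subset[OF assms(2)] assms(3)) auto
  then obtain M where M: "\<And>x. x \<in> K \<Longrightarrow> \<bar>\<phi> x\<bar> \<le> M" unfolding bounded_iff by fastforce
  have "integrable lborel (\<lambda>x. \<bar>M\<bar> * \<bar>indicator K x * f x\<bar>)"
    using assms(1,3) by (auto simp: loc_int_def)
  then show ?thesis
  proof (rule Bochner_Integration.integrable_bound)
    show "(\<lambda>x. f x * \<phi> x) \<in> borel_measurable lborel"
      using assms(1,2) by (intro borel_measurable_times) (auto simp: loc_int_def intro: borel_measurable_continuous_onI)
    show "AE x in lborel. norm (f x * \<phi> x) \<le> norm (\<bar>M\<bar> * \<bar>indicator K x * f x\<bar>)"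
    proof (rule AE_I2)
      fix x
      show "norm (f x * \<phi> x) \<le> norm (\<bar>M\<bar> * \<bar>indicator K x * f x\<bar>)"
      proof (cases "x \<in> K")
        case True
        have "\<bar>\<phi> x\<bar> * \<bar>f x\<bar> \<le> \<bar>M\<bar> * \<bar>f x\<bar>"
          by (rule mult_right_mono[OF order_trans[OF M[OF True] abs_ge_self]]) simp
        then show ?thesis using True by (simp add: abs_mult mult.commute[of "\<bar>f x\<bar>"])
      qed (simp add: assms(4))
    qed
  qed
qed

lemma pds_zero:
  assumes "open S" "\<And>x. x \<in> S \<Longrightarrow> g x = 0" "x \<in> S"
  shows "pds ws g x = 0"
  using assms(3)
proof (induction ws arbitrary: x)
  case (Cons w ws)
  have "((\<lambda>s. x + s *\<^sub>R axis w 1) \<longlongrightarrow> x + 0 *\<^sub>R axis w 1) (nhds 0)"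
    by (intro tendsto_intros filterlim_ident)
  then have "eventually (\<lambda>s. x + s *\<^sub>R axis w 1 \<in> S) (nhds (0::real))"
    by (rule topological_tendstoD) (use assms(1) Cons.prems in auto)
  then have "eventually (\<lambda>s. pds ws g (x + s *\<^sub>R axis w 1) = 0) (nhds (0::real))"
    by eventually_elim (rule Cons.IH)
  then have "deriv (\<lambda>s. pds ws g (x + s *\<^sub>R axis w 1)) 0 = deriv (\<lambda>_. 0) (0::real)"
    by (rule deriv_cong_ev) simp
  then show ?case by (simp add: pds_def pd_def)
qed (use assms in \<open>simp add: pds_def\<close>)

lemma test_fun_pds:
  assumes "test_fun \<phi>"
  shows "continuous_on UNIV (pds ws \<phi>)" "compact (closure {x. \<phi> x \<noteq> 0})"
    "x \<notin> closure {x. \<phi> x \<noteq> 0} \<Longrightarrow> pds ws \<phi> x = 0"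
proof -
  show "continuous_on UNIV (pds ws \<phi>)" "compact (closure {x. \<phi> x \<noteq> 0})"
    using assms by (auto simp: test_fun_def smooth2_def)
  assume "x \<notin> closure {x. \<phi> x \<noteq> 0}"
  then show "pds ws \<phi> x = 0"
    by (intro pds_zero[of "- closure {x. \<phi> x \<noteq> 0}"]) (use closure_subset[of "{x. \<phi> x \<noteq> 0}"] in auto)
qed

lemma weak_deriv_lincomb:
  assumes "weak_deriv i j f f'" "weak_deriv i j g g'"
  shows "weak_deriv i j (\<lambda>x. a * f x + b * g x) (\<lambda>x. a * f' x + b * g' x)"
  unfolding weak_deriv_def
proof (intro conjI allI impI)
  have li: "loc_int f" "loc_int f'" "loc_int g" "loc_int g'" using assms by (auto simp: weak_deriv_def)
  then show "loc_int (\<lambda>x. a * f x + b * g x)" "loc_int (\<lambda>x. a * f' x + b * g' x)"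
    by (auto intro: loc_int_lincomb)
  fix \<phi> assume t: "test_fun \<phi>"
  have int: "integrable lborel (\<lambda>x. p x * pds ws \<phi> x)" if "loc_int p" for p ws
    by (rule loc_int_mult_integrable[OF that test_fun_pds(1)[OF t] test_fun_pds(2)[OF t]]) (rule test_fun_pds(3)[OF t])
  have D: "integrable lborel (\<lambda>x. p x * Dab i j \<phi> x)" if "loc_int p" for p
    unfolding Dab_def by (rule int[OF that])
  have P: "integrable lborel (\<lambda>x. p x * \<phi> x)" if "loc_int p" for p
    using int[OF that, of "[]"] by (simp add: pds_def)
  have split: "(LINT x|lborel. (a * p x + b * q x) * \<theta> x) = a * (LINT x|lborel. p x * \<theta> x) + b * (LINT x|lborel. q x * \<theta> x)"
    if "integrable lborel (\<lambda>x. p x * \<theta> x)" "integrable lborel (\<lambda>x. q x * \<theta> x)" for p q \<theta> :: "real^2 \<Rightarrow> real"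
  proof -
    have "(LINT x|lborel. (a * p x + b * q x) * \<theta> x) = (LINT x|lborel. a * (p x * \<theta> x) + b * (q x * \<theta> x))"
      by (simp add: algebra_simps)
    also have "\<dots> = a * (LINT x|lborel. p x * \<theta> x) + b * (LINT x|lborel. q x * \<theta> x)" using that by simp
    finally show ?thesis .
  qed
  show "(LINT x|lborel. (a * f x + b * g x) * Dab i j \<phi> x) = (-1) ^ (i + j) * (LINT x|lborel. (a * f' x + b * g' x) * \<phi> x)"
    unfolding split[OF D[OF li(1)] D[OF li(3)]] split[OF P[OF li(2)] P[OF li(4)]]
      weak_derivD(1)[OF assms(1) t] weak_derivD(1)[OF assms(2) t] by (simp add: algebra_simps)
qed

lemma Hk_lincomb:
  assumes "Hk k f" "Hk k g"
  shows "Hk k (\<lambda>x. a * f x + b * g x)"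
  unfolding Hk_def
proof (intro conjI allI impI)
  show "L2 (\<lambda>x. a * f x + b * g x)" using assms L2_lincomb by (auto simp: Hk_def)
  fix i j assume "i + j \<le> k"
  then show "\<exists>h. weak_deriv i j (\<lambda>x. a * f x + b * g x) h \<and> L2 h"
    using weak_deriv_lincomb[OF wd_spec(1)[OF assms(1)] wd_spec(1)[OF assms(2)]]
      L2_lincomb[OF wd_spec(2)[OF assms(1)] wd_spec(2)[OF assms(2)]] by blast
qed

lemma Hk_loc_int: "Hk k u \<Longrightarrow> loc_int u"
  using wd_spec(1)[of k u 0 0] by (simp add: weak_deriv_def)

lemma Hk_difference_quotient:
  assumes "Hk k f" "Hk k g" "Hk k v"
  shows "Hk k (\<lambda>x. (f x - g x) / c - v x)"
proof -
  have "Hk k (\<lambda>x. 1 * ((1 / c) * f x + (- (1 / c)) * g x) + (-1) * v x)"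
    using assms by (intro Hk_lincomb)
  then show ?thesis by (simp add: diff_divide_distrib)
qed

text \<open>Both claims come from \<open>kern2_bound\<close>: the choice \<eta> = 1 with the global
  energy bounds second differences, and a small \<eta> with the vanishing local energy gives
  decay.\<close>

lemma Hk_continuous_bounds:
  assumes "k \<ge> 4" "Hk k u" "continuous_on UNIV u"
  shows "\<exists>C. \<forall>x h. \<bar>u (x + h) - 2 * u x + u (x - h)\<bar> \<le> C * (norm h)\<^sup>2"
    and "c > 0 \<Longrightarrow> \<exists>R. \<forall>x. norm x > R \<longrightarrow> \<bar>u x\<bar> < c"
proof -
  obtain P where "smooth_step P" using smooth_step_exists unfolding smooth_step_def by metis
  then interpret smooth_step P .
  obtain C where C: "C > 0" and bound: "\<And>u x n a b \<eta>. Hk k u \<Longrightarrow> a + b \<le> 2 \<Longrightarrow> n \<ge> 1 \<Longrightarrow> \<eta> > 0 \<Longrightarrow>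
     \<bar>LINT z|lborel. u z * kern2 n a b (z - x)\<bar> \<le> C * (\<eta> + local_energy k u x / \<eta>)"
    using kern2_bound assms(1) by blast
  have K: "\<bar>LINT z|lborel. u z * kern2 n a b (z - x)\<bar> \<le> C * (1 + (Hk_norm k u)\<^sup>2)" if "n \<ge> 1" "a + b \<le> 2" for n a b x
  proof -
    have "C * (1 + local_energy k u x / 1) \<le> C * (1 + (Hk_norm k u)\<^sup>2)"
      using C local_energy_le[OF assms(2), of x] by (intro mult_left_mono) auto
    then show ?thesis using bound[OF assms(2) that(2,1), of 1 x] by linarith
  qed
  have "\<bar>u (x + h) - 2 * u x + u (x - h)\<bar> \<le> (4 * (C * (1 + (Hk_norm k u)\<^sup>2)) / mass) * (norm h)\<^sup>2" for x h
    using second_difference_bound[OF assms(3) K, of x h] mass_pos by (simp add: pos_le_divide_eq)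
  then show "\<exists>C. \<forall>x h. \<bar>u (x + h) - 2 * u x + u (x - h)\<bar> \<le> C * (norm h)\<^sup>2" by blast
  assume c: "c > 0"
  \<comment> \<open>The 3 leaves room for a strict inequality: C (2 \<eta>) is two thirds of c times
    the mass.\<close>
  define \<eta> where "\<eta> = c * mass / (3 * C)"
  have \<eta>: "\<eta> > 0" using c C mass_pos by (simp add: \<eta>_def)
  obtain R where R: "\<And>x. norm x > R \<Longrightarrow> local_energy k u x < \<eta> * \<eta>"
    using local_energy_vanishes[OF assms(2), of "\<eta> * \<eta>"] \<eta> by auto
  show "\<exists>R. \<forall>x. norm x > R \<longrightarrow> \<bar>u x\<bar> < c"
  proof (intro exI[of _ R] allI impI)
    fix x :: "real^2" assume "norm x > R"
    then have "local_energy k u x / \<eta> < \<eta>" using R[of x] \<eta> by (simp add: divide_less_eq)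
    then have "C * (\<eta> + local_energy k u x / \<eta>) \<le> C * (2 * \<eta>)" using C by (intro mult_left_mono) auto
    then have "\<bar>u x\<bar> * mass \<le> C * (2 * \<eta>)"
      using bound[OF assms(2) _ _ \<eta>, of 0 0 _ x]
      by (intro sup_bound_of_kern2_bound[OF assms(3)]) (force intro: order_trans)
    also have "\<dots> < c * mass" using c C mass_pos by (simp add: \<eta>_def)
    finally show "\<bar>u x\<bar> < c" using mass_pos by simp
  qed
qed

text \<open>The increment u s - u t is s - t times the sum of v t and the remainder of the
  difference quotient. The sum is split inside the pairings with the mollifier, which are linear;
  this avoids a triangle inequality for \<open>Hk_norm\<close>, whose weak derivatives are arbitrary
  choices.\<close>

lemma C1_Hk_lipschitz_in_time:
  assumes k: "k \<ge> 4" and C1: "C1_Hk T k u" and t: "t \<in> {0..T}"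
    and cont: "\<And>s. s \<in> {0..T} \<Longrightarrow> continuous_on UNIV (u s)"
  obtains M \<delta> where "\<delta> > 0" "M \<ge> 0"
    "\<And>s x. s \<in> {0..T} \<Longrightarrow> \<bar>s - t\<bar> < \<delta> \<Longrightarrow> \<bar>u s x - u t x\<bar> \<le> M * \<bar>s - t\<bar>"
    "\<And>s x h. s \<in> {0..T} \<Longrightarrow> \<bar>s - t\<bar> < \<delta> \<Longrightarrow>
       \<bar>(u s (x + h) - u t (x + h)) - 2 * (u s x - u t x) + (u s (x - h) - u t (x - h))\<bar> \<le> M * \<bar>s - t\<bar> * (norm h)\<^sup>2"
proof -
  obtain P where "smooth_step P" using smooth_step_exists unfolding smooth_step_def by metis
  then interpret smooth_step P .
  obtain C where C: "C > 0" and bound: "\<And>u x n a b \<eta>. Hk k u \<Longrightarrow> a + b \<le> 2 \<Longrightarrow> n \<ge> 1 \<Longrightarrow> \<eta> > 0 \<Longrightarrow>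
     \<bar>LINT z|lborel. u z * kern2 n a b (z - x)\<bar> \<le> C * (\<eta> + local_energy k u x / \<eta>)"
    using kern2_bound k by blast
  obtain v where u: "\<And>s. s \<in> {0..T} \<Longrightarrow> Hk k (u s)" and v: "\<And>s. s \<in> {0..T} \<Longrightarrow> Hk k (v s)"
    and lim: "((\<lambda>s. Hk_norm k (\<lambda>x. (u s x - u t x) / (s - t) - v t x)) \<longlongrightarrow> 0) (at t within {0..T})"
    using C1 t unfolding C1_Hk_def by blast
  from tendstoD[OF lim, of 1] obtain \<delta> where \<delta>: "\<delta> > 0"
    "\<And>s. s \<in> {0..T} \<Longrightarrow> s \<noteq> t \<Longrightarrow> \<bar>s - t\<bar> < \<delta> \<Longrightarrow> \<bar>Hk_norm k (\<lambda>x. (u s x - u t x) / (s - t) - v t x)\<bar> < 1"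
    unfolding eventually_at by (auto simp: dist_real_def)
  \<comment> \<open>The first summand bounds the pairings of the remainder, whose
    \<open>Hk_norm\<close> is below 1 near t; the second bounds those of v t.\<close>
  define K where "K = C * (1 + 1) + C * (1 + (Hk_norm k (v t))\<^sup>2)"
  have K0: "K \<ge> 0" using C by (simp add: K_def)
  define M where "M = 4 * K / mass"
  have M: "M \<ge> 0" "K \<le> M * mass" using K0 mass_pos by (auto simp: M_def)
  have energy: "\<bar>LINT z|lborel. p z * kern2 n a b (z - x)\<bar> \<le> C * (1 + B\<^sup>2)"
    if "Hk k p" "\<bar>Hk_norm k p\<bar> \<le> B" "n \<ge> 1" "a + b \<le> 2" for p n a b x B
  proof -
    have "(Hk_norm k p)\<^sup>2 \<le> B\<^sup>2" using that(2) by (simp add: abs_le_square_iff[symmetric])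
    then have "C * (1 + local_energy k p x / 1) \<le> C * (1 + B\<^sup>2)"
      using C local_energy_le[OF that(1), of x] by (intro mult_left_mono) auto
    then show ?thesis using bound[OF that(1,4,3), of 1 x] by linarith
  qed
  have main: "\<bar>LINT z|lborel. (u s z - u t z) * kern2 n a b (z - x)\<bar> \<le> \<bar>s - t\<bar> * K"
    if s: "s \<in> {0..T}" "\<bar>s - t\<bar> < \<delta>" "s \<noteq> t" and n: "n \<ge> 1" "a + b \<le> 2" for s n a b x
  proof -
    define w where "w = (\<lambda>x. (u s x - u t x) / (s - t) - v t x)"
    have w: "Hk k w" unfolding w_def by (rule Hk_difference_quotient[OF u[OF s(1)] u[OF t] v[OF t]])
    have int: "integrable lborel (\<lambda>z. p z * kern2 n a b (z - x))" if "Hk k p" for p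
    proof (rule loc_int_mult_integrable[OF Hk_loc_int[OF that], of _ "cbox x (x + 1)"])
      show "continuous_on UNIV (\<lambda>z. kern2 n a b (z - x))"
        by (intro continuous_on_compose2[OF kern2_continuous_on[of UNIV]] continuous_intros) auto
      show "kern2 n a b (z - x) = 0" if "z \<notin> cbox x (x + 1)" for z
        using that n(1) by (intro kern2_zero) (auto simp: mem_box_cart algebra_simps)
    qed simp
    have "(u s z - u t z) * kern2 n a b (z - x) = (s - t) * (w z * kern2 n a b (z - x) + v t z * kern2 n a b (z - x))" for z
      using s(3) by (simp add: w_def algebra_simps flip: distrib_right) (simp add: field_simps)
    then have "(LINT z|lborel. (u s z - u t z) * kern2 n a b (z - x)) =
      (s - t) * ((LINT z|lborel. w z * kern2 n a b (z - x)) + (LINT z|lborel. v t z * kern2 n a b (z - x)))"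
      using int[OF w] int[OF v[OF t]] by simp
    also have "\<bar>\<dots>\<bar> = \<bar>s - t\<bar> * \<bar>(LINT z|lborel. w z * kern2 n a b (z - x)) + (LINT z|lborel. v t z * kern2 n a b (z - x))\<bar>"
      by (simp add: abs_mult)
    also have "\<dots> \<le> \<bar>s - t\<bar> * K"
    proof (rule mult_left_mono)
      have "\<bar>LINT z|lborel. w z * kern2 n a b (z - x)\<bar> \<le> C * (1 + 1\<^sup>2)"
        using \<delta>(2)[OF s(1,3,2)] by (intro energy[OF w _ n]) (simp add: w_def)
      moreover have "\<bar>LINT z|lborel. v t z * kern2 n a b (z - x)\<bar> \<le> C * (1 + \<bar>Hk_norm k (v t)\<bar>\<^sup>2)"
        by (intro energy[OF v[OF t] _ n]) simp
      ultimately show "\<bar>(LINT z|lborel. w z * kern2 n a b (z - x)) + (LINT z|lborel. v t z * kern2 n a b (z - x))\<bar> \<le> K"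
        unfolding K_def by simp
    qed simp
    finally show ?thesis .
  qed
  show ?thesis
  proof (rule that[OF \<delta>(1) M(1)])
    fix s assume s: "s \<in> {0..T}" "\<bar>s - t\<bar> < \<delta>"
    let ?d = "\<lambda>x. u s x - u t x"
    have c: "continuous_on UNIV ?d" using cont s(1) t by (intro continuous_intros) auto
    have m: "\<bar>LINT z|lborel. ?d z * kern2 n a b (z - x)\<bar> \<le> \<bar>s - t\<bar> * K" if "n \<ge> 1" "a + b \<le> 2" for n a b x
      using main[OF s _ that, of x] by (cases "s = t") auto
    show "\<bar>?d x\<bar> \<le> M * \<bar>s - t\<bar>" for x
    proof -
      have "\<bar>?d x\<bar> * mass \<le> \<bar>s - t\<bar> * K" using m by (intro sup_bound_of_kern2_bound[OF c]) auto
      also have "\<dots> \<le> \<bar>s - t\<bar> * (M * mass)" using M by (intro mult_left_mono) auto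
      also have "\<dots> = (M * \<bar>s - t\<bar>) * mass" by simp
      finally show ?thesis using mass_pos by simp
    qed
    show "\<bar>?d (x + h) - 2 * ?d x + ?d (x - h)\<bar> \<le> M * \<bar>s - t\<bar> * (norm h)\<^sup>2" for x h
      using second_difference_bound[OF c m, of x h] mass_pos by (simp add: M_def field_simps)
  qed
qed

section \<open>Propagation of the Lipschitz constant\<close>

locale muskat =
  fixes \<alpha> T :: real and k :: nat and f0 :: "real^2 \<Rightarrow> real" and f :: "real^2 \<Rightarrow> real \<Rightarrow> real"
  assumes \<alpha>: "0 \<le> \<alpha>" "\<alpha> < 1" and k: "k \<ge> 4" and sol: "is_solution \<alpha> k T f0 f"
begin

definition u :: "real \<Rightarrow> real^2 \<Rightarrow> real" where "u t = (\<lambda>x. f x t)"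

definition lip :: "real \<Rightarrow> real \<Rightarrow> bool" where
  "lip M t \<longleftrightarrow> (\<forall>x y. \<bar>u t x - u t y\<bar> \<le> M * norm (x - y))"

lemma C1: "C1_Hk T k u"
  using sol by (simp add: is_solution_def u_def[abs_def])

lemma u_diff: "t \<in> {0..T} \<Longrightarrow> u t differentiable (at x)"
  using sol by (simp add: is_solution_def u_def)

lemma u_cont: "t \<in> {0..T} \<Longrightarrow> continuous_on UNIV (u t)"
  using u_diff by (meson differentiable_imp_continuous_on differentiable_on_def differentiable_at_withinI)

lemma u_Hk: "t \<in> {0..T} \<Longrightarrow> Hk k (u t)"
  using C1 by (simp add: C1_Hk_def)

lemma u_taylor:
  assumes "t \<in> {0..T}"
  obtains C where "\<And>x h. \<bar>u t (x + h) - u t x - grad (u t) x \<bullet> h\<bar> \<le> C * (norm h)\<^sup>2"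
  using Hk_continuous_bounds(1)[OF k u_Hk u_cont, OF assms assms] taylor_of_second_difference[OF u_diff[OF assms]]
  by metis

lemma grad_cont:
  assumes "t \<in> {0..T}"
  shows "continuous_on UNIV (grad (u t))"
proof -
  obtain C where C: "\<And>x h. \<bar>u t (x + h) - u t x - grad (u t) x \<bullet> h\<bar> \<le> C * (norm h)\<^sup>2"
    using u_taylor[OF assms] by auto
  have "C \<ge> 0" using C[of 0 "axis 1 1"] by (simp add: norm_axis_1)
  then have "(6 * C)-lipschitz_on UNIV (grad (u t))"
    using grad_lipschitz_of_taylor[of "u t" C, OF C] by (intro lipschitz_onI) (auto simp: dist_norm)
  then show ?thesis by (rule lipschitz_on_continuous_on)
qed

text \<open>By \<open>grad_bound_of_taylor\<close> the gradient of u s - u t is at most 2 M |s - t|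
  + M |s - t|, hence the factor 3. This limits how fast the Lipschitz constant can vary in
  time.\<close>

lemma time_regularity:
  assumes "t \<in> {0..T}"
  obtains M \<delta> where "\<delta> > 0" "M \<ge> 0"
    "\<And>s x. s \<in> {0..T} \<Longrightarrow> \<bar>s - t\<bar> < \<delta> \<Longrightarrow> \<bar>u s x - u t x\<bar> \<le> M * \<bar>s - t\<bar>"
    "\<And>s x y. s \<in> {0..T} \<Longrightarrow> \<bar>s - t\<bar> < \<delta> \<Longrightarrow> \<bar>(u s x - u t x) - (u s y - u t y)\<bar> \<le> M * \<bar>s - t\<bar> * norm (x - y)"
proof -
  obtain M \<delta> where M: "\<delta> > 0" "M \<ge> 0"
    "\<And>s x. s \<in> {0..T} \<Longrightarrow> \<bar>s - t\<bar> < \<delta> \<Longrightarrow> \<bar>u s x - u t x\<bar> \<le> M * \<bar>s - t\<bar>"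
    "\<And>s x h. s \<in> {0..T} \<Longrightarrow> \<bar>s - t\<bar> < \<delta> \<Longrightarrow>
       \<bar>(u s (x + h) - u t (x + h)) - 2 * (u s x - u t x) + (u s (x - h) - u t (x - h))\<bar> \<le> M * \<bar>s - t\<bar> * (norm h)\<^sup>2"
    using C1_Hk_lipschitz_in_time[OF k C1 assms u_cont] by metis
  show ?thesis
  proof (rule that[of \<delta> "3 * M"])
    fix s assume s: "s \<in> {0..T}" "\<bar>s - t\<bar> < \<delta>"
    show "\<bar>u s x - u t x\<bar> \<le> 3 * M * \<bar>s - t\<bar>" for x
    proof -
      have "M * \<bar>s - t\<bar> \<ge> 0" using M by simp
      then show ?thesis using M(3)[OF s, of x] by simp
    qed
    let ?d = "\<lambda>x. u s x - u t x"
    have d: "?d differentiable (at x)" for x using u_diff s assms by (intro differentiable_diff) auto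
    have "norm (grad ?d x) \<le> 2 * (M * \<bar>s - t\<bar>) + M * \<bar>s - t\<bar>" for x
      using taylor_of_second_difference[OF d M(4)[OF s]] M(3)[OF s] by (rule grad_bound_of_taylor)
    from lipschitz_of_grad_bound[OF d this]
    show "\<bar>?d x - ?d y\<bar> \<le> 3 * M * \<bar>s - t\<bar> * norm (x - y)" for x y
      by (simp add: algebra_simps)
  qed (use M in auto)
qed

lemma joint_cont: "continuous_on (UNIV \<times> {0..T}) (\<lambda>(x, t). u t x)"
  unfolding continuous_on_iff
proof (intro ballI allI impI)
  fix p :: "(real^2) \<times> real" and e :: real
  assume p: "p \<in> UNIV \<times> {0..T}" and e: "0 < e"
  obtain x t where [simp]: "p = (x, t)" by (cases p)
  have t: "t \<in> {0..T}" using p by simp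
  obtain M \<delta> where M: "\<delta> > 0" "M \<ge> 0"
    "\<And>s x. s \<in> {0..T} \<Longrightarrow> \<bar>s - t\<bar> < \<delta> \<Longrightarrow> \<bar>u s x - u t x\<bar> \<le> M * \<bar>s - t\<bar>"
    using time_regularity[OF t] by metis
  obtain r where r: "r > 0" "\<And>y. dist y x < r \<Longrightarrow> \<bar>u t y - u t x\<bar> < e / 2"
    using u_cont[OF t] e unfolding continuous_on_iff by (metis UNIV_I dist_real_def half_gt_zero)
  define d where "d = Min {\<delta>, r, e / (2 * (M + 1))}"
  have d: "d > 0" "d \<le> \<delta>" "d \<le> r" "d \<le> e / (2 * (M + 1))" using M r e by (auto simp: d_def)
  show "\<exists>d>0. \<forall>q\<in>UNIV \<times> {0..T}. dist q p < d \<longrightarrow> dist (case q of (x, t) \<Rightarrow> u t x) (case p of (x, t) \<Rightarrow> u t x) < e"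
  proof (intro exI[of _ d] conjI ballI impI)
    fix q assume q: "q \<in> UNIV \<times> {0..T}" "dist q p < d"
    obtain y s where [simp]: "q = (y, s)" by (cases q)
    have yx: "dist y x < d" using q(2) dist_fst_le[of q p] by simp
    have st: "\<bar>s - t\<bar> < d" using q(2) dist_snd_le[of q p] by (simp add: dist_real_def)
    have "\<bar>u s y - u t y\<bar> \<le> M * \<bar>s - t\<bar>" using q(1) st d by (intro M(3)) auto
    also have "\<dots> \<le> M * (e / (2 * (M + 1)))" using st d M by (intro mult_left_mono) auto
    also have "\<dots> < e / 2" using M e by (simp add: field_simps)
    finally have "\<bar>u s y - u t y\<bar> < e / 2" .
    moreover have "\<bar>u t y - u t x\<bar> < e / 2" using yx d by (intro r(2)) auto
    ultimately have "\<bar>u s y - u t x\<bar> < e" by linarith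
    then show "dist (case q of (x, t) \<Rightarrow> u t x) (case p of (x, t) \<Rightarrow> u t x) < e"
      by (simp add: dist_real_def)
  qed (use d in auto)
qed

text \<open>Each time has its own radius with c/2 to spare, and Lipschitz continuity in time,
  uniform in x, carries that radius to nearby times. Bisection of [0, T] plays the role of a finite
  cover.\<close>

lemma uniform_decay:
  assumes "0 \<le> T" "c > 0"
  obtains R where "\<And>t x. t \<in> {0..T} \<Longrightarrow> norm x > R \<Longrightarrow> \<bar>u t x\<bar> < c"
proof -
  \<comment> \<open>The intersection with [0, T] is taken because the bisection principle asks about
    small intervals that may stick out at the ends.\<close>
  define Q where "Q a b \<longleftrightarrow> (\<exists>R. \<forall>t\<in>{a..b} \<inter> {0..T}. \<forall>x. norm x > R \<longrightarrow> \<bar>u t x\<bar> < c)" for a b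
  have "Q 0 T"
  proof (rule Bolzano[OF assms(1)])
    fix a b d assume "Q a b" "Q b d" "a \<le> b" "b \<le> d"
    then obtain R1 R2 where "\<forall>t\<in>{a..b} \<inter> {0..T}. \<forall>x. norm x > R1 \<longrightarrow> \<bar>u t x\<bar> < c"
      "\<forall>t\<in>{b..d} \<inter> {0..T}. \<forall>x. norm x > R2 \<longrightarrow> \<bar>u t x\<bar> < c" unfolding Q_def by blast
    then have "\<forall>t\<in>{a..d} \<inter> {0..T}. \<forall>x. norm x > max R1 R2 \<longrightarrow> \<bar>u t x\<bar> < c"
      by (metis IntD1 IntD2 IntI atLeastAtMost_iff linear max_less_iff_conj)
    then show "Q a d" unfolding Q_def by blast
  next
    fix t assume "0 \<le> t" "t \<le> T"
    then have t: "t \<in> {0..T}" by simp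
    obtain M \<delta> where M: "\<delta> > 0" "M \<ge> 0"
      "\<And>s x. s \<in> {0..T} \<Longrightarrow> \<bar>s - t\<bar> < \<delta> \<Longrightarrow> \<bar>u s x - u t x\<bar> \<le> M * \<bar>s - t\<bar>"
      using time_regularity[OF t] by metis
    obtain R where R: "\<And>x. norm x > R \<Longrightarrow> \<bar>u t x\<bar> < c / 2"
      using Hk_continuous_bounds(2)[OF k u_Hk[OF t] u_cont[OF t], of "c / 2"] assms by auto
    define d where "d = min \<delta> (c / (2 * (M + 1)))"
    have d: "d > 0" using M assms by (simp add: d_def)
    have "Q a b" if ab: "a \<le> t" "t \<le> b" "b - a < d" for a b
      unfolding Q_def
    proof (intro exI[of _ R] ballI allI impI)
      fix s and x :: "real^2" assume s: "s \<in> {a..b} \<inter> {0..T}" and x: "norm x > R"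
      have sd: "\<bar>s - t\<bar> < d" using s ab by auto
      then have "\<bar>u s x - u t x\<bar> \<le> M * \<bar>s - t\<bar>" using s by (intro M(3)) (auto simp: d_def)
      also have "\<dots> \<le> M * (c / (2 * (M + 1)))" using sd M by (intro mult_left_mono) (auto simp: d_def)
      also have "\<dots> \<le> c / 2" using M assms by (simp add: field_simps)
      finally show "\<bar>u s x\<bar> < c" using R[OF x] by linarith
    qed
    then show "\<exists>d>0. \<forall>a b. a \<le> t \<and> t \<le> b \<and> b - a < d \<longrightarrow> Q a b" using d by blast
  qed
  then obtain R where "\<forall>t\<in>{0..T} \<inter> {0..T}. \<forall>x. norm x > R \<longrightarrow> \<bar>u t x\<bar> < c"
    unfolding Q_def by blast
  then show ?thesis by (intro that[of R]) auto
qed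

lemma time_derivative:
  assumes "t \<in> {0..T}"
  shows "\<exists>D. ((\<lambda>s. u s x) has_real_derivative D) (at t within {0..T}) \<and>
    has_pv_integral (\<lambda>y. ((grad (u t) x - grad (u t) (x - y)) \<bullet> y) /
      ((norm y)\<^sup>2 + (u t x - u t (x - y))\<^sup>2) powr ((3 + \<alpha>) / 2)) D"
  using sol assms unfolding is_solution_def u_def by blast

text \<open>At a maximum point the gradient of the increment vanishes, which gives
  \<open>grad_eq\<close>. The equation then writes the time derivative as the difference of the two
  principal values in \<open>pv_comparison\<close>.\<close>

lemma increment_derivative_nonpos:
  assumes t: "t \<in> {0..T}" and L: "lip L t" "(5 + \<alpha>) * L\<^sup>2 \<le> 1 + \<alpha>"
    and max: "\<And>z. u t (z + h) - u t z \<le> u t (x + h) - u t x"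
  obtains D where "((\<lambda>s. u s (x + h) - u s x) has_real_derivative D) (at t within {0..T})" "D \<le> 0"
proof -
  obtain C where C: "\<And>x h. \<bar>u t (x + h) - u t x - grad (u t) x \<bullet> h\<bar> \<le> C * (norm h)\<^sup>2"
    using u_taylor[OF t] by auto
  have "\<exists>F. \<forall>q::real. (F has_real_derivative (1 + q\<^sup>2) powr (- ((3 + \<alpha>) / 2))) (at q)"
  proof -
    have "1 + x\<^sup>2 \<noteq> 0" for x :: real using zero_le_power2[of x] by linarith
    then have "isCont (\<lambda>q. (1 + q\<^sup>2) powr (- ((3 + \<alpha>) / 2))) x" for x :: real
      by (intro continuous_intros) auto
    then show ?thesis
      using einterval_antiderivative[of "-\<infinity>" "\<infinity>" "\<lambda>q. (1 + q\<^sup>2) powr (- ((3 + \<alpha>) / 2))"]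
      by (auto simp: has_real_derivative_iff_has_vector_derivative)
  qed
  then obtain \<Psi> where \<Psi>: "\<And>q. (\<Psi> has_real_derivative (1 + q\<^sup>2) powr (- ((3 + \<alpha>) / 2))) (at q)" by auto
  have grad_eq: "grad (u t) (x + h) = grad (u t) x"
  proof -
    have "((\<lambda>z. u t (z + h)) has_derivative (\<lambda>v. grad (u t) (x + h) \<bullet> v)) (at x)"
      by (rule has_derivative_compose[OF _ has_derivative_grad[OF u_diff[OF t]], of "\<lambda>z. z + h" "\<lambda>v. v"])
        (auto intro!: derivative_eq_intros)
    then have "((\<lambda>z. u t (z + h) - u t z) has_derivative (\<lambda>v. grad (u t) (x + h) \<bullet> v - grad (u t) x \<bullet> v)) (at x)"
      by (intro has_derivative_diff has_derivative_grad u_diff t)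
    from differential_zero_maxmin[OF UNIV_I open_UNIV this] max
    have "(\<lambda>v. grad (u t) (x + h) \<bullet> v - grad (u t) x \<bullet> v) = (\<lambda>v. 0)" by blast
    then have "\<forall>v. grad (u t) (x + h) \<bullet> v = grad (u t) x \<bullet> v" by (auto dest: fun_cong)
    then show ?thesis using vector_eq_rdot by blast
  qed
  interpret comparison \<alpha> L C "u t" x h \<Psi>
    by unfold_locales (use \<alpha> L u_diff[OF t] grad_cont[OF t] grad_eq max C \<Psi> in \<open>auto simp: lip_def\<close>)
  obtain D1 D0 where D: "((\<lambda>s. u s (x + h)) has_real_derivative D1) (at t within {0..T})" "has_pv_integral (K (x + h)) D1"
    "((\<lambda>s. u s x) has_real_derivative D0) (at t within {0..T})" "has_pv_integral (K x) D0"
    using time_derivative[OF t, of "x + h"] time_derivative[OF t, of x] unfolding K_def[abs_def] by blast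
  show ?thesis
    using DERIV_diff[OF D(1,3)] pv_comparison[OF D(2,4)] by (intro that) auto
qed

text \<open>A maximum principle for the increments by a fixed h. If one exceeds M0 |h|, tilt it by
  -\<eta> (t - a) and maximise over space and time. At the maximum, which lies after time a, the
  tilted time derivative is at most -\<eta>, so slightly earlier values are larger: a contradiction.
  L is the a priori bound that keeps the comparison available, M0 the bound being
  propagated.\<close>

lemma lip_propagates:
  assumes ab: "0 \<le> a" "b \<le> T" and M0: "M0 \<ge> 0" "lip M0 a"
    and L: "(5 + \<alpha>) * L\<^sup>2 \<le> 1 + \<alpha>" "\<And>t. t \<in> {a..b} \<Longrightarrow> lip L t"
    and t1: "t1 \<in> {a..b}"
  shows "lip M0 t1"
proof -
  have key: "u t1 (x1 + h) - u t1 x1 \<le> M0 * norm h" for x1 h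
  proof (rule ccontr)
    define g where "g x t = u t (x + h) - u t x" for x t
    assume "\<not> u t1 (x1 + h) - u t1 x1 \<le> M0 * norm h"
    then have gt: "g x1 t1 > M0 * norm h" by (simp add: g_def)
    \<comment> \<open>Up to time t1 the tilt consumes at most half of the excess over M0 |h|; the
      added 1 keeps the denominator positive when t1 = a.\<close>
    define \<eta> where "\<eta> = (g x1 t1 - M0 * norm h) / (2 * (t1 - a + 1))"
    have ta: "t1 - a \<ge> 0" using t1 by simp
    have \<eta>: "\<eta> > 0" using gt ta by (simp add: \<eta>_def)
    define G where "G x t = g x t - \<eta> * (t - a)" for x t
    define c where "c = G x1 t1"
    have c: "c > M0 * norm h"
    proof -
      have "\<eta> * (t1 - a) \<le> (g x1 t1 - M0 * norm h) / 2"
        using gt ta by (simp add: \<eta>_def field_simps)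
      then show ?thesis using gt by (simp add: c_def G_def)
    qed
    have c0: "c > 0" using c M0 mult_nonneg_nonneg[OF M0(1) norm_ge_zero[of h]] by linarith
    have sub: "{a..t1} \<subseteq> {0..T}" using ab t1 by auto
    have T: "0 \<le> T" using ab t1 by auto
    obtain R where R: "\<And>t x. t \<in> {0..T} \<Longrightarrow> norm x > R \<Longrightarrow> \<bar>u t x\<bar> < c / 2"
      using uniform_decay[OF T, of "c / 2"] c0 by auto
    \<comment> \<open>Beyond this radius both x and x + h are farther than R from the origin, so the
      tilted increment stays below c and the maximum over B is global.\<close>
    define B where "B = cball (0::real^2) (\<bar>R\<bar> + norm h) \<times> {a..t1}"
    have contG: "continuous_on B (\<lambda>(x, t). G x t)"
    proof -
      have *: "continuous_on B (\<lambda>p. u (snd p) (fst p + w))" for w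
        using continuous_on_compose2[OF joint_cont, of B "\<lambda>p. (fst p + w, snd p)"] sub
        by (force simp: B_def intro!: continuous_intros)
      have "continuous_on B (\<lambda>p. u (snd p) (fst p + h) - u (snd p) (fst p + 0) - \<eta> * (snd p - a))"
        by (intro continuous_intros *)
      then show ?thesis by (simp add: G_def g_def case_prod_unfold)
    qed
    have outside: "G x t < c" if "t \<in> {a..t1}" "(x, t) \<notin> B" for x t
    proof -
      have "norm x > \<bar>R\<bar> + norm h" using that by (auto simp: B_def)
      moreover have "norm (x + h) \<ge> norm x - norm h" using norm_diff_ineq[of x h] by simp
      ultimately have "norm x > R" "norm (x + h) > R" using norm_ge_zero[of h] by linarith+
      then have "\<bar>u t x\<bar> < c / 2" "\<bar>u t (x + h)\<bar> < c / 2" using R that sub by auto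
      moreover have "\<eta> * (t - a) \<ge> 0" using \<eta> that by simp
      ultimately show ?thesis by (simp add: G_def g_def)
    qed
    have x1B: "(x1, t1) \<in> B" using outside[of t1 x1] t1 by (force simp: c_def)
    have "compact B" unfolding B_def by (intro compact_Times) auto
    from continuous_attains_sup[OF this _ contG] x1B
    obtain x t where xt: "(x, t) \<in> B" "\<And>y s. (y, s) \<in> B \<Longrightarrow> G y s \<le> G x t" by fastforce
    have tt: "t \<in> {a..t1}" using xt(1) by (simp add: B_def)
    have Gc: "G x t \<ge> c" using xt(2)[OF x1B] by (simp add: c_def)
    have max: "G y s \<le> G x t" if "s \<in> {a..t1}" for y s
      using xt(2)[of y s] outside[OF that, of y] Gc by (cases "(y, s) \<in> B") auto
    \<comment> \<open>At time a the tilt vanishes and the increment is at most M0 |h| < c. Having t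
      > a leaves earlier times to compare with.\<close>
    have "t \<noteq> a"
    proof
      assume "t = a"
      have "u a (x + h) - u a x \<le> M0 * norm h" using M0(2) unfolding lip_def by (metis abs_le_D1 add_diff_cancel_left')
      then show False using Gc c \<open>t = a\<close> by (simp add: G_def g_def)
    qed
    then have ta': "a < t" using tt by simp
    have tT: "t \<in> {0..T}" using tt sub by auto
    have "lip L t" using L(2) tt t1 by auto
    moreover have "u t (z + h) - u t z \<le> u t (x + h) - u t x" for z
      using max[OF tt, of z] by (simp add: G_def g_def)
    ultimately obtain D where D: "((\<lambda>s. u s (x + h) - u s x) has_real_derivative D) (at t within {0..T})" "D \<le> 0"
      using increment_derivative_nonpos[OF tT _ L(1)] by metis
    have "((\<lambda>s. G x s) has_real_derivative D - \<eta>) (at t within {0..T})"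
      unfolding G_def g_def
      by (rule DERIV_cong[OF DERIV_diff[OF D(1) DERIV_cmult[OF DERIV_diff[OF DERIV_ident DERIV_const]]]]) simp
    moreover have "D - \<eta> < 0" using D(2) \<eta> by simp
    \<comment> \<open>The contradiction comes from times before t, so the derivative within [0, T]
      suffices even when t = T.\<close>
    ultimately obtain d where d: "d > 0" "\<And>s. s > 0 \<Longrightarrow> t - s \<in> {0..T} \<Longrightarrow> s < d \<Longrightarrow> G x t < G x (t - s)"
      using has_real_derivative_neg_dec_left by metis
    define s where "s = min (d / 2) (t - a)"
    have s: "s > 0" "s < d" "t - s \<in> {a..t1}" using d ta' tt by (auto simp: s_def)
    then show False using d(2)[of s] max[OF s(3), of x] sub by auto
  qed
  show ?thesis unfolding lip_def
  proof (intro allI)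
    fix x y
    show "\<bar>u t1 x - u t1 y\<bar> \<le> M0 * norm (x - y)"
      using key[of y "x - y"] key[of x "y - x"] by (simp add: norm_minus_commute)
  qed
qed

text \<open>A continuity argument: on a short interval the Lipschitz constant cannot use up the gap
  L - M0, so \<open>lip_propagates\<close> applies and returns M0, restoring the full gap for the
  next interval. Bisection glues the intervals.\<close>

lemma lip_preserved:
  assumes M0: "0 \<le> M0" "M0 < L" "lip M0 0" and L: "(5 + \<alpha>) * L\<^sup>2 \<le> 1 + \<alpha>" and t: "t \<in> {0..T}"
  shows "lip M0 t"
proof -
  \<comment> \<open>An implication from the left endpoint, so that adjacent intervals
    compose.\<close>
  define Q where "Q a b \<longleftrightarrow> (0 \<le> a \<longrightarrow> b \<le> T \<longrightarrow> lip M0 a \<longrightarrow> (\<forall>t\<in>{a..b}. lip M0 t))" for a b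
  have T: "0 \<le> T" using t by auto
  have "Q 0 T"
  proof (rule Bolzano[OF T])
    fix a b c assume "Q a b" "Q b c" "a \<le> b" "b \<le> c"
    then show "Q a c" unfolding Q_def by (metis atLeastAtMost_iff linear order_trans)
  next
    fix x assume "0 \<le> x" "x \<le> T"
    then have x: "x \<in> {0..T}" by simp
    obtain M \<delta> where M: "\<delta> > 0" "M \<ge> 0"
      "\<And>s y z. s \<in> {0..T} \<Longrightarrow> \<bar>s - x\<bar> < \<delta> \<Longrightarrow> \<bar>(u s y - u x y) - (u s z - u x z)\<bar> \<le> M * \<bar>s - x\<bar> * norm (y - z)"
      using time_regularity[OF x] by metis
    \<comment> \<open>The times a and s are both compared with x, and each comparison may use half
      of the gap.\<close>
    define d where "d = min \<delta> ((L - M0) / (2 * (M + 1)))"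
    have d: "d > 0" using M M0 by (simp add: d_def)
    have "Q a b" if ab: "a \<le> x" "x \<le> b" "b - a < d" for a b
      unfolding Q_def
    proof (intro impI ballI)
      fix t1 assume a: "0 \<le> a" and b: "b \<le> T" and la: "lip M0 a" and t1: "t1 \<in> {a..b}"
      have close: "\<bar>(u s y - u x y) - (u s z - u x z)\<bar> \<le> (L - M0) / 2 * norm (y - z)" if "s \<in> {a..b}" for s y z
      proof -
        have sd: "\<bar>s - x\<bar> < d" using that ab by auto
        have "\<bar>(u s y - u x y) - (u s z - u x z)\<bar> \<le> M * \<bar>s - x\<bar> * norm (y - z)"
          using that a b sd by (intro M(3)) (auto simp: d_def)
        also have "\<dots> \<le> M * ((L - M0) / (2 * (M + 1))) * norm (y - z)"
          using sd M by (intro mult_right_mono mult_left_mono) (auto simp: d_def)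
        also have "\<dots> \<le> (L - M0) / 2 * norm (y - z)"
          using M M0 by (intro mult_right_mono) (auto simp: field_simps)
        finally show ?thesis .
      qed
      have "lip L s" if s: "s \<in> {a..b}" for s
        unfolding lip_def
      proof (intro allI)
        fix y z
        have aab: "a \<in> {a..b}" using ab by auto
        have "\<bar>u a y - u a z\<bar> \<le> M0 * norm (y - z)" using la by (simp add: lip_def)
        moreover have "(L - M0) / 2 * norm (y - z) + (L - M0) / 2 * norm (y - z) + M0 * norm (y - z) = L * norm (y - z)"
          by (simp add: field_simps)
        ultimately show "\<bar>u s y - u s z\<bar> \<le> L * norm (y - z)"
          using close[OF s, of y z] close[OF aab, of y z] by linarith
      qed
      then show "lip M0 t1" using lip_propagates[OF a b M0(1) la L _ t1] by blast
    qed
    then show "\<exists>d>0. \<forall>a b. a \<le> x \<and> x \<le> b \<and> b - a < d \<longrightarrow> Q a b" using d by blast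
  qed
  then show ?thesis using M0(3) t T unfolding Q_def by auto
qed

end

theorem theorem4p4:
  fixes \<alpha> \<epsilon> T :: real and k :: nat
    and f0 :: "real^2 \<Rightarrow> real" and f :: "real^2 \<Rightarrow> real \<Rightarrow> real"
  assumes "0 \<le> \<alpha>" "\<alpha> < 1"
    and "0 < \<epsilon>" "\<epsilon> < 1 + \<alpha>"
    and "k \<ge> 4"
    and "Hk k f0"
    and "\<forall>x. f0 differentiable (at x)"
    and "Linf_grad f0 < ereal (sqrt ((1 + \<alpha> - \<epsilon>) / (5 + \<alpha> + \<epsilon>)))"
    and "is_solution \<alpha> k T f0 f"
    and "\<forall>g. is_solution \<alpha> k T f0 g \<longrightarrow> (\<forall>x. \<forall>t\<in>{0..T}. g x t = f x t)"
  shows "\<forall>t\<in>{0..T}. Linf_grad (\<lambda>x. f x t) \<le> Linf_grad f0"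
proof
  fix t assume t: "t \<in> {0..T}"
  interpret muskat \<alpha> T k f0 f by unfold_locales (use assms in auto)
  have T: "0 \<in> {0..T}" using t by auto
  have u0: "u 0 = f0" using assms(9) by (simp add: u_def is_solution_def)
  have meas: "(\<lambda>x. ereal (norm (grad (u s) x))) \<in> borel_measurable lborel" if "s \<in> {0..T}" for s
    using borel_measurable_continuous_onI[OF grad_cont[OF that]] by simp
  \<comment> \<open>The essential supremum is nonnegative and, by hypothesis, below a real number,
    so it is itself a real number M0.\<close>
  have "esssup lborel (\<lambda>x::real^2. 0 :: ereal) \<le> Linf_grad f0"
    unfolding Linf_grad_def by (rule esssup_mono) auto
  then have "0 \<le> Linf_grad f0" by (subst (asm) esssup_const) auto
  then obtain M0 where M0: "Linf_grad f0 = ereal M0" "M0 \<ge> 0"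
    using assms(8) by (cases "Linf_grad f0") auto
  have "AE x in lborel. ereal (norm (grad f0 x)) \<le> ereal M0"
    using esssup_AE[of "\<lambda>x. ereal (norm (grad f0 x))" lborel] M0(1) by (simp add: Linf_grad_def)
  then have "AE x in lborel. norm (grad (u 0) x) \<le> M0" by (simp add: u0)
  \<comment> \<open>The gradient at time 0 is continuous by the H^k regularity, so the almost
    everywhere bound holds at every point.\<close>
  from AE_le_continuous[OF continuous_on_norm[OF grad_cont[OF T]] this]
  have "norm (grad (u 0) x) \<le> M0" for x .
  then have lip0: "lip M0 0" unfolding lip_def using lipschitz_of_grad_bound[OF u_diff[OF T]] by blast
  \<comment> \<open>The largest slope that \<open>H_antimono\<close> admits. It is the assumed
    threshold at \<epsilon> = 0; the threshold decreases in \<epsilon>, which gives M0 < L.\<close>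
  define L where "L = sqrt ((1 + \<alpha>) / (5 + \<alpha>))"
  have "(5 + \<alpha>) * L\<^sup>2 \<le> 1 + \<alpha>" using assms by (simp add: L_def)
  moreover have "M0 < L"
  proof -
    have "(1 + \<alpha> - \<epsilon>) / (5 + \<alpha> + \<epsilon>) \<le> (1 + \<alpha>) / (5 + \<alpha>)"
      using assms by (intro frac_le) auto
    then have "sqrt ((1 + \<alpha> - \<epsilon>) / (5 + \<alpha> + \<epsilon>)) \<le> L" by (simp add: L_def)
    then show ?thesis using assms(8) M0(1) by simp
  qed
  ultimately have "lip M0 t" using lip_preserved[OF M0(2) _ lip0 _ t] by blast
  then have "norm (grad (u t) x) \<le> M0" for x
    by (intro grad_bound_of_lipschitz[OF u_diff[OF t]]) (auto simp: lip_def)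
  then have "Linf_grad (u t) \<le> ereal M0"
    unfolding Linf_grad_def by (intro esssup_I meas[OF t]) auto
  then show "Linf_grad (\<lambda>x. f x t) \<le> Linf_grad f0" by (simp add: M0(1) u_def)
qed

end
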